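(* A ring extension $R\subseteq S$ of finite type is a ring epimorphism (i.e. the inclusion $R\to S$ is an epimorphism in the category of commutative rings) if and only if it is radicial and unramified. Therefore, an integral FCP extension $R\subseteq S$ is trivial (i.e. $R=S$) when it is radicial and unramified.
   Context: All rings are commutative and unital. $[R,S]$ is the set of all $R$-subalgebras of $S$; $R\subseteq S$ has FCP if each chain in $[R,S]$ (ordered by inclusion) is finite. An extension $R\subseteq S$ is an $i$-extension if $\mathrm{Spec}(S)\to\mathrm{Spec}(R)$ is injective. For $Q\in\mathrm{Spec}(S)$ the residual extension at $Q$ is $\kappa_R(Q\cap R)\to\kappa_S(Q)$, where $\kappa_R(P)=R_P/PR_P$. The extension is $\kappa$-radicial if all its residual extensions are purely inseparable (called radicial) field extensions, and radicial if it is a $\kappa$-radicial $i$-extension (equivalently, $R\to S$ is universally injective on spectra). A ring morphism $R\to S$ is unramified if $S$ is of finite type as an $R$-algebra and the module of differentials $\Omega_R(S)=I/I^2$ is zero, where $I$ is the kernel of the multiplication map $S\otimes_RS\to S$. *)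

theory Defs
  imports "HOL-Algebra.Algebra" "HOL-Library.Poly_Mapping"
begin

text \<open>
  A ring extension \<open>R \<subseteq> S\<close> is given by a commutative ring \<open>S\<close> and a subring \<open>R\<close> of it;
  as a ring of its own, the base is \<open>S\<lparr>carrier := R\<rparr>\<close>.
\<close>

section \<open>Subextensions, finite type, integrality\<close>

definition subalgebras :: "'a set \<Rightarrow> ('a, 'b) ring_scheme \<Rightarrow> 'a set set" where
  "subalgebras R S = {T. subring T S \<and> R \<subseteq> T}"

definition FCP_extension :: "'a set \<Rightarrow> ('a, 'b) ring_scheme \<Rightarrow> bool" where
  "FCP_extension R S \<longleftrightarrow> (\<forall>C. subset.chain (subalgebras R S) C \<longrightarrow> finite C)"

definition finite_type :: "'a set \<Rightarrow> ('a, 'b) ring_scheme \<Rightarrow> bool" where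
  "finite_type R S \<longleftrightarrow>
     (\<exists>A. finite A \<and> A \<subseteq> carrier S \<and> generate_ring S (R \<union> A) = carrier S)"

text \<open>The list \<open>\<one> # p\<close> is the coefficient list, leading coefficient first, of a monic polynomial.\<close>

definition integral_extension :: "'a set \<Rightarrow> ('a, 'b) ring_scheme \<Rightarrow> bool" where
  "integral_extension R S \<longleftrightarrow>
     (\<forall>x \<in> carrier S. \<exists>p. set p \<subseteq> R \<and> ring.eval S (\<one>\<^bsub>S\<^esub> # p) x = \<zero>\<^bsub>S\<^esub>)"

section \<open>Epimorphisms of commutative rings\<close>

text \<open>
  HOL cannot quantify over all types inside a formula, so the test rings are those carried by
  the type \<open>('b \<times> 'b) list\<close>.  This is no restriction: if \<open>g\<close> and \<open>h\<close> are two morphisms from \<open>B\<close>,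
  then the subring generated by their images consists of the finite sums of products \<open>g x * h y\<close>,
  so it is isomorphic to a ring carried by \<open>('b \<times> 'b) list\<close>.  The lemma \<open>ring_epimorphism_any\<close>
  proves the cancellation property for test rings over an arbitrary type.
\<close>

definition ring_epimorphism ::
    "('a, 'm) ring_scheme \<Rightarrow> ('b, 'n) ring_scheme \<Rightarrow> ('a \<Rightarrow> 'b) \<Rightarrow> bool" where
  "ring_epimorphism A B f \<longleftrightarrow> f \<in> ring_hom A B \<and>
     (\<forall>T :: ('b \<times> 'b) list ring. cring T \<longrightarrow>
       (\<forall>g \<in> ring_hom B T. \<forall>h \<in> ring_hom B T.
          (\<forall>a \<in> carrier A. g (f a) = h (f a)) \<longrightarrow> (\<forall>b \<in> carrier B. g b = h b)))"

section \<open>Localizations and residue fields\<close>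

definition frac_rel :: "('a, 'b) ring_scheme \<Rightarrow> 'a set \<Rightarrow> (('a \<times> 'a) \<times> ('a \<times> 'a)) set" where
  "frac_rel R M = {((r, s), (r', s')) | r s r' s'.
     r \<in> carrier R \<and> s \<in> M \<and> r' \<in> carrier R \<and> s' \<in> M \<and>
     (\<exists>t \<in> M. t \<otimes>\<^bsub>R\<^esub> (r \<otimes>\<^bsub>R\<^esub> s' \<ominus>\<^bsub>R\<^esub> r' \<otimes>\<^bsub>R\<^esub> s) = \<zero>\<^bsub>R\<^esub>)}"

definition fraction :: "('a, 'b) ring_scheme \<Rightarrow> 'a set \<Rightarrow> 'a \<Rightarrow> 'a \<Rightarrow> ('a \<times> 'a) set" where
  "fraction R M r s = frac_rel R M `` {(r, s)}"

definition localization :: "('a, 'b) ring_scheme \<Rightarrow> 'a set \<Rightarrow> ('a \<times> 'a) set ring" where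
  "localization R M =
     \<lparr>carrier = (carrier R \<times> M) // frac_rel R M,
      monoid.mult = (\<lambda>U V. \<Union>(r, s) \<in> U. \<Union>(r', s') \<in> V. fraction R M (r \<otimes>\<^bsub>R\<^esub> r') (s \<otimes>\<^bsub>R\<^esub> s')),
      one = fraction R M \<one>\<^bsub>R\<^esub> \<one>\<^bsub>R\<^esub>,
      ring.zero = fraction R M \<zero>\<^bsub>R\<^esub> \<one>\<^bsub>R\<^esub>,
      add = (\<lambda>U V. \<Union>(r, s) \<in> U. \<Union>(r', s') \<in> V.
               fraction R M (r \<otimes>\<^bsub>R\<^esub> s' \<oplus>\<^bsub>R\<^esub> r' \<otimes>\<^bsub>R\<^esub> s) (s \<otimes>\<^bsub>R\<^esub> s'))\<rparr>"

abbreviation local_ring :: "('a, 'b) ring_scheme \<Rightarrow> 'a set \<Rightarrow> ('a \<times> 'a) set ring" where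
  "local_ring R P \<equiv> localization R (carrier R - P)"

definition extended_ideal :: "('a, 'b) ring_scheme \<Rightarrow> 'a set \<Rightarrow> ('a \<times> 'a) set set" where
  "extended_ideal R P =
     Idl\<^bsub>local_ring R P\<^esub> ((\<lambda>r. fraction R (carrier R - P) r \<one>\<^bsub>R\<^esub>) ` P)"

definition residue_field :: "('a, 'b) ring_scheme \<Rightarrow> 'a set \<Rightarrow> ('a \<times> 'a) set set ring" where
  "residue_field R P = local_ring R P Quot extended_ideal R P"

definition residue_frac :: "('a, 'b) ring_scheme \<Rightarrow> 'a set \<Rightarrow> 'a \<Rightarrow> 'a \<Rightarrow> ('a \<times> 'a) set set" where
  "residue_frac R P r s =
     extended_ideal R P +>\<^bsub>local_ring R P\<^esub> fraction R (carrier R - P) r s"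

section \<open>Radicial extensions\<close>

text \<open>The residual extension at \<open>Q\<close> maps the class of \<open>r / s\<close> to the class of \<open>r / s\<close>.\<close>

definition residual_map ::
    "'a set \<Rightarrow> ('a, 'b) ring_scheme \<Rightarrow> 'a set \<Rightarrow> ('a \<times> 'a) set set \<Rightarrow> ('a \<times> 'a) set set" where
  "residual_map R S Q U =
     (THE V. \<exists>r \<in> R. \<exists>s \<in> R - Q.
        U = residue_frac (S\<lparr>carrier := R\<rparr>) (Q \<inter> R) r s \<and> V = residue_frac S Q r s)"

text \<open>The order of \<open>\<one>\<close> in the additive group is the characteristic (\<open>0\<close> for infinite order).\<close>

definition char_exponent :: "('a, 'b) ring_scheme \<Rightarrow> nat" where
  "char_exponent K = (let p = group.ord (add_monoid K) \<one>\<^bsub>K\<^esub> in if p = 0 then 1 else p)"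

definition purely_inseparable ::
    "('a, 'm) ring_scheme \<Rightarrow> ('b, 'n) ring_scheme \<Rightarrow> ('a \<Rightarrow> 'b) \<Rightarrow> bool" where
  "purely_inseparable K L f \<longleftrightarrow> field K \<and> field L \<and> f \<in> ring_hom K L \<and>
     (\<forall>y \<in> carrier L. \<exists>n :: nat. y [^]\<^bsub>L\<^esub> (char_exponent K ^ n) \<in> f ` carrier K)"

definition i_extension :: "'a set \<Rightarrow> ('a, 'b) ring_scheme \<Rightarrow> bool" where
  "i_extension R S \<longleftrightarrow> inj_on (\<lambda>Q. Q \<inter> R) {Q. primeideal Q S}"

definition kappa_radicial :: "'a set \<Rightarrow> ('a, 'b) ring_scheme \<Rightarrow> bool" where
  "kappa_radicial R S \<longleftrightarrow> (\<forall>Q. primeideal Q S \<longrightarrow>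
     purely_inseparable (residue_field (S\<lparr>carrier := R\<rparr>) (Q \<inter> R)) (residue_field S Q)
       (residual_map R S Q))"

definition radicial :: "'a set \<Rightarrow> ('a, 'b) ring_scheme \<Rightarrow> bool" where
  "radicial R S \<longleftrightarrow> kappa_radicial R S \<and> i_extension R S"

section \<open>Unramified extensions\<close>

text \<open>
  \<open>S \<otimes>\<^sub>R S\<close> is the quotient of the free abelian group on \<open>S \<times> S\<close>, made into a ring by
  \<open>(a, b) * (a', b') = (a * a', b * b')\<close>, by the ideal generated by the bilinearity relations.
  (The subgroup generated by these relations is already an ideal.)
\<close>

definition pair_ring :: "('a, 'b) ring_scheme \<Rightarrow> (('a \<times> 'a) \<Rightarrow>\<^sub>0 int) ring" where
  "pair_ring S =
     \<lparr>carrier = {f. Poly_Mapping.keys f \<subseteq> carrier S \<times> carrier S},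
      monoid.mult = (\<lambda>f g. frag_extend (\<lambda>x. frag_extend (\<lambda>y.
                frag_of (fst x \<otimes>\<^bsub>S\<^esub> fst y, snd x \<otimes>\<^bsub>S\<^esub> snd y)) g) f),
      one = frag_of (\<one>\<^bsub>S\<^esub>, \<one>\<^bsub>S\<^esub>),
      ring.zero = 0,
      add = (+)\<rparr>"

definition tensor_relations :: "'a set \<Rightarrow> ('a, 'b) ring_scheme \<Rightarrow> (('a \<times> 'a) \<Rightarrow>\<^sub>0 int) set" where
  "tensor_relations R S =
     {frag_of (a \<oplus>\<^bsub>S\<^esub> a', b) - frag_of (a, b) - frag_of (a', b) | a a' b.
        a \<in> carrier S \<and> a' \<in> carrier S \<and> b \<in> carrier S} \<union>
     {frag_of (a, b \<oplus>\<^bsub>S\<^esub> b') - frag_of (a, b) - frag_of (a, b') | a b b'.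
        a \<in> carrier S \<and> b \<in> carrier S \<and> b' \<in> carrier S} \<union>
     {frag_of (r \<otimes>\<^bsub>S\<^esub> a, b) - frag_of (a, r \<otimes>\<^bsub>S\<^esub> b) | r a b.
        r \<in> R \<and> a \<in> carrier S \<and> b \<in> carrier S}"

definition tensor_square :: "'a set \<Rightarrow> ('a, 'b) ring_scheme \<Rightarrow> (('a \<times> 'a) \<Rightarrow>\<^sub>0 int) set ring" where
  "tensor_square R S = pair_ring S Quot (Idl\<^bsub>pair_ring S\<^esub> (tensor_relations R S))"

text \<open>
  The multiplication map \<open>S \<otimes>\<^sub>R S \<rightarrow> S\<close>: all representatives of a coset have the same value
  under the additive extension of \<open>(a, b) \<mapsto> a * b\<close>.
\<close>

definition pair_mult :: "('a, 'b) ring_scheme \<Rightarrow> (('a \<times> 'a) \<Rightarrow>\<^sub>0 int) \<Rightarrow> 'a" where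
  "pair_mult S f = (\<Oplus>\<^bsub>S\<^esub>x \<in> Poly_Mapping.keys f.
     add_pow S (Poly_Mapping.lookup f x) (fst x \<otimes>\<^bsub>S\<^esub> snd x))"

definition tensor_mult :: "('a, 'b) ring_scheme \<Rightarrow> (('a \<times> 'a) \<Rightarrow>\<^sub>0 int) set \<Rightarrow> 'a" where
  "tensor_mult S U = the_elem (pair_mult S ` U)"

definition diagonal_ideal :: "'a set \<Rightarrow> ('a, 'b) ring_scheme \<Rightarrow> (('a \<times> 'a) \<Rightarrow>\<^sub>0 int) set set" where
  "diagonal_ideal R S = a_kernel (tensor_square R S) S (tensor_mult S)"

text \<open>The additive group of \<open>I / I\<^sup>2\<close>; the module structure is irrelevant for its vanishing.\<close>

definition differentials ::
    "'a set \<Rightarrow> ('a, 'b) ring_scheme \<Rightarrow> (('a \<times> 'a) \<Rightarrow>\<^sub>0 int) set set monoid" where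
  "differentials R S =
     add_monoid ((tensor_square R S)\<lparr>carrier := diagonal_ideal R S\<rparr>) Mod
       (diagonal_ideal R S \<cdot>\<^bsub>tensor_square R S\<^esub> diagonal_ideal R S)"

definition unramified :: "'a set \<Rightarrow> ('a, 'b) ring_scheme \<Rightarrow> bool" where
  "unramified R S \<longleftrightarrow> finite_type R S \<and> trivial_group (differentials R S)"

section \<open>Independence of the universe of test rings\<close>

lemma ring_epimorphism_any:
  fixes T :: "('c, 'd) ring_scheme" and B :: "('b, 'n) ring_scheme"
  assumes epi: "ring_epimorphism A B f" and B: "ring B" and T: "cring T"
    and g: "g \<in> ring_hom B T" and h: "h \<in> ring_hom B T"
    and eq: "\<And>a. a \<in> carrier A \<Longrightarrow> g (f a) = h (f a)" and b: "b \<in> carrier B"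
  shows "g b = h b"
proof -
  interpret B: ring B by fact
  interpret T: cring T by fact
  interpret g: ring_hom_ring B T g using g by (intro ring_hom_ringI2) unfold_locales
  interpret h: ring_hom_ring B T h using h by (intro ring_hom_ringI2) unfold_locales
  define L where "L = lists (carrier B \<times> carrier B)"
  define val where "val xs = foldr (\<lambda>p t. g (fst p) \<otimes>\<^bsub>T\<^esub> h (snd p) \<oplus>\<^bsub>T\<^esub> t) xs \<zero>\<^bsub>T\<^esub>" for xs
  have val_Nil [simp]: "val [] = \<zero>\<^bsub>T\<^esub>"
    and val_Cons [simp]: "val (p # xs) = g (fst p) \<otimes>\<^bsub>T\<^esub> h (snd p) \<oplus>\<^bsub>T\<^esub> val xs" for p xs
    by (simp_all add: val_def)
  have L_Nil [simp]: "[] \<in> L"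
    and L_Cons [simp]: "p # xs \<in> L \<longleftrightarrow> fst p \<in> carrier B \<and> snd p \<in> carrier B \<and> xs \<in> L" for p xs
    by (cases p; simp add: L_def)+
  have L_induct [consumes 1, case_names Nil Cons]: "P xs" if "xs \<in> L" and "P []"
    and "\<And>p xs. \<lbrakk>fst p \<in> carrier B; snd p \<in> carrier B; xs \<in> L; P xs\<rbrakk> \<Longrightarrow> P (p # xs)" for P xs
    using that by (induction xs) auto
  have val_closed [simp]: "val xs \<in> carrier T" if "xs \<in> L" for xs
    using that by (induction xs rule: L_induct) auto
  define W where "W = val ` L"
  have W_add: "x \<oplus>\<^bsub>T\<^esub> y \<in> W" if "x \<in> W" "y \<in> W" for x y
  proof -
    from that obtain xs ys where xs: "xs \<in> L" "x = val xs" and ys: "ys \<in> L" "y = val ys"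
      by (auto simp: W_def)
    have "xs @ ys \<in> L \<and> val (xs @ ys) = val xs \<oplus>\<^bsub>T\<^esub> val ys"
      using xs(1) ys(1) by (induction xs rule: L_induct) (auto simp: T.a_assoc)
    with xs ys show ?thesis unfolding W_def by (metis imageI)
  qed
  have W_single: "g x \<otimes>\<^bsub>T\<^esub> h y \<in> W" if "x \<in> carrier B" "y \<in> carrier B" for x y
  proof -
    have "[(x, y)] \<in> L" "val [(x, y)] = g x \<otimes>\<^bsub>T\<^esub> h y" using that by auto
    then show ?thesis unfolding W_def by (metis imageI)
  qed
  have W_carrier: "W \<subseteq> carrier T" by (auto simp: W_def)
  have W_zero: "\<zero>\<^bsub>T\<^esub> \<in> W" unfolding W_def by (metis L_Nil val_Nil imageI)
  have W_neg: "\<ominus>\<^bsub>T\<^esub> x \<in> W" if "x \<in> W" for x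
  proof -
    have "\<ominus>\<^bsub>T\<^esub> val xs \<in> W" if "xs \<in> L" for xs
      using that
    proof (induction xs rule: L_induct)
      case (Cons p xs)
      have "\<ominus>\<^bsub>T\<^esub> val (p # xs) = g (\<ominus>\<^bsub>B\<^esub> fst p) \<otimes>\<^bsub>T\<^esub> h (snd p) \<oplus>\<^bsub>T\<^esub> \<ominus>\<^bsub>T\<^esub> val xs"
        using Cons by (simp add: T.minus_add T.l_minus)
      with Cons show ?case by (metis B.a_inv_closed W_add W_single)
    qed (use W_zero in auto)
    with that show ?thesis by (auto simp: W_def)
  qed
  have W_mult: "x \<otimes>\<^bsub>T\<^esub> y \<in> W" if "x \<in> W" "y \<in> W" for x y
  proof -
    have single: "(g u \<otimes>\<^bsub>T\<^esub> h v) \<otimes>\<^bsub>T\<^esub> val ys \<in> W"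
      if "u \<in> carrier B" "v \<in> carrier B" "ys \<in> L" for u v ys
      using that(3)
    proof (induction ys rule: L_induct)
      case (Cons p ys)
      have "(g u \<otimes>\<^bsub>T\<^esub> h v) \<otimes>\<^bsub>T\<^esub> val (p # ys) =
          g (u \<otimes>\<^bsub>B\<^esub> fst p) \<otimes>\<^bsub>T\<^esub> h (v \<otimes>\<^bsub>B\<^esub> snd p) \<oplus>\<^bsub>T\<^esub> (g u \<otimes>\<^bsub>T\<^esub> h v) \<otimes>\<^bsub>T\<^esub> val ys"
        using Cons that by (simp add: T.r_distr T.m_ac)
      with Cons that show ?case by (metis B.m_closed W_add W_single)
    qed (use W_zero that in auto)
    have "val xs \<otimes>\<^bsub>T\<^esub> val ys \<in> W" if "xs \<in> L" "ys \<in> L" for xs ys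
      using that by (induction xs rule: L_induct) (auto simp: T.l_distr W_zero intro: W_add single)
    with that show ?thesis by (auto simp: W_def)
  qed
  have W_g: "g x \<in> W" and W_h: "h x \<in> W" if "x \<in> carrier B" for x
    using W_single[of x "\<one>\<^bsub>B\<^esub>"] W_single[of "\<one>\<^bsub>B\<^esub>" x] that by auto
  have W_one: "\<one>\<^bsub>T\<^esub> \<in> W" using W_g[of "\<one>\<^bsub>B\<^esub>"] by simp
  have "subring W T" by (rule T.subringI) (use W_carrier W_one W_neg W_mult W_add in auto)
  then have cW: "cring (T\<lparr>carrier := W\<rparr>)"
    using T.subcringI' T.subcring_iff W_carrier by blast
  define \<phi> where "\<phi> = inv_into L val"
  have val_\<phi> [simp]: "val (\<phi> x) = x" if "x \<in> W" for x
    using that by (simp add: \<phi>_def W_def f_inv_into_f)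
  define T' :: "('b \<times> 'b) list ring" where
    "T' = \<lparr>carrier = \<phi> ` W, monoid.mult = (\<lambda>u v. \<phi> (val u \<otimes>\<^bsub>T\<^esub> val v)), one = \<phi> \<one>\<^bsub>T\<^esub>,
           ring.zero = \<phi> \<zero>\<^bsub>T\<^esub>, add = (\<lambda>u v. \<phi> (val u \<oplus>\<^bsub>T\<^esub> val v))\<rparr>"
  have inj: "inj_on \<phi> W" by (metis inj_onI val_\<phi>)
  have iso: "\<phi> \<in> ring_iso (T\<lparr>carrier := W\<rparr>) T'"
    by (rule ring_iso_memI) (auto simp: T'_def bij_betw_def inj W_mult W_add)
  have "T'\<lparr>zero := \<phi> \<zero>\<^bsub>T\<lparr>carrier := W\<rparr>\<^esub>\<rparr> = T'" by (simp add: T'_def)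
  with cring.ring_iso_imp_img_cring[OF cW iso] have T': "cring T'" by simp
  have hom: "\<phi> \<circ> k \<in> ring_hom B T'" if "k \<in> ring_hom B T" "\<And>x. x \<in> carrier B \<Longrightarrow> k x \<in> W" for k
    using that unfolding ring_hom_def by (auto simp: T'_def)
  have "\<forall>a \<in> carrier A. (\<phi> \<circ> g) (f a) = (\<phi> \<circ> h) (f a)" using eq by simp
  with epi T' hom[OF g W_g] hom[OF h W_h] b have "(\<phi> \<circ> g) b = (\<phi> \<circ> h) b"
    unfolding ring_epimorphism_def by blast
  then show ?thesis using inj W_g[OF b] W_h[OF b] by (simp add: inj_on_def)
qed

section \<open>Residue fields are fields and residual maps are ring morphisms\<close>

locale mult_subset = cring R for R (structure) +
  fixes M
  assumes M_carrier: "M \<subseteq> carrier R" and M_one: "\<one> \<in> M"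
    and M_mult: "s \<in> M \<Longrightarrow> t \<in> M \<Longrightarrow> s \<otimes> t \<in> M"
begin

lemma MC [simp]: "s \<in> M \<Longrightarrow> s \<in> carrier R" using M_carrier by blast

declare M_one [simp] M_mult [simp]

lemma frac_rel_iff:
  "((r, s), (r', s')) \<in> frac_rel R M \<longleftrightarrow> r \<in> carrier R \<and> s \<in> M \<and> r' \<in> carrier R \<and> s' \<in> M \<and>
     (\<exists>t \<in> M. t \<otimes> (r \<otimes> s') = t \<otimes> (r' \<otimes> s))"
proof -
  have "t \<otimes> (r \<otimes> s' \<ominus> r' \<otimes> s) = \<zero> \<longleftrightarrow> t \<otimes> (r \<otimes> s') = t \<otimes> (r' \<otimes> s)"
    if "r \<in> carrier R" "s \<in> M" "r' \<in> carrier R" "s' \<in> M" "t \<in> M" for t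
  proof -
    have "t \<otimes> (r \<otimes> s' \<ominus> r' \<otimes> s) = t \<otimes> (r \<otimes> s') \<ominus> t \<otimes> (r' \<otimes> s)"
      using that by (simp add: a_minus_def r_distr r_minus)
    then show ?thesis using that by simp
  qed
  then show ?thesis unfolding frac_rel_def by blast
qed

lemma equiv_frac_rel: "equiv (carrier R \<times> M) (frac_rel R M)"
proof (rule equivI)
  show "frac_rel R M \<subseteq> (carrier R \<times> M) \<times> (carrier R \<times> M)" by (auto simp: frac_rel_iff)
  show "refl_on (carrier R \<times> M) (frac_rel R M)"
    using M_one by (auto simp: refl_on_def frac_rel_iff)
  show "sym (frac_rel R M)" by (auto simp: sym_def frac_rel_iff) metis
  show "trans (frac_rel R M)"
  proof (rule transI, clarsimp simp: frac_rel_iff)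
    fix r s r' s' r'' s'' t t'
    assume *: "r \<in> carrier R" "s \<in> M" "r' \<in> carrier R" "s' \<in> M" "r'' \<in> carrier R" "s'' \<in> M" "t \<in> M" "t' \<in> M"
      and 1: "t \<otimes> (r \<otimes> s') = t \<otimes> (r' \<otimes> s)" and 2: "t' \<otimes> (r' \<otimes> s'') = t' \<otimes> (r'' \<otimes> s')"
    have "(t \<otimes> t' \<otimes> s') \<otimes> (r \<otimes> s'') = (t \<otimes> (r \<otimes> s')) \<otimes> (t' \<otimes> s'')" using * by (simp add: m_ac)
    also have "\<dots> = (t \<otimes> s) \<otimes> (t' \<otimes> (r' \<otimes> s''))" unfolding 1 using * by (simp add: m_ac)
    also have "\<dots> = (t \<otimes> t' \<otimes> s') \<otimes> (r'' \<otimes> s)" unfolding 2 using * by (simp add: m_ac)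
    finally show "\<exists>t \<in> M. t \<otimes> (r \<otimes> s'') = t \<otimes> (r'' \<otimes> s)" using * by (meson M_mult)
  qed
qed

lemma fraction_eq_iff:
  assumes "r \<in> carrier R" "s \<in> M" "r' \<in> carrier R" "s' \<in> M"
  shows "fraction R M r s = fraction R M r' s' \<longleftrightarrow> (\<exists>t \<in> M. t \<otimes> (r \<otimes> s') = t \<otimes> (r' \<otimes> s))"
  using eq_equiv_class_iff[OF equiv_frac_rel, of "(r, s)" "(r', s')"] assms
  by (simp add: fraction_def frac_rel_iff)

lemma fraction_eqI:
  assumes "r \<in> carrier R" "s \<in> M" "r' \<in> carrier R" "s' \<in> M" "r \<otimes> s' = r' \<otimes> s"
  shows "fraction R M r s = fraction R M r' s'"
  using assms M_one by (auto simp: fraction_eq_iff)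

lemma fraction_cases:
  assumes "x \<in> carrier (localization R M)"
  obtains r s where "r \<in> carrier R" "s \<in> M" "x = fraction R M r s"
  using assms by (auto simp: localization_def fraction_def elim!: quotientE)

lemma fraction_closed [simp]:
  "r \<in> carrier R \<Longrightarrow> s \<in> M \<Longrightarrow> fraction R M r s \<in> carrier (localization R M)"
  by (auto simp: localization_def fraction_def intro!: quotientI)

lemma fraction_mult:
  assumes "r \<in> carrier R" "s \<in> M" "r' \<in> carrier R" "s' \<in> M"
  shows "fraction R M r s \<otimes>\<^bsub>localization R M\<^esub> fraction R M r' s' = fraction R M (r \<otimes> r') (s \<otimes> s')"
proof -
  have "(\<Union>(r, s) \<in> fraction R M r s. \<Union>(r', s') \<in> fraction R M r' s'. fraction R M (r \<otimes> r') (s \<otimes> s')) =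
      fraction R M (r \<otimes> r') (s \<otimes> s')"
  proof -
    have "(r, s) \<in> fraction R M r s" "(r', s') \<in> fraction R M r' s'"
      using assms M_one by (auto simp: fraction_def frac_rel_iff)
    moreover have "fraction R M (a \<otimes> a') (b \<otimes> b') = fraction R M (r \<otimes> r') (s \<otimes> s')"
      if "(a, b) \<in> fraction R M r s" "(a', b') \<in> fraction R M r' s'" for a b a' b'
    proof -
      from that obtain t t' where t: "t \<in> M" "a \<in> carrier R" "b \<in> M" "t \<otimes> (r \<otimes> b) = t \<otimes> (a \<otimes> s)"
        and t': "t' \<in> M" "a' \<in> carrier R" "b' \<in> M" "t' \<otimes> (r' \<otimes> b') = t' \<otimes> (a' \<otimes> s')"
        by (auto simp: fraction_def frac_rel_iff)
      have "(t \<otimes> t') \<otimes> ((a \<otimes> a') \<otimes> (s \<otimes> s')) = (t \<otimes> (a \<otimes> s)) \<otimes> (t' \<otimes> (a' \<otimes> s'))"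
        using assms t(1-3) t'(1-3) by (simp add: m_ac)
      also have "\<dots> = (t \<otimes> t') \<otimes> ((r \<otimes> r') \<otimes> (b \<otimes> b'))"
        unfolding t(4)[symmetric] t'(4)[symmetric] using assms t(1-3) t'(1-3) by (simp add: m_ac)
      finally show ?thesis using assms t t' by (subst fraction_eq_iff) (auto intro!: bexI[of _ "t \<otimes> t'"])
    qed
    ultimately show ?thesis by fast
  qed
  then show ?thesis by (simp add: localization_def)
qed

lemma fraction_add:
  assumes "r \<in> carrier R" "s \<in> M" "r' \<in> carrier R" "s' \<in> M"
  shows "fraction R M r s \<oplus>\<^bsub>localization R M\<^esub> fraction R M r' s' =
    fraction R M (r \<otimes> s' \<oplus> r' \<otimes> s) (s \<otimes> s')"
proof -
  have "(\<Union>(r, s) \<in> fraction R M r s. \<Union>(r', s') \<in> fraction R M r' s'.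
      fraction R M (r \<otimes> s' \<oplus> r' \<otimes> s) (s \<otimes> s')) = fraction R M (r \<otimes> s' \<oplus> r' \<otimes> s) (s \<otimes> s')"
  proof -
    have "(r, s) \<in> fraction R M r s" "(r', s') \<in> fraction R M r' s'"
      using assms M_one by (auto simp: fraction_def frac_rel_iff)
    moreover have "fraction R M (a \<otimes> b' \<oplus> a' \<otimes> b) (b \<otimes> b') = fraction R M (r \<otimes> s' \<oplus> r' \<otimes> s) (s \<otimes> s')"
      if "(a, b) \<in> fraction R M r s" "(a', b') \<in> fraction R M r' s'" for a b a' b'
    proof -
      from that obtain t t' where t: "t \<in> M" "a \<in> carrier R" "b \<in> M" "t \<otimes> (r \<otimes> b) = t \<otimes> (a \<otimes> s)"
        and t': "t' \<in> M" "a' \<in> carrier R" "b' \<in> M" "t' \<otimes> (r' \<otimes> b') = t' \<otimes> (a' \<otimes> s')"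
        by (auto simp: fraction_def frac_rel_iff)
      have "(t \<otimes> t') \<otimes> ((a \<otimes> b' \<oplus> a' \<otimes> b) \<otimes> (s \<otimes> s')) =
          (t \<otimes> (a \<otimes> s)) \<otimes> (t' \<otimes> b' \<otimes> s') \<oplus> (t' \<otimes> (a' \<otimes> s')) \<otimes> (t \<otimes> b \<otimes> s)"
        using assms t(1-3) t'(1-3) by (simp add: m_ac l_distr r_distr)
      also have "\<dots> = (t \<otimes> t') \<otimes> ((r \<otimes> s' \<oplus> r' \<otimes> s) \<otimes> (b \<otimes> b'))"
        unfolding t(4)[symmetric] t'(4)[symmetric] using assms t(1-3) t'(1-3) by (simp add: m_ac l_distr r_distr)
      finally show ?thesis using assms t t' by (subst fraction_eq_iff) (auto intro!: bexI[of _ "t \<otimes> t'"])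
    qed
    ultimately show ?thesis by fast
  qed
  then show ?thesis by (simp add: localization_def)
qed

lemma localization_one: "\<one>\<^bsub>localization R M\<^esub> = fraction R M \<one> \<one>"
  and localization_zero: "\<zero>\<^bsub>localization R M\<^esub> = fraction R M \<zero> \<one>"
  by (simp_all add: localization_def)

lemma cring_localization: "cring (localization R M)"
proof (rule cringI)
  let ?L = "localization R M"
  note simps = fraction_add fraction_mult localization_one localization_zero
  show "abelian_group ?L"
  proof (rule abelian_groupI)
    fix x assume "x \<in> carrier ?L"
    then obtain r s where x: "r \<in> carrier R" "s \<in> M" "x = fraction R M r s" by (rule fraction_cases)
    then show "\<zero>\<^bsub>?L\<^esub> \<oplus>\<^bsub>?L\<^esub> x = x" by (simp add: simps)
    have "fraction R M (\<ominus> r) s \<oplus>\<^bsub>?L\<^esub> x = \<zero>\<^bsub>?L\<^esub>"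
      using x by (simp add: simps, intro fraction_eqI) (auto simp: l_minus l_neg)
    then show "\<exists>y\<in>carrier ?L. y \<oplus>\<^bsub>?L\<^esub> x = \<zero>\<^bsub>?L\<^esub>" using x by (meson a_inv_closed fraction_closed)
    fix y assume "y \<in> carrier ?L"
    then obtain r' s' where y: "r' \<in> carrier R" "s' \<in> M" "y = fraction R M r' s'" by (rule fraction_cases)
    show "x \<oplus>\<^bsub>?L\<^esub> y \<in> carrier ?L" using x y by (simp add: simps)
    show "x \<oplus>\<^bsub>?L\<^esub> y = y \<oplus>\<^bsub>?L\<^esub> x" using x y by (simp add: simps m_comm a_comm)
    fix z assume "z \<in> carrier ?L"
    then obtain r'' s'' where z: "r'' \<in> carrier R" "s'' \<in> M" "z = fraction R M r'' s''" by (rule fraction_cases)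
    show "x \<oplus>\<^bsub>?L\<^esub> y \<oplus>\<^bsub>?L\<^esub> z = x \<oplus>\<^bsub>?L\<^esub> (y \<oplus>\<^bsub>?L\<^esub> z)"
      using x y z by (simp add: simps l_distr r_distr m_ac a_ac)
  qed (simp add: simps)
  show "comm_monoid ?L"
  proof (rule comm_monoidI)
    fix x assume "x \<in> carrier ?L"
    then obtain r s where x: "r \<in> carrier R" "s \<in> M" "x = fraction R M r s" by (rule fraction_cases)
    then show "\<one>\<^bsub>?L\<^esub> \<otimes>\<^bsub>?L\<^esub> x = x" by (simp add: simps)
    fix y assume "y \<in> carrier ?L"
    then obtain r' s' where y: "r' \<in> carrier R" "s' \<in> M" "y = fraction R M r' s'" by (rule fraction_cases)
    show "x \<otimes>\<^bsub>?L\<^esub> y \<in> carrier ?L" using x y by (simp add: simps)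
    show "x \<otimes>\<^bsub>?L\<^esub> y = y \<otimes>\<^bsub>?L\<^esub> x" using x y by (simp add: simps m_comm)
    fix z assume "z \<in> carrier ?L"
    then obtain r'' s'' where z: "r'' \<in> carrier R" "s'' \<in> M" "z = fraction R M r'' s''" by (rule fraction_cases)
    show "x \<otimes>\<^bsub>?L\<^esub> y \<otimes>\<^bsub>?L\<^esub> z = x \<otimes>\<^bsub>?L\<^esub> (y \<otimes>\<^bsub>?L\<^esub> z)"
      using x y z by (simp add: simps m_ac)
  qed (simp add: simps)
  fix x y z assume "x \<in> carrier ?L" "y \<in> carrier ?L" "z \<in> carrier ?L"
  then obtain r s r' s' r'' s'' where x: "r \<in> carrier R" "s \<in> M" "x = fraction R M r s"
    and y: "r' \<in> carrier R" "s' \<in> M" "y = fraction R M r' s'"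
    and z: "r'' \<in> carrier R" "s'' \<in> M" "z = fraction R M r'' s''" by (metis fraction_cases)
  show "(x \<oplus>\<^bsub>?L\<^esub> y) \<otimes>\<^bsub>?L\<^esub> z = x \<otimes>\<^bsub>?L\<^esub> z \<oplus>\<^bsub>?L\<^esub> y \<otimes>\<^bsub>?L\<^esub> z"
    using x y z by (simp add: simps, intro fraction_eqI) (auto simp: l_distr r_distr m_ac)
qed

lemma fraction_minus:
  assumes "r \<in> carrier R" "s \<in> M"
  shows "\<ominus>\<^bsub>localization R M\<^esub> fraction R M r s = fraction R M (\<ominus> r) s"
proof -
  interpret L: cring "localization R M" by (rule cring_localization)
  have "fraction R M (\<ominus> r) s \<oplus>\<^bsub>localization R M\<^esub> fraction R M r s = \<zero>\<^bsub>localization R M\<^esub>"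
    using assms
    by (simp add: fraction_add localization_zero, intro fraction_eqI) (auto simp: l_minus l_neg)
  then show ?thesis using assms by (intro L.minus_equality) auto
qed

end

lemma (in primeideal) mult_subset_complement: "mult_subset R (carrier R - I)"
  using I_prime I_notcarr one_imp_carrier by unfold_locales auto

context primeideal begin

interpretation M: mult_subset R "carrier R - I" by (rule mult_subset_complement)
interpretation L: cring "local_ring R I" by (rule M.cring_localization)

lemma extended_ideal_eq:
  "extended_ideal R I = {fraction R (carrier R - I) r s | r s. r \<in> I \<and> s \<in> carrier R - I}" (is "_ = ?J")
proof
  have IC: "r \<in> I \<Longrightarrow> r \<in> carrier R" for r using a_subset by blast
  have JI: "fraction R (carrier R - I) r s \<in> ?J" if "r \<in> I" "s \<in> carrier R - I" for r s
    using that by blast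
  note [simp] = M.fraction_add M.fraction_mult M.localization_one M.localization_zero
  have "ideal ?J (local_ring R I)"
  proof (rule idealI)
    show "ring (local_ring R I)" by unfold_locales
    show "subgroup ?J (add_monoid (local_ring R I))"
    proof (rule group.subgroupI[OF L.a_group])
      show "?J \<subseteq> carrier (add_monoid (local_ring R I))" using IC by auto
      have "fraction R (carrier R - I) \<zero> \<one> \<in> ?J"
        by (intro JI M.M_one additive_subgroup.zero_closed[OF additive_subgroup_axioms])
      then show "?J \<noteq> {}" by auto
      fix a assume "a \<in> ?J"
      then obtain r s where a: "a = fraction R (carrier R - I) r s" "r \<in> I" "s \<in> carrier R - I" by blast
      have "\<ominus>\<^bsub>local_ring R I\<^esub> a = fraction R (carrier R - I) (\<ominus> r) s"
        using a IC by (simp add: M.fraction_minus)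
      moreover have "fraction R (carrier R - I) (\<ominus> r) s \<in> ?J"
        using a by (intro JI additive_subgroup.a_inv_closed[OF additive_subgroup_axioms])
      ultimately show "inv\<^bsub>add_monoid (local_ring R I)\<^esub> a \<in> ?J"
        unfolding a_inv_def by simp
      fix b assume "b \<in> ?J"
      then obtain r' s' where b: "b = fraction R (carrier R - I) r' s'" "r' \<in> I" "s' \<in> carrier R - I" by blast
      have "a \<oplus>\<^bsub>local_ring R I\<^esub> b = fraction R (carrier R - I) (r \<otimes> s' \<oplus> r' \<otimes> s) (s \<otimes> s')"
        using a b IC by simp
      moreover have "r \<otimes> s' \<oplus> r' \<otimes> s \<in> I" using a b by (simp add: I_r_closed)
      ultimately show "a \<otimes>\<^bsub>add_monoid (local_ring R I)\<^esub> b \<in> ?J"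
        using JI[OF _ M.M_mult[OF a(3) b(3)]] by simp
    qed
    fix a x assume "a \<in> ?J" and x: "x \<in> carrier (local_ring R I)"
    then obtain r s where a: "a = fraction R (carrier R - I) r s" "r \<in> I" "s \<in> carrier R - I" by blast
    obtain r' s' where x: "x = fraction R (carrier R - I) r' s'" "r' \<in> carrier R" "s' \<in> carrier R - I"
      using x M.fraction_cases by metis
    have "r' \<otimes> r \<in> I" "s' \<otimes> s \<in> carrier R - I" "r \<otimes> r' \<in> I" "s \<otimes> s' \<in> carrier R - I"
      using a x M.M_mult by (auto simp: I_l_closed I_r_closed)
    moreover have "x \<otimes>\<^bsub>local_ring R I\<^esub> a = fraction R (carrier R - I) (r' \<otimes> r) (s' \<otimes> s)"
      "a \<otimes>\<^bsub>local_ring R I\<^esub> x = fraction R (carrier R - I) (r \<otimes> r') (s \<otimes> s')"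
      using a x IC by simp_all
    ultimately show "x \<otimes>\<^bsub>local_ring R I\<^esub> a \<in> ?J" "a \<otimes>\<^bsub>local_ring R I\<^esub> x \<in> ?J"
      using JI by (simp_all only:)
  qed
  then show "extended_ideal R I \<subseteq> ?J"
    unfolding extended_ideal_def by (rule L.genideal_minimal) (use JI M.M_one in auto)
  have sub: "(\<lambda>r. fraction R (carrier R - I) r \<one>) ` I \<subseteq> carrier (local_ring R I)"
    using IC M.M_one by auto
  interpret E: ideal "extended_ideal R I" "local_ring R I"
    unfolding extended_ideal_def by (rule L.genideal_ideal[OF sub])
  show "?J \<subseteq> extended_ideal R I"
  proof clarify
    fix r s assume rs: "r \<in> I" "s \<in> carrier R" "s \<notin> I"
    have "fraction R (carrier R - I) r \<one> \<in> extended_ideal R I"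
      unfolding extended_ideal_def using L.genideal_self[OF sub] rs by blast
    moreover have "fraction R (carrier R - I) \<one> s \<in> carrier (local_ring R I)" using rs by simp
    ultimately have "fraction R (carrier R - I) r \<one> \<otimes>\<^bsub>local_ring R I\<^esub> fraction R (carrier R - I) \<one> s
      \<in> extended_ideal R I" by (rule E.I_r_closed)
    then show "fraction R (carrier R - I) r s \<in> extended_ideal R I" using rs IC M.M_one by simp
  qed
qed

lemma ideal_extended_ideal: "ideal (extended_ideal R I) (local_ring R I)"
  unfolding extended_ideal_def using a_subset M.M_one
  by (intro L.genideal_ideal) auto

lemma fraction_in_extended_ideal:
  assumes "r \<in> carrier R" "s \<in> carrier R - I"
  shows "fraction R (carrier R - I) r s \<in> extended_ideal R I \<longleftrightarrow> r \<in> I"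
proof
  assume "fraction R (carrier R - I) r s \<in> extended_ideal R I"
  then obtain r' s' where *: "r' \<in> I" "s' \<in> carrier R - I"
    "fraction R (carrier R - I) r s = fraction R (carrier R - I) r' s'"
    unfolding extended_ideal_eq by blast
  moreover from * have r': "r' \<in> carrier R" using a_subset by blast
  ultimately obtain t where t: "t \<in> carrier R - I" "t \<otimes> (r \<otimes> s') = t \<otimes> (r' \<otimes> s)"
    using assms M.fraction_eq_iff by metis
  have "t \<otimes> (r \<otimes> s') \<in> I" unfolding t(2) using t * assms by (simp add: I_l_closed I_r_closed)
  then show "r \<in> I" using t * assms I_prime m_closed by (metis DiffD1 DiffD2)
qed (use assms in \<open>auto simp: extended_ideal_eq\<close>)

lemma field_residue_field: "field (residue_field R I)"
  unfolding residue_field_def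
proof (rule maximalideal.quotient_is_field[OF _ M.cring_localization])
  interpret E: ideal "extended_ideal R I" "local_ring R I" by (rule ideal_extended_ideal)
  show "maximalideal (extended_ideal R I) (local_ring R I)"
  proof (rule maximalidealI[OF ideal_extended_ideal])
    have "\<one>\<^bsub>local_ring R I\<^esub> \<notin> extended_ideal R I"
      using fraction_in_extended_ideal[of \<one> \<one>] M.M_one by (simp add: M.localization_one)
    then show "carrier (local_ring R I) \<noteq> extended_ideal R I" using L.one_closed by blast
    fix J assume J: "ideal J (local_ring R I)" "extended_ideal R I \<subseteq> J" "J \<subseteq> carrier (local_ring R I)"
    interpret J: ideal J "local_ring R I" by fact
    show "J = extended_ideal R I \<or> J = carrier (local_ring R I)"
    proof (cases "J \<subseteq> extended_ideal R I")
      case False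
      then obtain x where x: "x \<in> J" "x \<notin> extended_ideal R I" by blast
      then obtain r s where rs: "r \<in> carrier R" "s \<in> carrier R - I" "x = fraction R (carrier R - I) r s"
        using J(3) M.fraction_cases by blast
      with x have r: "r \<in> carrier R - I" by (simp add: fraction_in_extended_ideal)
      with rs have y: "fraction R (carrier R - I) s r \<in> carrier (local_ring R I)" by simp
      have s: "s \<in> carrier R" using rs(2) by blast
      have "x \<otimes>\<^bsub>local_ring R I\<^esub> fraction R (carrier R - I) s r = \<one>\<^bsub>local_ring R I\<^esub>"
        unfolding rs(3) M.localization_one M.fraction_mult[OF rs(1,2) s r]
        by (rule M.fraction_eqI[OF _ M.M_mult[OF rs(2) r] one_closed M.M_one])
           (use rs(1) s in \<open>simp_all add: m_comm\<close>)
      then have "\<one>\<^bsub>local_ring R I\<^esub> \<in> J" using J.I_r_closed[OF x(1) y] by simp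
      then show ?thesis using J.one_imp_carrier by blast
    qed (use J in blast)
  qed
qed

lemma residue_frac_closed:
  assumes "r \<in> carrier R" "s \<in> carrier R - I"
  shows "residue_frac R I r s \<in> carrier (residue_field R I)"
  using assms unfolding residue_frac_def residue_field_def FactRing_simps by auto

lemma residue_frac_cases:
  assumes "x \<in> carrier (residue_field R I)"
  obtains r s where "r \<in> carrier R" "s \<in> carrier R - I" "x = residue_frac R I r s"
proof -
  obtain u where u: "u \<in> carrier (local_ring R I)" "x = extended_ideal R I +>\<^bsub>local_ring R I\<^esub> u"
    using assms unfolding residue_field_def FactRing_simps by auto
  from u(1) show ?thesis by (rule M.fraction_cases) (use u(2) that in \<open>simp add: residue_frac_def\<close>)
qed

lemma residue_frac_mult:
  assumes "r \<in> carrier R" "s \<in> carrier R - I" "r' \<in> carrier R" "s' \<in> carrier R - I"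
  shows "residue_frac R I r s \<otimes>\<^bsub>residue_field R I\<^esub> residue_frac R I r' s' =
    residue_frac R I (r \<otimes> r') (s \<otimes> s')"
proof -
  interpret E: ideal "extended_ideal R I" "local_ring R I" by (rule ideal_extended_ideal)
  show ?thesis using assms unfolding residue_frac_def residue_field_def
    by (simp add: FactRing_def E.rcoset_mult_add M.fraction_mult)
qed

lemma residue_frac_add:
  assumes "r \<in> carrier R" "s \<in> carrier R - I" "r' \<in> carrier R" "s' \<in> carrier R - I"
  shows "residue_frac R I r s \<oplus>\<^bsub>residue_field R I\<^esub> residue_frac R I r' s' =
    residue_frac R I (r \<otimes> s' \<oplus> r' \<otimes> s) (s \<otimes> s')"
proof -
  interpret E: ideal "extended_ideal R I" "local_ring R I" by (rule ideal_extended_ideal)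
  show ?thesis using assms unfolding residue_frac_def residue_field_def
    by (simp add: FactRing_def E.a_rcos_sum M.fraction_add)
qed

lemma residue_frac_one: "\<one>\<^bsub>residue_field R I\<^esub> = residue_frac R I \<one> \<one>"
  by (simp add: residue_frac_def residue_field_def FactRing_def M.localization_one)

lemma residue_frac_eq_iff:
  assumes "r \<in> carrier R" "s \<in> carrier R - I" "r' \<in> carrier R" "s' \<in> carrier R - I"
  shows "residue_frac R I r s = residue_frac R I r' s' \<longleftrightarrow> r \<otimes> s' \<ominus> r' \<otimes> s \<in> I"
proof -
  interpret E: ideal "extended_ideal R I" "local_ring R I" by (rule ideal_extended_ideal)
  have "\<ominus>\<^bsub>local_ring R I\<^esub> fraction R (carrier R - I) r' s' = fraction R (carrier R - I) (\<ominus> r') s'"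
    using assms by (simp add: M.fraction_minus)
  then have "fraction R (carrier R - I) r s \<ominus>\<^bsub>local_ring R I\<^esub> fraction R (carrier R - I) r' s' =
      fraction R (carrier R - I) (r \<otimes> s' \<ominus> r' \<otimes> s) (s \<otimes> s')"
    using assms by (simp add: a_minus_def M.fraction_add l_minus)
  moreover have "residue_frac R I r s = residue_frac R I r' s' \<longleftrightarrow>
      fraction R (carrier R - I) r s \<ominus>\<^bsub>local_ring R I\<^esub> fraction R (carrier R - I) r' s' \<in> extended_ideal R I"
    unfolding residue_frac_def
    by (rule L.quotient_eq_iff_same_a_r_cos[OF ideal_extended_ideal M.fraction_closed M.fraction_closed,
          symmetric]) (fact assms)+
  moreover have "r \<otimes> s' \<ominus> r' \<otimes> s \<in> carrier R" using assms by auto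
  ultimately show ?thesis
    using fraction_in_extended_ideal[OF _ M.M_mult[OF assms(2,4)]] by (simp only:)
qed

end

lemma primeideal_contraction:
  assumes S: "cring S" and R: "subring R S" and Q: "primeideal Q S"
  shows "primeideal (Q \<inter> R) (S\<lparr>carrier := R\<rparr>)"
proof -
  interpret S: cring S by fact
  interpret Q: primeideal Q S by fact
  note sub = subringE[OF R]
  have cR: "cring (S\<lparr>carrier := R\<rparr>)" using R S.subcringI' S.subcring_iff sub(1) by blast
  interpret R: cring "S\<lparr>carrier := R\<rparr>" by (rule cR)
  interpret i: ring_hom_ring "S\<lparr>carrier := R\<rparr>" S "\<lambda>x. x"
    using sub by (intro ring_hom_ringI2) (auto intro!: ring_hom_memI R.ring_axioms S.ring_axioms)
  have "{r \<in> carrier (S\<lparr>carrier := R\<rparr>). r \<in> Q} = Q \<inter> R" by auto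
  with i.primeideal_vimage[OF cR Q] show ?thesis by simp
qed

lemma residual_map_frac:
  assumes S: "cring S" and R: "subring R S" and Q: "primeideal Q S"
    and r: "r \<in> R" and s: "s \<in> R - Q"
  shows "residual_map R S Q (residue_frac (S\<lparr>carrier := R\<rparr>) (Q \<inter> R) r s) = residue_frac S Q r s"
proof -
  interpret S: cring S by fact
  interpret Q: primeideal Q S by fact
  interpret P: primeideal "Q \<inter> R" "S\<lparr>carrier := R\<rparr>" by (rule primeideal_contraction[OF S R Q])
  note sub = subringE[OF R]
  show ?thesis
    unfolding residual_map_def
  proof (rule the_equality)
    fix V assume "\<exists>r'\<in>R. \<exists>s'\<in>R - Q. residue_frac (S\<lparr>carrier := R\<rparr>) (Q \<inter> R) r s =
      residue_frac (S\<lparr>carrier := R\<rparr>) (Q \<inter> R) r' s' \<and> V = residue_frac S Q r' s'"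
    then obtain r' s' where *: "r' \<in> R" "s' \<in> R - Q" "V = residue_frac S Q r' s'"
      "residue_frac (S\<lparr>carrier := R\<rparr>) (Q \<inter> R) r s = residue_frac (S\<lparr>carrier := R\<rparr>) (Q \<inter> R) r' s'" by blast
    have "r \<otimes>\<^bsub>S\<^esub> s' \<ominus>\<^bsub>S\<lparr>carrier := R\<rparr>\<^esub> r' \<otimes>\<^bsub>S\<^esub> s \<in> Q"
      using P.residue_frac_eq_iff[of r s r' s'] *(1,2,4) r s by (simp only: *(4)) simp
    moreover have "r \<otimes>\<^bsub>S\<^esub> s' \<ominus>\<^bsub>S\<lparr>carrier := R\<rparr>\<^esub> r' \<otimes>\<^bsub>S\<^esub> s = r \<otimes>\<^bsub>S\<^esub> s' \<ominus>\<^bsub>S\<^esub> r' \<otimes>\<^bsub>S\<^esub> s"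
    proof -
      have "\<ominus>\<^bsub>S\<lparr>carrier := R\<rparr>\<^esub> (r' \<otimes>\<^bsub>S\<^esub> s) = \<ominus>\<^bsub>S\<^esub> (r' \<otimes>\<^bsub>S\<^esub> s)"
      proof (rule P.minus_equality)
        have "r' \<otimes>\<^bsub>S\<^esub> s \<in> R" using * s sub(6) by blast
        then show "r' \<otimes>\<^bsub>S\<^esub> s \<in> carrier (S\<lparr>carrier := R\<rparr>)"
          "\<ominus>\<^bsub>S\<^esub> (r' \<otimes>\<^bsub>S\<^esub> s) \<in> carrier (S\<lparr>carrier := R\<rparr>)" using sub(5) by simp_all
        show "\<ominus>\<^bsub>S\<^esub> (r' \<otimes>\<^bsub>S\<^esub> s) \<oplus>\<^bsub>S\<lparr>carrier := R\<rparr>\<^esub> r' \<otimes>\<^bsub>S\<^esub> s = \<zero>\<^bsub>S\<lparr>carrier := R\<rparr>\<^esub>"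
          using \<open>r' \<otimes>\<^bsub>S\<^esub> s \<in> R\<close> sub(1) by (simp add: S.l_neg subsetD)
      qed
      then show ?thesis by (simp add: a_minus_def)
    qed
    ultimately have "r \<otimes>\<^bsub>S\<^esub> s' \<ominus>\<^bsub>S\<^esub> r' \<otimes>\<^bsub>S\<^esub> s \<in> Q" by (simp only:)
    moreover have "r \<in> carrier S" "s \<in> carrier S - Q" "r' \<in> carrier S" "s' \<in> carrier S - Q"
      using *(1,2) r s sub(1) by auto
    ultimately show "V = residue_frac S Q r s"
      unfolding *(3) using Q.residue_frac_eq_iff by metis
  qed (use r s in blast)
qed

lemma residual_map_hom:
  assumes S: "cring S" and R: "subring R S" and Q: "primeideal Q S"
  shows "residual_map R S Q \<in>
    ring_hom (residue_field (S\<lparr>carrier := R\<rparr>) (Q \<inter> R)) (residue_field S Q)"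
proof -
  interpret Q: primeideal Q S by fact
  interpret P: primeideal "Q \<inter> R" "S\<lparr>carrier := R\<rparr>" by (rule primeideal_contraction[OF S R Q])
  note sub = subringE[OF R] and res = residual_map_frac[OF S R Q]
  have M: "s \<otimes>\<^bsub>S\<^esub> t \<in> R - Q" if "s \<in> R - Q" "t \<in> R - Q" for s t
    using that sub(6)[of s t] Q.I_prime[of s t] subsetD[OF sub(1)] by auto
  have one: "\<one>\<^bsub>S\<^esub> \<in> R - Q" using sub(3) Q.I_notcarr Q.one_imp_carrier by auto
  have D: "carrier (S\<lparr>carrier := R\<rparr>) - Q \<inter> R = R - Q" by auto
  show ?thesis
  proof (rule ring_hom_memI)
    fix x assume "x \<in> carrier (residue_field (S\<lparr>carrier := R\<rparr>) (Q \<inter> R))"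
    then obtain r s where x: "r \<in> R" "s \<in> R - Q" "x = residue_frac (S\<lparr>carrier := R\<rparr>) (Q \<inter> R) r s"
      by (rule P.residue_frac_cases) auto
    show "residual_map R S Q x \<in> carrier (residue_field S Q)"
      unfolding x(3) res[OF x(1,2)] using x(1,2) sub(1) by (intro Q.residue_frac_closed) auto
    fix y assume "y \<in> carrier (residue_field (S\<lparr>carrier := R\<rparr>) (Q \<inter> R))"
    then obtain r' s' where y: "r' \<in> R" "s' \<in> R - Q" "y = residue_frac (S\<lparr>carrier := R\<rparr>) (Q \<inter> R) r' s'"
      by (rule P.residue_frac_cases) auto
    have inS: "r \<in> carrier S" "s \<in> carrier S - Q" "r' \<in> carrier S" "s' \<in> carrier S - Q"
      using x y sub(1) by auto
    have inR: "r \<in> carrier (S\<lparr>carrier := R\<rparr>)" "s \<in> carrier (S\<lparr>carrier := R\<rparr>) - Q \<inter> R"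
      "r' \<in> carrier (S\<lparr>carrier := R\<rparr>)" "s' \<in> carrier (S\<lparr>carrier := R\<rparr>) - Q \<inter> R"
      using x(1,2) y(1,2) by auto
    note ss = M[OF x(2) y(2)]
    have "r \<otimes>\<^bsub>S\<^esub> r' \<in> R" using x(1) y(1) by (rule sub(6))
    from res[OF this ss]
    show "residual_map R S Q (x \<otimes>\<^bsub>residue_field (S\<lparr>carrier := R\<rparr>) (Q \<inter> R)\<^esub> y) =
      residual_map R S Q x \<otimes>\<^bsub>residue_field S Q\<^esub> residual_map R S Q y"
      unfolding x(3) y(3) res[OF x(1,2)] res[OF y(1,2)] P.residue_frac_mult[OF inR]
        Q.residue_frac_mult[OF inS] by simp
    have "r \<otimes>\<^bsub>S\<^esub> s' \<oplus>\<^bsub>S\<^esub> r' \<otimes>\<^bsub>S\<^esub> s \<in> R" using x(1,2) y(1,2) by (intro sub(6,7)) auto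
    from res[OF this ss]
    show "residual_map R S Q (x \<oplus>\<^bsub>residue_field (S\<lparr>carrier := R\<rparr>) (Q \<inter> R)\<^esub> y) =
      residual_map R S Q x \<oplus>\<^bsub>residue_field S Q\<^esub> residual_map R S Q y"
      unfolding x(3) y(3) res[OF x(1,2)] res[OF y(1,2)] P.residue_frac_add[OF inR]
        Q.residue_frac_add[OF inS] by simp
  next
    show "residual_map R S Q \<one>\<^bsub>residue_field (S\<lparr>carrier := R\<rparr>) (Q \<inter> R)\<^esub> = \<one>\<^bsub>residue_field S Q\<^esub>"
      unfolding P.residue_frac_one Q.residue_frac_one using res[OF sub(3) one] by simp
  qed
qed

section \<open>The tensor square is a ring and its multiplication map is well defined\<close>

context
  fixes S :: "('a, 'b) ring_scheme"
  assumes cring_S: "cring S"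
begin

interpretation S: cring S by (rule cring_S)

lemma pair_ring_mult_diff:
  "(f - f') \<otimes>\<^bsub>pair_ring S\<^esub> g = f \<otimes>\<^bsub>pair_ring S\<^esub> g - f' \<otimes>\<^bsub>pair_ring S\<^esub> g"
  "f \<otimes>\<^bsub>pair_ring S\<^esub> (g - g') = f \<otimes>\<^bsub>pair_ring S\<^esub> g - f \<otimes>\<^bsub>pair_ring S\<^esub> g'"
proof -
  have minus: "frag_cmul k (u - v) = frag_cmul k u - frag_cmul k v" for k and u v :: "('a \<times> 'a) \<Rightarrow>\<^sub>0 int"
    by (rule poly_mapping_eqI) (simp add: lookup_minus algebra_simps)
  have *: "frag_extend (\<lambda>x. u x - v x) c = frag_extend u c - frag_extend v c"
    for u v :: "'a \<times> 'a \<Rightarrow> ('a \<times> 'a) \<Rightarrow>\<^sub>0 int" and c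
    by (simp add: frag_extend_def minus sum_subtractf)
  show "(f - f') \<otimes>\<^bsub>pair_ring S\<^esub> g = f \<otimes>\<^bsub>pair_ring S\<^esub> g - f' \<otimes>\<^bsub>pair_ring S\<^esub> g"
    "f \<otimes>\<^bsub>pair_ring S\<^esub> (g - g') = f \<otimes>\<^bsub>pair_ring S\<^esub> g - f \<otimes>\<^bsub>pair_ring S\<^esub> g'"
    by (simp_all add: pair_ring_def frag_extend_diff *)
qed

lemma pair_ring_mult_zero:
  "0 \<otimes>\<^bsub>pair_ring S\<^esub> g = 0" "f \<otimes>\<^bsub>pair_ring S\<^esub> 0 = 0"
  using pair_ring_mult_diff(1)[of 0 0 g] pair_ring_mult_diff(2)[of f 0 0] by simp_all

lemma pair_ring_mult_of:
  "frag_of x \<otimes>\<^bsub>pair_ring S\<^esub> frag_of y = frag_of (fst x \<otimes>\<^bsub>S\<^esub> fst y, snd x \<otimes>\<^bsub>S\<^esub> snd y)"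
  by (simp add: pair_ring_def)

lemma pair_ring_carrier: "f \<in> carrier (pair_ring S) \<longleftrightarrow> Poly_Mapping.keys f \<subseteq> carrier S \<times> carrier S"
  by (simp add: pair_ring_def)

lemma pair_ring_add: "f \<oplus>\<^bsub>pair_ring S\<^esub> g = f + g" and pair_ring_zero: "\<zero>\<^bsub>pair_ring S\<^esub> = 0"
  and pair_ring_one: "\<one>\<^bsub>pair_ring S\<^esub> = frag_of (\<one>\<^bsub>S\<^esub>, \<one>\<^bsub>S\<^esub>)"
  by (simp_all add: pair_ring_def)

lemma pair_ring_induct [consumes 1, case_names zero of_pair diff]:
  assumes "f \<in> carrier (pair_ring S)" and "P 0"
    and "\<And>a b. a \<in> carrier S \<Longrightarrow> b \<in> carrier S \<Longrightarrow> P (frag_of (a, b))"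
    and "\<And>f g. f \<in> carrier (pair_ring S) \<Longrightarrow> g \<in> carrier (pair_ring S) \<Longrightarrow> P f \<Longrightarrow> P g \<Longrightarrow> P (f - g)"
  shows "P f"
  by (rule free_Abelian_group_induct[of f "carrier S \<times> carrier S"])
     (use assms in \<open>auto simp: pair_ring_carrier\<close>)

lemma pair_ring_mult_closed:
  assumes "f \<in> carrier (pair_ring S)" "g \<in> carrier (pair_ring S)"
  shows "f \<otimes>\<^bsub>pair_ring S\<^esub> g \<in> carrier (pair_ring S)"
proof -
  have diff: "u - v \<in> carrier (pair_ring S)" if "u \<in> carrier (pair_ring S)" "v \<in> carrier (pair_ring S)" for u v
    using that keys_diff[of u v] by (auto simp: pair_ring_carrier)
  have 0: "0 \<in> carrier (pair_ring S)" by (simp add: pair_ring_carrier)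
  have of0: "frag_of (a, b) \<in> carrier (pair_ring S)" if "a \<in> carrier S" "b \<in> carrier S" for a b
    using that by (simp add: pair_ring_carrier)
  have of: "frag_of (a, b) \<otimes>\<^bsub>pair_ring S\<^esub> g \<in> carrier (pair_ring S)"
    if "a \<in> carrier S" "b \<in> carrier S" for a b
    using assms(2) that
    by (induction rule: pair_ring_induct)
       (auto simp: 0 pair_ring_mult_zero pair_ring_mult_diff diff pair_ring_mult_of of0)
  show ?thesis
    using assms(1)
    by (induction rule: pair_ring_induct)
       (auto simp: 0 pair_ring_mult_zero pair_ring_mult_diff diff of)
qed

lemma pair_ring_comm:
  assumes "f \<in> carrier (pair_ring S)" "g \<in> carrier (pair_ring S)"
  shows "f \<otimes>\<^bsub>pair_ring S\<^esub> g = g \<otimes>\<^bsub>pair_ring S\<^esub> f"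
proof -
  have of: "frag_of (a, b) \<otimes>\<^bsub>pair_ring S\<^esub> g = g \<otimes>\<^bsub>pair_ring S\<^esub> frag_of (a, b)"
    if "a \<in> carrier S" "b \<in> carrier S" for a b
    using assms(2) that
    by (induction rule: pair_ring_induct)
       (auto simp: pair_ring_mult_zero pair_ring_mult_diff pair_ring_mult_of S.m_comm)
  show ?thesis
    using assms(1)
    by (induction rule: pair_ring_induct)
       (auto simp: pair_ring_mult_zero pair_ring_mult_diff of)
qed

lemma pair_ring_assoc:
  assumes "f \<in> carrier (pair_ring S)" "g \<in> carrier (pair_ring S)" "k \<in> carrier (pair_ring S)"
  shows "f \<otimes>\<^bsub>pair_ring S\<^esub> g \<otimes>\<^bsub>pair_ring S\<^esub> k = f \<otimes>\<^bsub>pair_ring S\<^esub> (g \<otimes>\<^bsub>pair_ring S\<^esub> k)"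
proof -
  have 1: "frag_of (a, b) \<otimes>\<^bsub>pair_ring S\<^esub> frag_of (c, d) \<otimes>\<^bsub>pair_ring S\<^esub> k =
      frag_of (a, b) \<otimes>\<^bsub>pair_ring S\<^esub> (frag_of (c, d) \<otimes>\<^bsub>pair_ring S\<^esub> k)"
    if "a \<in> carrier S" "b \<in> carrier S" "c \<in> carrier S" "d \<in> carrier S" for a b c d
    using assms(3) that
    by (induction rule: pair_ring_induct)
       (auto simp: pair_ring_mult_zero pair_ring_mult_diff pair_ring_mult_of S.m_assoc)
  have 2: "frag_of (a, b) \<otimes>\<^bsub>pair_ring S\<^esub> g \<otimes>\<^bsub>pair_ring S\<^esub> k =
      frag_of (a, b) \<otimes>\<^bsub>pair_ring S\<^esub> (g \<otimes>\<^bsub>pair_ring S\<^esub> k)"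
    if "a \<in> carrier S" "b \<in> carrier S" for a b
    using assms(2) that
    by (induction rule: pair_ring_induct)
       (auto simp: pair_ring_mult_zero pair_ring_mult_diff 1)
  show ?thesis
    using assms(1)
    by (induction rule: pair_ring_induct)
       (auto simp: pair_ring_mult_zero pair_ring_mult_diff 2)
qed

lemma pair_ring_one_mult:
  assumes "f \<in> carrier (pair_ring S)"
  shows "\<one>\<^bsub>pair_ring S\<^esub> \<otimes>\<^bsub>pair_ring S\<^esub> f = f"
  using assms unfolding pair_ring_one
  by (induction rule: pair_ring_induct)
     (auto simp: pair_ring_mult_zero pair_ring_mult_diff pair_ring_mult_of)

lemma cring_pair_ring: "cring (pair_ring S)"
proof (rule cringI)
  show "abelian_group (pair_ring S)"
    using abelian_free_Abelian_group[of "carrier S \<times> carrier S"]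
    by (intro comm_group_abelian_groupI) (simp add: pair_ring_def free_Abelian_group_def)
  have one: "\<one>\<^bsub>pair_ring S\<^esub> \<in> carrier (pair_ring S)"
    by (simp add: pair_ring_one pair_ring_carrier)
  show "comm_monoid (pair_ring S)"
    by (rule comm_monoidI)
       (auto intro: pair_ring_mult_closed pair_ring_assoc pair_ring_one_mult pair_ring_comm one)
  fix f g k assume "f \<in> carrier (pair_ring S)" "g \<in> carrier (pair_ring S)" "k \<in> carrier (pair_ring S)"
  show "(f \<oplus>\<^bsub>pair_ring S\<^esub> g) \<otimes>\<^bsub>pair_ring S\<^esub> k =
    f \<otimes>\<^bsub>pair_ring S\<^esub> k \<oplus>\<^bsub>pair_ring S\<^esub> g \<otimes>\<^bsub>pair_ring S\<^esub> k"
    using pair_ring_mult_diff(1)[of f "0 - g" k] pair_ring_mult_diff(1)[of 0 g k]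
    by (simp add: pair_ring_add pair_ring_mult_zero)
qed

interpretation P: cring "pair_ring S" by (rule cring_pair_ring)

lemma pair_ring_minus: 
  assumes "f \<in> carrier (pair_ring S)" "g \<in> carrier (pair_ring S)"
  shows "f \<ominus>\<^bsub>pair_ring S\<^esub> g = f - g"
proof -
  have "\<ominus>\<^bsub>pair_ring S\<^esub> g = - g"
    by (rule P.minus_equality) (use assms in \<open>auto simp: pair_ring_add pair_ring_zero pair_ring_carrier\<close>)
  then show ?thesis by (simp add: a_minus_def pair_ring_add)
qed

lemma tensor_relations_subset:
  assumes "R \<subseteq> carrier S"
  shows "tensor_relations R S \<subseteq> carrier (pair_ring S)"
proof -
  have of: "frag_of (a, b) \<in> carrier (pair_ring S)" if "a \<in> carrier S" "b \<in> carrier S" for a b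
    using that by (simp add: pair_ring_carrier)
  have diff: "u - v \<in> carrier (pair_ring S)" if "u \<in> carrier (pair_ring S)" "v \<in> carrier (pair_ring S)" for u v
    using that P.minus_closed pair_ring_minus by metis
  show ?thesis using assms unfolding tensor_relations_def by (auto intro!: diff of)
qed

lemma cring_tensor_square:
  assumes "R \<subseteq> carrier S"
  shows "cring (tensor_square R S)"
  unfolding tensor_square_def
  by (rule ideal.quotient_is_cring[OF P.genideal_ideal[OF tensor_relations_subset[OF assms]] cring_pair_ring])

lemma pair_mult_superset:
  assumes "finite A" "Poly_Mapping.keys f \<subseteq> A" "A \<subseteq> carrier S \<times> carrier S"
  shows "pair_mult S f = (\<Oplus>\<^bsub>S\<^esub>x \<in> A. add_pow S (Poly_Mapping.lookup f x) (fst x \<otimes>\<^bsub>S\<^esub> snd x))"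
proof -
  have zero: "add_pow S (0 :: int) x = \<zero>\<^bsub>S\<^esub>" for x by (simp add: add_pow_def)
  show ?thesis unfolding pair_mult_def using assms
  by (intro S.add.finprod_mono_neutral_cong_left)
     (auto simp: in_keys_iff zero intro!: S.add.int_pow_closed)
qed

lemma pair_mult_add:
  assumes "f \<in> carrier (pair_ring S)" "g \<in> carrier (pair_ring S)"
  shows "pair_mult S (f + g) = pair_mult S f \<oplus>\<^bsub>S\<^esub> pair_mult S g"
proof -
  let ?A = "Poly_Mapping.keys f \<union> Poly_Mapping.keys g"
  have A: "finite ?A" "?A \<subseteq> carrier S \<times> carrier S" using assms by (auto simp: pair_ring_carrier)
  show ?thesis
    using A keys_add[of f g]
    apply (subst (1 2 3) pair_mult_superset[of ?A])
             apply (simp_all add: lookup_add flip: S.finsum_addf)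
    apply (subst S.finsum_addf[symmetric])
      apply (auto intro!: S.add.int_pow_closed S.finsum_cong' simp: S.add.int_pow_mult)
    done
qed

lemma pair_mult_of: "a \<in> carrier S \<Longrightarrow> b \<in> carrier S \<Longrightarrow> pair_mult S (frag_of (a, b)) = a \<otimes>\<^bsub>S\<^esub> b"
  by (simp add: pair_mult_def)

lemma pair_mult_closed: "f \<in> carrier (pair_ring S) \<Longrightarrow> pair_mult S f \<in> carrier S"
  unfolding pair_mult_def by (rule S.finsum_closed) (auto simp: pair_ring_carrier intro!: S.add.int_pow_closed)

lemma pair_mult_diff:
  assumes "f \<in> carrier (pair_ring S)" "g \<in> carrier (pair_ring S)"
  shows "pair_mult S (f - g) = pair_mult S f \<ominus>\<^bsub>S\<^esub> pair_mult S g"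
proof -
  have c: "f - g \<in> carrier (pair_ring S)" using assms P.minus_closed pair_ring_minus by metis
  have "pair_mult S f = pair_mult S (f - g) \<oplus>\<^bsub>S\<^esub> pair_mult S g"
    using pair_mult_add[OF c assms(2)] by simp
  with pair_mult_closed[OF c] pair_mult_closed[OF assms(2)]
  show ?thesis by (simp add: a_minus_def S.a_assoc S.r_neg)
qed

lemma pair_mult_zero: "pair_mult S 0 = \<zero>\<^bsub>S\<^esub>" by (simp add: pair_mult_def)

lemma pair_mult_mult:
  assumes "f \<in> carrier (pair_ring S)" "g \<in> carrier (pair_ring S)"
  shows "pair_mult S (f \<otimes>\<^bsub>pair_ring S\<^esub> g) = pair_mult S f \<otimes>\<^bsub>S\<^esub> pair_mult S g"
proof -
  have of: "pair_mult S (frag_of (a, b) \<otimes>\<^bsub>pair_ring S\<^esub> g) = (a \<otimes>\<^bsub>S\<^esub> b) \<otimes>\<^bsub>S\<^esub> pair_mult S g"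
    if ab: "a \<in> carrier S" "b \<in> carrier S" for a b
    using assms(2)
  proof (induction rule: pair_ring_induct)
    case (diff f g)
    have "frag_of (a, b) \<in> carrier (pair_ring S)" using ab by (simp add: pair_ring_carrier)
    with diff ab show ?case
      by (simp add: pair_ring_mult_diff pair_mult_diff pair_mult_closed P.m_closed a_minus_def S.r_distr S.r_minus)
  qed (use ab in \<open>auto simp: pair_ring_mult_zero pair_mult_zero pair_ring_mult_of pair_mult_of S.m_ac\<close>)
  show ?thesis
    using assms(1)
  proof (induction rule: pair_ring_induct)
    case (diff f f')
    with assms(2) show ?case
      by (simp add: pair_ring_mult_diff pair_mult_diff pair_mult_closed P.m_closed a_minus_def S.l_distr S.l_minus)
  qed (use assms(2) in \<open>auto simp: pair_ring_mult_zero pair_mult_zero of pair_mult_of pair_mult_closed\<close>)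
qed

lemma pair_mult_ring_hom: "pair_mult S \<in> ring_hom (pair_ring S) S"
  by (rule ring_hom_memI)
     (auto simp: pair_mult_closed pair_mult_mult pair_ring_add pair_mult_add pair_ring_one pair_mult_of)

lemma tensor_mult_coset:
  assumes R: "R \<subseteq> carrier S" and f: "f \<in> carrier (pair_ring S)"
  shows "tensor_mult S (Idl\<^bsub>pair_ring S\<^esub> (tensor_relations R S) +>\<^bsub>pair_ring S\<^esub> f) = pair_mult S f"
proof -
  interpret \<mu>: ring_hom_ring "pair_ring S" S "pair_mult S"
    by (intro ring_hom_ringI2 pair_mult_ring_hom) unfold_locales
  have of: "frag_of (a, b) \<in> carrier (pair_ring S)" if "a \<in> carrier S" "b \<in> carrier S" for a b
    using that by (simp add: pair_ring_carrier)
  have diff: "u - v \<in> carrier (pair_ring S)" if "u \<in> carrier (pair_ring S)" "v \<in> carrier (pair_ring S)" for u v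
    using that P.minus_closed pair_ring_minus by metis
  have "tensor_relations R S \<subseteq> a_kernel (pair_ring S) S (pair_mult S)"
  proof
    fix u assume u: "u \<in> tensor_relations R S"
    then have uc: "u \<in> carrier (pair_ring S)" using tensor_relations_subset[OF R] by blast
    have cancel: "((x \<oplus>\<^bsub>S\<^esub> y) \<ominus>\<^bsub>S\<^esub> x) \<ominus>\<^bsub>S\<^esub> y = \<zero>\<^bsub>S\<^esub>"
      if "x \<in> carrier S" "y \<in> carrier S" for x y
    proof -
      have "x \<oplus>\<^bsub>S\<^esub> y = y \<oplus>\<^bsub>S\<^esub> x" using that by (rule S.a_comm)
      then show ?thesis using that by (simp add: a_minus_def S.a_assoc S.r_neg)
    qed
    have "pair_mult S u = \<zero>\<^bsub>S\<^esub>"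
      using u unfolding tensor_relations_def
    proof (elim UnE CollectE exE conjE)
      fix a a' b assume *: "a \<in> carrier S" "a' \<in> carrier S" "b \<in> carrier S"
        and u: "u = frag_of (a \<oplus>\<^bsub>S\<^esub> a', b) - frag_of (a, b) - frag_of (a', b)"
      show "pair_mult S u = \<zero>\<^bsub>S\<^esub>"
        unfolding u using * by (simp add: pair_mult_diff of diff pair_mult_of S.l_distr cancel)
    next
      fix a b b' assume *: "a \<in> carrier S" "b \<in> carrier S" "b' \<in> carrier S"
        and u: "u = frag_of (a, b \<oplus>\<^bsub>S\<^esub> b') - frag_of (a, b) - frag_of (a, b')"
      show "pair_mult S u = \<zero>\<^bsub>S\<^esub>"
        unfolding u using * by (simp add: pair_mult_diff of diff pair_mult_of S.r_distr cancel)
    next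
      fix r a b assume *: "r \<in> R" "a \<in> carrier S" "b \<in> carrier S"
        and u: "u = frag_of (r \<otimes>\<^bsub>S\<^esub> a, b) - frag_of (a, r \<otimes>\<^bsub>S\<^esub> b)"
      have "r \<in> carrier S" using * R by blast
      moreover from this * have "r \<otimes>\<^bsub>S\<^esub> a \<otimes>\<^bsub>S\<^esub> b = a \<otimes>\<^bsub>S\<^esub> (r \<otimes>\<^bsub>S\<^esub> b)" by (simp add: S.m_ac)
      ultimately show "pair_mult S u = \<zero>\<^bsub>S\<^esub>"
        unfolding u using * by (simp add: pair_mult_diff of pair_mult_of)
    qed
    with uc show "u \<in> a_kernel (pair_ring S) S (pair_mult S)"
      unfolding a_kernel_def' by (intro CollectI conjI)
  qed
  then have sub: "Idl\<^bsub>pair_ring S\<^esub> (tensor_relations R S) \<subseteq> a_kernel (pair_ring S) S (pair_mult S)"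
    by (rule P.genideal_minimal[OF \<mu>.kernel_is_ideal])
  interpret I: ideal "Idl\<^bsub>pair_ring S\<^esub> (tensor_relations R S)" "pair_ring S"
    by (rule P.genideal_ideal[OF tensor_relations_subset[OF R]])
  have "pair_mult S ` (Idl\<^bsub>pair_ring S\<^esub> (tensor_relations R S) +>\<^bsub>pair_ring S\<^esub> f) = {pair_mult S f}"
  proof -
    have "pair_mult S v = pair_mult S f"
      if "v \<in> Idl\<^bsub>pair_ring S\<^esub> (tensor_relations R S) +>\<^bsub>pair_ring S\<^esub> f" for v
    proof -
      from that obtain i where i: "i \<in> Idl\<^bsub>pair_ring S\<^esub> (tensor_relations R S)" "v = i \<oplus>\<^bsub>pair_ring S\<^esub> f"
        by (auto simp: a_r_coset_def')
      with sub have "i \<in> carrier (pair_ring S)" "pair_mult S i = \<zero>\<^bsub>S\<^esub>" unfolding a_kernel_def' by blast+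
      with i f show ?thesis by simp
    qed
    moreover have "f \<in> Idl\<^bsub>pair_ring S\<^esub> (tensor_relations R S) +>\<^bsub>pair_ring S\<^esub> f"
      using f by (rule I.a_rcos_self)
    ultimately show ?thesis by blast
  qed
  then show ?thesis by (simp add: tensor_mult_def)
qed

end

end

theory Submission
  imports Defs
begin

text \<open>
  Let \<open>T = S \<otimes>\<^sub>R S\<close> and let \<open>I\<close> be the kernel of the multiplication map \<open>T \<rightarrow> S\<close>. The universal
  property of \<open>T\<close> shows that \<open>R \<rightarrow> S\<close> is an epimorphism iff \<open>I = 0\<close>, in which case \<open>I / I\<^sup>2 = 0\<close>.

  If \<open>R \<subseteq> S\<close> is radicial, every prime of \<open>T\<close> contains \<open>I\<close>: its two contractions to \<open>S\<close> agree, and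
  modulo it \<open>a \<otimes> 1\<close> and \<open>1 \<otimes> a\<close> have a common \<open>p\<^sup>n\<close>-th power, hence are equal. So \<open>I\<close> lies in the
  Jacobson radical. As \<open>I\<close> is finitely generated and \<open>I = I\<^sup>2\<close>, Nakayama's lemma gives \<open>I = 0\<close>.

  Conversely, for an epimorphism every balanced biadditive map \<open>\<beta>\<close> on \<open>S \<times> S\<close> satisfies
  \<open>\<beta>(x, 1) = \<beta>(1, x)\<close>. If \<open>x\<close> had a residue class at \<open>Q\<close> outside \<open>\<kappa>(Q \<inter> R)\<close>, then
  \<open>\<beta>(a, b) = \<phi>(a) b\<close> with a linear form \<open>\<phi>\<close> such that \<open>\<phi>(1) = 1\<close> and \<open>\<phi>(x) = 0\<close> would violate this.
  So the residual extensions are trivial, and two primes over the same prime \<open>P\<close> of \<open>R\<close> are kernels of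
  morphisms \<open>S \<rightarrow> \<kappa>(P)\<close> that agree on \<open>R\<close>.

  For the last claim adjoin the generators one at a time: if \<open>S = R[a]\<close> is a finite \<open>R\<close>-module and
  \<open>S \<noteq> R\<close>, then \<open>S / R\<close> has a quotient \<open>R / M\<close> with \<open>M\<close> maximal, and the induced
  \<open>\<phi> : S \<rightarrow> R / M\<close>, which kills \<open>1\<close>, again yields a balanced map with \<open>\<beta>(x, 1) \<noteq> \<beta>(1, x)\<close>.
\<close>

section \<open>Preliminaries on commutative rings\<close>

text \<open>Krull's theorem by Zorn. The family consists of the ideals above \<open>J\<close> that
  avoid \<open>\<one>\<close>, a form of properness that passes to unions of chains.\<close>

lemma (in cring) exists_maximalideal_above:
  assumes J: "ideal J R" "J \<noteq> carrier R"
  shows "\<exists>M. maximalideal M R \<and> J \<subseteq> M"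
proof -
  define F where "F = {I. ideal I R \<and> J \<subseteq> I \<and> \<one> \<notin> I}"
  have one: "\<one> \<notin> J" using J ideal.one_imp_carrier by blast
  have "\<exists>M\<in>F. \<forall>Y\<in>F. M \<subseteq> Y \<longrightarrow> Y = M"
  proof (rule subset_Zorn_nonempty)
    show "F \<noteq> {}" using J one by (auto simp: F_def)
    fix C assume C: "C \<noteq> {}" "subset.chain F C"
    then have C_sub: "C \<subseteq> {I. ideal I R}" by (auto simp: subset.chain_def F_def)
    then have "subset.chain {I. ideal I R} C" using C(2) by (simp add: subset.chain_def)
    from chain_Union_is_ideal[OF this] C(1) have "ideal (\<Union>C) R" by simp
    then show "\<Union>C \<in> F"
      using C by (auto simp: subset.chain_def F_def)
  qed
  then obtain M where MF: "M \<in> F" and maxF: "\<And>Y. Y \<in> F \<Longrightarrow> M \<subseteq> Y \<Longrightarrow> Y = M" by blast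
  from MF have M: "ideal M R" "J \<subseteq> M" "\<one> \<notin> M" by (auto simp: F_def)
  have "maximalideal M R"
  proof (rule maximalidealI[OF M(1)])
    show "carrier R \<noteq> M" using M(3) by blast
    fix Y assume Y: "ideal Y R" "M \<subseteq> Y" "Y \<subseteq> carrier R"
    show "Y = M \<or> Y = carrier R"
    proof (cases "\<one> \<in> Y")
      case False
      then have "Y \<in> F" using Y M(2) by (auto simp: F_def)
      with maxF Y(2) show ?thesis by blast
    qed (use ideal.one_imp_carrier[OF Y(1)] in simp)
  qed
  with M show ?thesis by blast
qed

text \<open>If \<open>\<one> \<ominus> x\<close> were a non-unit, its principal ideal would lie in
  some maximal \<open>M\<close>. As \<open>x \<in> M\<close> too, the sum \<open>\<one>\<close> of
  both would lie in \<open>M\<close>.\<close>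

lemma (in cring) one_minus_unit_if_in_maximalideals:
  assumes x: "x \<in> carrier R" and max: "\<And>M. maximalideal M R \<Longrightarrow> x \<in> M"
  shows "\<one> \<ominus> x \<in> Units R"
proof (rule ccontr)
  assume nu: "\<one> \<ominus> x \<notin> Units R"
  have y: "\<one> \<ominus> x \<in> carrier R" using x by simp
  have "PIdl (\<one> \<ominus> x) \<noteq> carrier R"
  proof
    assume "PIdl (\<one> \<ominus> x) = carrier R"
    then have "\<one> \<in> PIdl (\<one> \<ominus> x)" by simp
    then obtain z where "z \<in> carrier R" "\<one> = z \<otimes> (\<one> \<ominus> x)" unfolding cgenideal_def by blast
    with y nu show False unfolding Units_def by (metis (mono_tags, lifting) CollectI m_comm)
  qed
  then obtain M where M: "maximalideal M R" "PIdl (\<one> \<ominus> x) \<subseteq> M"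
    using exists_maximalideal_above cgenideal_ideal[OF y] by blast
  interpret M: maximalideal M R by (fact M(1))
  have "\<one> \<ominus> x \<in> M" "x \<in> M" using M cgenideal_self[OF y] max by auto
  then have "(\<one> \<ominus> x) \<oplus> x \<in> M" by (rule M.a_closed)
  then have "\<one> \<in> M" using x by (simp add: a_minus_def a_assoc l_neg)
  then show False using M.one_imp_carrier M.I_notcarr by simp
qed

text \<open>Nakayama's lemma without determinants: generators are discarded one at a time.
  \<open>I\<close> stays fixed during the induction, so \<open>I \<subseteq> I \<cdot> I\<close> and
  the units \<open>\<one> \<ominus> c\<close> remain available while \<open>A\<close>
  shrinks.\<close>

lemma (in cring) nakayama_idempotent_ideal:
  assumes "finite A" "A \<subseteq> carrier R" "I = Idl A" "I \<subseteq> I \<cdot> I"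
    and unit: "\<And>x. x \<in> I \<Longrightarrow> \<one> \<ominus> x \<in> Units R"
  shows "I = {\<zero>}"
  using assms(1,2,3)
proof (induction A)
  case empty
  interpret I: ideal I R unfolding empty by (rule genideal_ideal) simp
  have "ideal {\<zero>} R" by (rule zeroideal)
  then have "I \<subseteq> {\<zero>}" unfolding empty by (rule genideal_minimal) simp
  then show ?case using I.zero_closed by blast
next
  case (insert x A)
  then have xA: "x \<in> carrier R" "A \<subseteq> carrier R" "insert x A \<subseteq> carrier R" by auto
  interpret I: ideal I R unfolding insert.prems(2) by (rule genideal_ideal[OF xA(3)])
  interpret J: ideal "Idl A" R by (rule genideal_ideal[OF xA(2)])
  have gen: "insert x A \<subseteq> I" unfolding insert.prems(2) by (rule genideal_self[OF xA(3)])
  have JI: "Idl A \<subseteq> I" by (rule genideal_minimal[OF I.ideal_axioms]) (use gen in blast)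
  let ?K = "{c \<otimes> x \<oplus> y | c y. c \<in> carrier R \<and> y \<in> Idl A}"
  have "ideal ?K R"
  proof (rule idealI)
    show "ring R" by unfold_locales
    show "subgroup ?K (add_monoid R)"
    proof (rule add.subgroupI)
      show "?K \<subseteq> carrier R" using xA by auto
      have "\<zero> = \<zero> \<otimes> x \<oplus> \<zero>" using xA by simp
      then show "?K \<noteq> {}" using J.zero_closed by blast
      fix a assume "a \<in> ?K"
      then obtain c y where a: "a = c \<otimes> x \<oplus> y" "c \<in> carrier R" "y \<in> Idl A" by blast
      have "\<ominus> a = (\<ominus> c) \<otimes> x \<oplus> \<ominus> y" using a xA by (simp add: minus_add l_minus)
      then show "\<ominus> a \<in> ?K" using a by blast
      fix b assume "b \<in> ?K"
      then obtain c' y' where b: "b = c' \<otimes> x \<oplus> y'" "c' \<in> carrier R" "y' \<in> Idl A" by blast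
      have "a \<oplus> b = (c \<oplus> c') \<otimes> x \<oplus> (y \<oplus> y')" using a b xA by (simp add: l_distr a_ac)
      then show "a \<oplus> b \<in> ?K" using a b by blast
    qed
    fix a r assume "a \<in> ?K" and r: "r \<in> carrier R"
    then obtain c y where a: "a = c \<otimes> x \<oplus> y" "c \<in> carrier R" "y \<in> Idl A" by blast
    have "r \<otimes> a = (r \<otimes> c) \<otimes> x \<oplus> r \<otimes> y" using a xA r by (simp add: r_distr m_assoc)
    then show "r \<otimes> a \<in> ?K" using a r J.I_l_closed by blast
    moreover have "a \<otimes> r = r \<otimes> a" using a xA r by (simp add: m_comm)
    ultimately show "a \<otimes> r \<in> ?K" by simp
  qed
  moreover have "insert x A \<subseteq> ?K"
  proof -
    have "x = \<one> \<otimes> x \<oplus> \<zero>" using xA by simp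
    moreover have "a = \<zero> \<otimes> x \<oplus> a" if "a \<in> A" for a using xA that by auto
    ultimately show ?thesis using genideal_self[OF xA(2)] J.zero_closed by blast
  qed
  ultimately have IK: "I \<subseteq> ?K" unfolding insert.prems(2) by (rule genideal_minimal)
  \<comment> \<open>In a product \<open>i \<otimes> j\<close> only \<open>j\<close> is expanded as
    \<open>c \<otimes> x \<oplus> y\<close>; the factor \<open>i\<close> moves the coefficient of
    \<open>x\<close> into \<open>I\<close>.\<close>
  have "\<exists>c y. c \<in> I \<and> y \<in> Idl A \<and> u = c \<otimes> x \<oplus> y" if "u \<in> I \<cdot> I" for u
    using that
  proof (induction rule: ideal_prod.induct)
    case (prod i j)
    then obtain c y where j: "j = c \<otimes> x \<oplus> y" "c \<in> carrier R" "y \<in> Idl A" using IK by blast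
    have "i \<otimes> j = (i \<otimes> c) \<otimes> x \<oplus> i \<otimes> y" using j prod xA by (simp add: r_distr m_assoc)
    moreover have "i \<otimes> c \<in> I" "i \<otimes> y \<in> Idl A"
      using j prod I.I_r_closed J.I_l_closed by auto
    ultimately show ?case by blast
  next
    case (sum s t)
    then obtain c y c' y' where *: "c \<in> I" "y \<in> Idl A" "s = c \<otimes> x \<oplus> y"
      "c' \<in> I" "y' \<in> Idl A" "t = c' \<otimes> x \<oplus> y'" by blast
    have "s \<oplus> t = (c \<oplus> c') \<otimes> x \<oplus> (y \<oplus> y')" using * xA by (simp add: l_distr a_ac)
    moreover have "c \<oplus> c' \<in> I" "y \<oplus> y' \<in> Idl A" using * by auto
    ultimately show ?case by blast
  qed
  then obtain c y where cy: "c \<in> I" "y \<in> Idl A" "x = c \<otimes> x \<oplus> y" using gen assms(4) by blast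
  \<comment> \<open>As \<open>\<one> \<ominus> c\<close> is a unit, this makes the generator
    \<open>x\<close> redundant.\<close>
  have "(\<one> \<ominus> c) \<otimes> x = y"
  proof -
    have "(\<one> \<ominus> c) \<otimes> x = x \<ominus> c \<otimes> x" using cy(1) xA by (simp add: a_minus_def l_distr l_minus)
    also have "\<dots> = (c \<otimes> x \<oplus> y) \<ominus> c \<otimes> x" using cy(3) by simp
    also have "\<dots> = y" using cy(1,2) xA by (simp add: a_minus_def a_assoc a_comm[of y] r_neg2)
    finally show ?thesis .
  qed
  moreover have u: "\<one> \<ominus> c \<in> Units R" by (rule unit[OF cy(1)])
  ultimately have "x = inv (\<one> \<ominus> c) \<otimes> y"
    using xA Units_closed[OF u] by (metis Units_inv_closed Units_l_inv l_one m_assoc)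
  then have "x \<in> Idl A" using J.I_l_closed cy(2) Units_inv_closed[OF u] by simp
  then have "I \<subseteq> Idl A" unfolding insert.prems(2)
    by (intro genideal_minimal[OF J.ideal_axioms]) (use genideal_self[OF xA(2)] in blast)
  then have "I = Idl A" using JI by blast
  then show ?case using insert.IH xA by blast
qed

section \<open>Frobenius in prime characteristic\<close>

lemma (in cring) binomial_finsum:
  assumes "x \<in> carrier R" "y \<in> carrier R"
  shows "(x \<oplus> y) [^] n = (\<Oplus>k\<in>{..n}. [(n choose k)] \<cdot> (x [^] k \<otimes> y [^] (n - k)))"
proof (induction n)
  case 0
  then show ?case by simp
next
  case (Suc n)
  let ?t = "\<lambda>n k. [(n choose k)] \<cdot> (x [^] k \<otimes> y [^] (n - k))"
  \<comment> \<open>\<open>?s\<close> and \<open>?u\<close> are the two summands of Pascal's rule.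
    The case \<open>k = 0\<close> is set apart because truncated subtraction would make
    \<open>n choose (k - 1)\<close> equal to \<open>1\<close> there.\<close>
  let ?s = "\<lambda>k. (if k = 0 then \<zero> else [(n choose (k - 1))] \<cdot> (x [^] k \<otimes> y [^] (Suc n - k)))"
  let ?u = "\<lambda>k. [(n choose k)] \<cdot> (x [^] k \<otimes> y [^] (Suc n - k))"
  have S: "(\<Oplus>k\<in>{..Suc n}. ?t (Suc n) k) = (\<Oplus>k\<in>{..Suc n}. ?s k \<oplus> ?u k)"
  proof (rule finsum_cong')
    show "?t (Suc n) k = ?s k \<oplus> ?u k" if "k \<in> {..Suc n}" for k
      using assms by (cases k) (auto simp flip: add.nat_pow_mult)
  qed (use assms in auto)
  also have "\<dots> = (\<Oplus>k\<in>{..Suc n}. ?s k) \<oplus> (\<Oplus>k\<in>{..Suc n}. ?u k)"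
    using assms by (intro finsum_addf) auto
  also have "(\<Oplus>k\<in>{..Suc n}. ?s k) = (\<Oplus>k\<in>{..n}. x \<otimes> ?t n k)"
  proof -
    have "(\<Oplus>k\<in>{..Suc n}. ?s k) = (\<Oplus>k\<in>{..n}. ?s (Suc k)) \<oplus> ?s 0"
      using assms by (intro finsum_Suc2) auto
    also have "\<dots> = (\<Oplus>k\<in>{..n}. ?s (Suc k))" using assms by (simp add: finsum_closed)
    also have "\<dots> = (\<Oplus>k\<in>{..n}. x \<otimes> ?t n k)"
      using assms by (intro finsum_cong') (auto simp: add_pow_rdistr m_ac)
    finally show ?thesis .
  qed
  also have "(\<Oplus>k\<in>{..Suc n}. ?u k) = (\<Oplus>k\<in>{..n}. y \<otimes> ?t n k)"
  proof -
    \<comment> \<open>The top term vanishes because \<open>n choose Suc n\<close> is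
      \<open>0\<close>.\<close>
    have "(\<Oplus>k\<in>{..Suc n}. ?u k) = (\<Oplus>k\<in>{..n}. ?u k)"
      using assms by (simp add: finsum_Suc binomial_eq_0)
    also have "\<dots> = (\<Oplus>k\<in>{..n}. y \<otimes> ?t n k)"
      using assms by (intro finsum_cong') (auto simp: add_pow_rdistr Suc_diff_le m_ac)
    finally show ?thesis .
  qed
  also have "(\<Oplus>k\<in>{..n}. x \<otimes> ?t n k) \<oplus> (\<Oplus>k\<in>{..n}. y \<otimes> ?t n k) = (x \<oplus> y) \<otimes> (\<Oplus>k\<in>{..n}. ?t n k)"
    using assms by (simp add: finsum_rdistr l_distr Pi_def)
  also have "\<dots> = (x \<oplus> y) [^] Suc n" unfolding Suc.IH[symmetric] using assms by (simp add: m_comm)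
  finally show ?case by simp
qed

text \<open>In the binomial expansion all coefficients but the two outer ones are divisible by
  \<open>p\<close>.\<close>

lemma (in cring) frobenius_add:
  assumes p: "Factorial_Ring.prime (p :: nat)" "[p] \<cdot> \<one> = \<zero>" and xy: "x \<in> carrier R" "y \<in> carrier R"
  shows "(x \<oplus> y) [^] p = x [^] p \<oplus> y [^] p"
proof -
  let ?t = "\<lambda>k. [(p choose k)] \<cdot> (x [^] k \<otimes> y [^] (p - k))"
  have pz: "[m] \<cdot> z = \<zero>" if m: "p dvd m" and z: "z \<in> carrier R" for m z
  proof -
    obtain q where m: "m = p * q" using m by (rule dvdE)
    have "[m] \<cdot> \<one> = \<zero>" unfolding m using p(2) by (simp flip: add.nat_pow_pow)
    then show ?thesis using add_pow_ldistr[of \<one> z m] z by simp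
  qed
  have mid: "?t k = \<zero>" if "k \<noteq> 0" "k \<noteq> p" "k \<le> p" for k
    using that p(1) xy by (intro pz) (auto intro!: dvd_choose_prime)
  have p0: "p \<noteq> 0" using p(1) by auto
  have "(x \<oplus> y) [^] p = (\<Oplus>k\<in>{..p}. ?t k)" by (rule binomial_finsum[OF xy])
  also have "\<dots> = (\<Oplus>k\<in>{0, p}. ?t k)"
    using xy by (intro add.finprod_mono_neutral_cong_right) (auto intro!: mid)
  also have "\<dots> = x [^] p \<oplus> y [^] p" using xy p0 by (simp add: a_comm)
  finally show ?thesis .
qed

lemma (in domain) nat_pow_eq_zeroD:
  assumes "x \<in> carrier R" "x [^] (n :: nat) = \<zero>"
  shows "x = \<zero>"
  using assms(2) by (induction n) (use assms(1) integral in auto)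

lemma (in domain) pow_char_exponent_inj:
  assumes p: "Factorial_Ring.prime (p :: nat)" "[p] \<cdot> \<one> = \<zero>" and xy: "x \<in> carrier R" "y \<in> carrier R"
    and eq: "x [^] (p ^ n) = y [^] (p ^ n)"
  shows "x = y"
  using eq xy
proof (induction n arbitrary: x y)
  case (Suc n)
  have c: "x [^] p = y [^] p"
    using Suc.IH[of "x [^] p" "y [^] p"] Suc.prems by (simp add: nat_pow_pow)
  \<comment> \<open>Expanding \<open>(x \<ominus> y) \<oplus> y\<close> instead of
    \<open>x \<ominus> y\<close> avoids the sign of \<open>(\<ominus> y) [^] p\<close>.\<close>
  have "(x \<ominus> y) [^] p \<oplus> y [^] p = (x \<ominus> y \<oplus> y) [^] p"
    by (rule frobenius_add[OF p, symmetric]) (use Suc.prems in auto)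
  also have "\<dots> = y [^] p" using Suc.prems c by (simp add: a_minus_def a_assoc l_neg)
  finally have "(x \<ominus> y) [^] p = \<zero>" using Suc.prems by simp
  then have "x \<ominus> y = \<zero>" using nat_pow_eq_zeroD Suc.prems by (metis minus_closed)
  then show ?case using Suc.prems by simp
qed simp

text \<open>\<open>[m] \<cdot> \<one>\<close> vanishes exactly when \<open>p dvd m\<close>, and it
  is multiplicative in \<open>m\<close>; the absence of zero divisors does the rest. So a
  \<open>char_exponent\<close> that comes from a nonzero order is a prime.\<close>

lemma (in domain) prime_ord_one:
  assumes "group.ord (add_monoid R) \<one> = p" "p \<noteq> 0"
  shows "Factorial_Ring.prime p" "[p] \<cdot> \<one> = \<zero>"
proof -
  have zero_iff: "[m] \<cdot> \<one> = \<zero> \<longleftrightarrow> p dvd m" for m :: nat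
    using add.pow_eq_id[of \<one> m] assms by simp
  show "[p] \<cdot> \<one> = \<zero>" using zero_iff by simp
  have p1: "p \<noteq> 1"
    using zero_iff[of 1] by auto
  show "Factorial_Ring.prime p"
  proof (rule normalization_semidom_class.primeI)
    show "prime_elem p"
    proof (rule prime_elemI)
      fix m n assume "p dvd m * n"
      then have "[(m * n)] \<cdot> \<one> = \<zero>" using zero_iff by blast
      moreover have "[(m * n)] \<cdot> \<one> = [m] \<cdot> \<one> \<otimes> [n] \<cdot> \<one>"
        by (simp add: add_pow_ldistr add_pow_rdistr add.nat_pow_pow mult.commute)
      ultimately show "p dvd m \<or> p dvd n" using zero_iff integral[of "[m] \<cdot> \<one>" "[n] \<cdot> \<one>"] by auto
    qed (use assms(2) p1 in auto)
  qed simp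
qed

lemma (in ring_hom_ring) hom_add_pow:
  fixes n :: nat
  assumes "x \<in> carrier R"
  shows "h (add_pow R n x) = add_pow S n (h x)"
  using assms by (induction n) auto

section \<open>The canonical map to a residue field\<close>

lemma (in primeideal) residue_frac_hom:
  "(\<lambda>a. residue_frac R I a \<one>) \<in> ring_hom R (residue_field R I)"
proof -
  have one: "\<one> \<in> carrier R - I" using I_notcarr one_imp_carrier by auto
  show ?thesis
    by (rule ring_hom_memI)
       (use one in \<open>auto simp: residue_frac_closed residue_frac_mult residue_frac_add residue_frac_one\<close>)
qed

lemma (in primeideal) residue_frac_eq_zero_iff:
  assumes "a \<in> carrier R"
  shows "residue_frac R I a \<one> = \<zero>\<^bsub>residue_field R I\<^esub> \<longleftrightarrow> a \<in> I"
proof -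
  have one: "\<one> \<in> carrier R - I" using I_notcarr one_imp_carrier by auto
  interpret K: field "residue_field R I" by (rule field_residue_field)
  interpret h: ring_hom_ring R "residue_field R I" "\<lambda>a. residue_frac R I a \<one>"
    by (intro ring_hom_ringI2 residue_frac_hom) unfold_locales
  have "\<zero>\<^bsub>residue_field R I\<^esub> = residue_frac R I \<zero> \<one>" using h.hom_zero by simp
  then show ?thesis using residue_frac_eq_iff[OF assms one zero_closed one] assms by (simp add: a_minus_def)
qed

lemma (in primeideal) residue_frac_eq_iff_mult:
  assumes "r \<in> carrier R" "s \<in> carrier R - I" "r' \<in> carrier R" "s' \<in> carrier R - I"
  shows "residue_frac R I r s = residue_frac R I r' s' \<longleftrightarrow>
    residue_frac R I (r \<otimes> s') \<one> = residue_frac R I (r' \<otimes> s) \<one>"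
proof -
  have one: "\<one> \<in> carrier R - I" using I_notcarr one_imp_carrier by auto
  show ?thesis using assms one by (simp add: residue_frac_eq_iff)
qed

section \<open>The tensor square and its diagonal ideal\<close>

text \<open>A locale, because the last section instantiates it again with a larger base inside the
  same \<open>S\<close>.\<close>

locale ring_extension = cring S for S (structure) +
  fixes R
  assumes subring_R: "subring R S"
begin

lemma R_carrier: "R \<subseteq> carrier S"
  by (rule subringE(1)[OF subring_R])

lemma R_closed [simp]: "r \<in> R \<Longrightarrow> r \<in> carrier S"
  using R_carrier by blast

abbreviation P where "P \<equiv> pair_ring S"
abbreviation T where "T \<equiv> tensor_square R S"
definition N where "N = Idl\<^bsub>P\<^esub> (tensor_relations R S)"
definition tens where "tens a b = N +>\<^bsub>P\<^esub> frag_of (a, b)"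

lemma T_eq: "T = P Quot N"
  by (simp add: tensor_square_def N_def)

sublocale P: cring P by (rule cring_pair_ring[OF cring_axioms])
sublocale T: cring T by (rule cring_tensor_square[OF cring_axioms R_carrier])
sublocale N: ideal N P
  unfolding N_def by (rule P.genideal_ideal[OF tensor_relations_subset[OF cring_axioms R_carrier]])
sublocale proj: ring_hom_ring P T "\<lambda>f. N +>\<^bsub>P\<^esub> f"
  unfolding T_eq by (rule N.rcos_ring_hom_ring)

lemma frag_closed [simp]: "a \<in> carrier S \<Longrightarrow> b \<in> carrier S \<Longrightarrow> frag_of (a, b) \<in> carrier P"
  by (simp add: pair_ring_carrier[OF cring_axioms])

lemma coset_eqI: "f \<in> carrier P \<Longrightarrow> g \<in> carrier P \<Longrightarrow> f - g \<in> N \<Longrightarrow> N +>\<^bsub>P\<^esub> f = N +>\<^bsub>P\<^esub> g"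
  and coset_eqD: "f \<in> carrier P \<Longrightarrow> g \<in> carrier P \<Longrightarrow> N +>\<^bsub>P\<^esub> f = N +>\<^bsub>P\<^esub> g \<Longrightarrow> f - g \<in> N"
  using P.quotient_eq_iff_same_a_r_cos[OF N.ideal_axioms, of f g] pair_ring_minus[OF cring_axioms, of f g]
  by auto

lemma tensor_relations_N: "tensor_relations R S \<subseteq> N"
  unfolding N_def by (rule P.genideal_self[OF tensor_relations_subset[OF cring_axioms R_carrier]])

lemmas pair_induct = pair_ring_induct[OF cring_axioms, consumes 1, case_names zero of_pair diff]

section \<open>Pure tensors and balanced maps\<close>

lemma tens_closed [simp]: "a \<in> carrier S \<Longrightarrow> b \<in> carrier S \<Longrightarrow> tens a b \<in> carrier T"
  unfolding tens_def by simp

lemma tens_add_left: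
  assumes "a \<in> carrier S" "a' \<in> carrier S" "b \<in> carrier S"
  shows "tens (a \<oplus> a') b = tens a b \<oplus>\<^bsub>T\<^esub> tens a' b"
proof -
  have "frag_of (a \<oplus> a', b) - frag_of (a, b) - frag_of (a', b) \<in> N"
    using tensor_relations_N assms unfolding tensor_relations_def by blast
  then have "frag_of (a \<oplus> a', b) - (frag_of (a, b) \<oplus>\<^bsub>P\<^esub> frag_of (a', b)) \<in> N"
    by (simp add: pair_ring_add[OF cring_axioms] diff_diff_eq)
  then have "tens (a \<oplus> a') b = N +>\<^bsub>P\<^esub> (frag_of (a, b) \<oplus>\<^bsub>P\<^esub> frag_of (a', b))"
    unfolding tens_def using assms by (intro coset_eqI) auto
  then show ?thesis using assms by (simp add: tens_def)
qed

lemma tens_add_right: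
  assumes "a \<in> carrier S" "b \<in> carrier S" "b' \<in> carrier S"
  shows "tens a (b \<oplus> b') = tens a b \<oplus>\<^bsub>T\<^esub> tens a b'"
proof -
  have "frag_of (a, b \<oplus> b') - frag_of (a, b) - frag_of (a, b') \<in> N"
    using tensor_relations_N assms unfolding tensor_relations_def by blast
  then have "frag_of (a, b \<oplus> b') - (frag_of (a, b) \<oplus>\<^bsub>P\<^esub> frag_of (a, b')) \<in> N"
    by (simp add: pair_ring_add[OF cring_axioms] diff_diff_eq)
  then have "tens a (b \<oplus> b') = N +>\<^bsub>P\<^esub> (frag_of (a, b) \<oplus>\<^bsub>P\<^esub> frag_of (a, b'))"
    unfolding tens_def using assms by (intro coset_eqI) auto
  then show ?thesis using assms by (simp add: tens_def)
qed

lemma tens_balanced: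
  assumes "r \<in> R" "a \<in> carrier S" "b \<in> carrier S"
  shows "tens (r \<otimes> a) b = tens a (r \<otimes> b)"
  unfolding tens_def
proof (rule coset_eqI)
  show "frag_of (r \<otimes> a, b) - frag_of (a, r \<otimes> b) \<in> N"
    using tensor_relations_N assms unfolding tensor_relations_def by blast
qed (use assms in auto)

lemma tens_mult:
  assumes "a \<in> carrier S" "b \<in> carrier S" "c \<in> carrier S" "d \<in> carrier S"
  shows "tens a b \<otimes>\<^bsub>T\<^esub> tens c d = tens (a \<otimes> c) (b \<otimes> d)"
proof -
  have "tens a b \<otimes>\<^bsub>T\<^esub> tens c d = N +>\<^bsub>P\<^esub> (frag_of (a, b) \<otimes>\<^bsub>P\<^esub> frag_of (c, d))"
    unfolding tens_def using assms by simp
  then show ?thesis by (simp add: tens_def pair_ring_mult_of[OF cring_axioms])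
qed

lemma tens_one: "\<one>\<^bsub>T\<^esub> = tens \<one> \<one>"
  using proj.hom_one by (simp add: tens_def pair_ring_one[OF cring_axioms])

lemma tens_hom_left: "(\<lambda>a. tens a \<one>) \<in> ring_hom S T"
  and tens_hom_right: "(\<lambda>a. tens \<one> a) \<in> ring_hom S T"
  by (auto intro!: ring_hom_memI simp: tens_mult tens_add_left tens_add_right tens_one)

lemma tens_base: "r \<in> R \<Longrightarrow> tens r \<one> = tens \<one> r"
  using tens_balanced[of r \<one> \<one>] by simp

text \<open>Every tensor is the class of an integer combination of pairs. Closure under differences
  rather than sums also reaches the negative coefficients.\<close>

lemma tensor_induct [consumes 1, case_names zero tens minus]:
  assumes "u \<in> carrier T" and "Q \<zero>\<^bsub>T\<^esub>"
    and "\<And>a b. a \<in> carrier S \<Longrightarrow> b \<in> carrier S \<Longrightarrow> Q (tens a b)"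
    and "\<And>u v. \<lbrakk>u \<in> carrier T; v \<in> carrier T; Q u; Q v\<rbrakk> \<Longrightarrow> Q (u \<ominus>\<^bsub>T\<^esub> v)"
  shows "Q u"
proof -
  obtain f where f: "f \<in> carrier P" "u = N +>\<^bsub>P\<^esub> f"
    using assms(1) unfolding T_eq FactRing_simps by auto
  from f(1) have "Q (N +>\<^bsub>P\<^esub> f)"
  proof (induction rule: pair_induct)
    case zero
    then show ?case using assms(2) proj.hom_zero by (simp add: pair_ring_zero[OF cring_axioms])
  next
    case (of_pair a b)
    then show ?case using assms(3) by (simp add: tens_def)
  next
    case (diff f g)
    have "N +>\<^bsub>P\<^esub> (f - g) = (N +>\<^bsub>P\<^esub> f) \<ominus>\<^bsub>T\<^esub> (N +>\<^bsub>P\<^esub> g)"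
      using diff by (simp add: a_minus_def flip: pair_ring_minus[OF cring_axioms])
    then show ?case using diff assms(4) by simp
  qed
  with f show ?thesis by simp
qed

text \<open>The additive extension of a balanced map is not multiplicative, so its kernel need not be an
  ideal a priori; hence the relations are tested after multiplication by arbitrary elements.\<close>

lemma tens_eq_imp_balanced_eq:
  fixes \<beta> :: "'a \<Rightarrow> 'a \<Rightarrow> 'c" and G :: "('c, 'd) ring_scheme"
  assumes G: "abelian_group G"
    and closed: "\<And>a b. a \<in> carrier S \<Longrightarrow> b \<in> carrier S \<Longrightarrow> \<beta> a b \<in> carrier G"
    and left: "\<And>a a' b. \<lbrakk>a \<in> carrier S; a' \<in> carrier S; b \<in> carrier S\<rbrakk> \<Longrightarrow>
        \<beta> (a \<oplus> a') b = \<beta> a b \<oplus>\<^bsub>G\<^esub> \<beta> a' b"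
    and right: "\<And>a b b'. \<lbrakk>a \<in> carrier S; b \<in> carrier S; b' \<in> carrier S\<rbrakk> \<Longrightarrow>
        \<beta> a (b \<oplus> b') = \<beta> a b \<oplus>\<^bsub>G\<^esub> \<beta> a b'"
    and bal: "\<And>r a b. \<lbrakk>r \<in> R; a \<in> carrier S; b \<in> carrier S\<rbrakk> \<Longrightarrow> \<beta> (r \<otimes> a) b = \<beta> a (r \<otimes> b)"
    and abcd: "a \<in> carrier S" "b \<in> carrier S" "c \<in> carrier S" "d \<in> carrier S"
    and eq: "tens a b = tens c d"
  shows "\<beta> a b = \<beta> c d"
proof -
  interpret G: abelian_group G by fact
  note P_simps = pair_ring_mult_diff[OF cring_axioms] pair_ring_mult_zero[OF cring_axioms]
    pair_ring_mult_of[OF cring_axioms]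
  have "case_prod \<beta> ` (carrier S \<times> carrier S) \<subseteq> carrier (add_monoid G)" using closed by auto
  \<comment> \<open>\<open>\<Phi>\<close> is the additive extension of \<open>\<beta>\<close> given
    by the universal property of the free abelian group.\<close>
  then obtain \<Phi> where hom: "\<Phi> \<in> hom (free_Abelian_group (carrier S \<times> carrier S)) (add_monoid G)"
    and of: "\<And>x. x \<in> carrier S \<times> carrier S \<Longrightarrow> \<Phi> (frag_of x) = case_prod \<beta> x"
    using comm_group.free_Abelian_group_universal[OF G.a_comm_group] by blast
  interpret \<Phi>: abelian_group_hom P G \<Phi>
    by (intro abelian_group_homI P.abelian_group_axioms G group_hom.intro group_hom_axioms.intro
        P.a_group G.a_group)
       (use hom in \<open>simp add: pair_ring_def free_Abelian_group_def hom_def\<close>)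
  have of': "\<Phi> (frag_of (a, b)) = \<beta> a b" if "a \<in> carrier S" "b \<in> carrier S" for a b
    using of that by simp
  have \<Phi>_diff: "\<Phi> (f - g) = \<Phi> f \<ominus>\<^bsub>G\<^esub> \<Phi> g" and diff_closed: "f - g \<in> carrier P"
    if "f \<in> carrier P" "g \<in> carrier P" for f g
    using that by (simp_all add: a_minus_def flip: pair_ring_minus[OF cring_axioms])
  \<comment> \<open>The largest ideal inside the kernel of \<open>\<Phi>\<close>.\<close>
  define J where "J = {f \<in> carrier P. \<forall>g \<in> carrier P. \<Phi> (f \<otimes>\<^bsub>P\<^esub> g) = \<zero>\<^bsub>G\<^esub>}"
  have "ideal J P"
  proof (rule idealI)
    show "subgroup J (add_monoid P)"
    proof (rule P.add.subgroupI)
      have "\<zero>\<^bsub>P\<^esub> \<in> J" by (auto simp: J_def)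
      then show "J \<noteq> {}" by blast
    qed (auto simp: J_def P.l_minus P.l_distr)
  qed (auto simp: J_def P.m_assoc P.m_comm P.m_lcomm P.ring_axioms)
  moreover have "tensor_relations R S \<subseteq> J"
  proof
    fix u assume u: "u \<in> tensor_relations R S"
    then have uc: "u \<in> carrier P" using tensor_relations_subset[OF cring_axioms R_carrier] by blast
    have cancel: "((x \<oplus>\<^bsub>G\<^esub> y) \<ominus>\<^bsub>G\<^esub> x) \<ominus>\<^bsub>G\<^esub> y = \<zero>\<^bsub>G\<^esub>"
      if "x \<in> carrier G" "y \<in> carrier G" for x y
      using that by (simp add: a_minus_def G.a_assoc G.a_comm[of x y] G.r_neg)
    \<comment> \<open>By additivity \<open>g\<close> may be a single pair, and the product of a
      relation with a pair is a relation of the same kind.\<close>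
    have "\<Phi> (u \<otimes>\<^bsub>P\<^esub> g) = \<zero>\<^bsub>G\<^esub>" if "g \<in> carrier P" for g
      using that
    proof (induction rule: pair_induct)
      case zero
      then show ?case using \<Phi>.hom_zero by (simp add: P_simps pair_ring_zero[OF cring_axioms])
    next
      case (of_pair x y)
      from u show ?case unfolding tensor_relations_def
      proof (elim UnE CollectE exE conjE)
        fix a a' b assume "a \<in> carrier S" "a' \<in> carrier S" "b \<in> carrier S"
          "u = frag_of (a \<oplus> a', b) - frag_of (a, b) - frag_of (a', b)"
        with of_pair show ?thesis by (simp add: P_simps \<Phi>_diff diff_closed of' l_distr left closed cancel)
      next
        fix a b b' assume "a \<in> carrier S" "b \<in> carrier S" "b' \<in> carrier S"
          "u = frag_of (a, b \<oplus> b') - frag_of (a, b) - frag_of (a, b')"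
        with of_pair show ?thesis by (simp add: P_simps \<Phi>_diff diff_closed of' l_distr right closed cancel)
      next
        fix r a b assume *: "r \<in> R" "a \<in> carrier S" "b \<in> carrier S"
          "u = frag_of (r \<otimes> a, b) - frag_of (a, r \<otimes> b)"
        with of_pair show ?thesis
          by (simp add: P_simps \<Phi>_diff of' m_assoc bal closed a_minus_def G.r_neg)
      qed
    next
      case (diff f g)
      with uc show ?case by (simp add: P_simps \<Phi>_diff a_minus_def G.r_neg)
    qed
    with uc show "u \<in> J" by (simp add: J_def)
  qed
  ultimately have "N \<subseteq> J" unfolding N_def by (rule P.genideal_minimal)
  moreover have "frag_of (a, b) - frag_of (c, d) \<in> N"
    using eq abcd unfolding tens_def by (intro coset_eqD) auto
  \<comment> \<open>The factor \<open>\<one>\<close> recovers the value of \<open>\<Phi>\<close>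
    from membership in \<open>J\<close>.\<close>
  ultimately have "\<Phi> ((frag_of (a, b) - frag_of (c, d)) \<otimes>\<^bsub>P\<^esub> \<one>\<^bsub>P\<^esub>) = \<zero>\<^bsub>G\<^esub>"
    unfolding J_def by blast
  then have "\<beta> a b \<oplus>\<^bsub>G\<^esub> \<ominus>\<^bsub>G\<^esub> \<beta> c d = \<zero>\<^bsub>G\<^esub>"
    using abcd by (simp add: diff_closed \<Phi>_diff of' a_minus_def)
  from G.minus_equality[OF this] show ?thesis using abcd closed by simp
qed

section \<open>Epimorphisms tested on the tensor square\<close>

text \<open>\<open>tens a \<one>\<close> and \<open>tens \<one> a\<close>, as functions of
  \<open>a\<close>, form the universal pair of morphisms from \<open>S\<close> that agree on
  \<open>R\<close>, so epimorphisms are recognised on this single pair.\<close>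

lemma epimorphism_iff_tens:
  "ring_epimorphism (S\<lparr>carrier := R\<rparr>) S (\<lambda>x. x) \<longleftrightarrow> (\<forall>x \<in> carrier S. tens x \<one> = tens \<one> x)"
proof
  assume epi: "ring_epimorphism (S\<lparr>carrier := R\<rparr>) S (\<lambda>x. x)"
  show "\<forall>x \<in> carrier S. tens x \<one> = tens \<one> x"
  proof
    fix x assume x: "x \<in> carrier S"
    show "tens x \<one> = tens \<one> x"
      \<comment> \<open>The ring \<open>T\<close> is carried by another type than the test rings of
        the definition, hence the appeal to \<open>ring_epimorphism_any\<close>.\<close>
      by (rule ring_epimorphism_any[OF epi ring_axioms T.is_cring tens_hom_left tens_hom_right _ x])
         (simp add: tens_base)
  qed
next
  assume swap: "\<forall>x \<in> carrier S. tens x \<one> = tens \<one> x"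
  show "ring_epimorphism (S\<lparr>carrier := R\<rparr>) S (\<lambda>x. x)"
    unfolding ring_epimorphism_def
  proof (intro conjI allI impI ballI)
    show "(\<lambda>x. x) \<in> ring_hom (S\<lparr>carrier := R\<rparr>) S" by (rule ring_hom_memI) auto
    fix B :: "('a \<times> 'a) list ring" and g h x
    assume B: "cring B" and g: "g \<in> ring_hom S B" and h: "h \<in> ring_hom S B"
      and agree: "\<forall>a \<in> carrier (S\<lparr>carrier := R\<rparr>). g a = h a" and x: "x \<in> carrier S"
    interpret B: cring B by (rule B)
    interpret g: ring_hom_ring S B g using g by (intro ring_hom_ringI2) unfold_locales
    interpret h: ring_hom_ring S B h using h by (intro ring_hom_ringI2) unfold_locales
    \<comment> \<open>For morphisms that agree on \<open>R\<close> the map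
      \<open>g a \<otimes> h b\<close> is balanced, so equal tensors have equal values.\<close>
    have "g x \<otimes>\<^bsub>B\<^esub> h \<one> = g \<one> \<otimes>\<^bsub>B\<^esub> h x"
      by (rule tens_eq_imp_balanced_eq[OF B.abelian_group_axioms, where \<beta> = "\<lambda>a b. g a \<otimes>\<^bsub>B\<^esub> h b"])
         (use x agree swap in \<open>auto simp: B.l_distr B.r_distr B.m_ac\<close>)
    then show "g x = h x" using x by simp
  qed
qed

section \<open>The multiplication map and its kernel\<close>

text \<open>On a coset \<open>tensor_mult\<close> takes the common value of
  \<open>pair_mult\<close>, so its homomorphism laws are read off from representatives.\<close>

interpretation mu: ring_hom_ring T S "tensor_mult S"
proof (intro ring_hom_ringI2 T.ring_axioms ring_axioms)
  have tm: "tensor_mult S (N +>\<^bsub>P\<^esub> f) = pair_mult S f" if "f \<in> carrier P" for f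
    using tensor_mult_coset[OF cring_axioms R_carrier that] by (simp add: N_def)
  interpret pm: ring_hom_ring P S "pair_mult S"
    by (intro ring_hom_ringI2 P.ring_axioms ring_axioms pair_mult_ring_hom[OF cring_axioms])
  have ex: "\<exists>f. f \<in> carrier P \<and> u = N +>\<^bsub>P\<^esub> f" if "u \<in> carrier T" for u
    using that unfolding T_eq FactRing_simps by auto
  show "tensor_mult S \<in> ring_hom T S"
  proof (rule ring_hom_memI)
    fix u assume "u \<in> carrier T"
    then obtain f where f: "f \<in> carrier P" "u = N +>\<^bsub>P\<^esub> f" using ex by blast
    then show "tensor_mult S u \<in> carrier S" by (simp add: tm)
    fix v assume "v \<in> carrier T"
    then obtain g where g: "g \<in> carrier P" "v = N +>\<^bsub>P\<^esub> g" using ex by blast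
    show "tensor_mult S (u \<otimes>\<^bsub>T\<^esub> v) = tensor_mult S u \<otimes> tensor_mult S v"
      using f g by (simp add: tm flip: proj.hom_mult)
    show "tensor_mult S (u \<oplus>\<^bsub>T\<^esub> v) = tensor_mult S u \<oplus> tensor_mult S v"
      using f g by (simp add: tm flip: proj.hom_add)
  next
    show "tensor_mult S \<one>\<^bsub>T\<^esub> = \<one>" by (simp add: tm flip: proj.hom_one)
  qed
qed

lemma tensor_mult_tens:
  assumes "a \<in> carrier S" "b \<in> carrier S"
  shows "tensor_mult S (tens a b) = a \<otimes> b"
  using tensor_mult_coset[OF cring_axioms R_carrier frag_closed[OF assms]] assms
  by (simp add: tens_def N_def pair_mult_of[OF cring_axioms])

abbreviation I where "I \<equiv> diagonal_ideal R S"

lemma ideal_diagonal: "ideal I T"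
  unfolding diagonal_ideal_def by (rule mu.kernel_is_ideal)

lemma diagonal_iff: "u \<in> I \<longleftrightarrow> u \<in> carrier T \<and> tensor_mult S u = \<zero>"
  unfolding diagonal_ideal_def a_kernel_def' by (rule mem_Collect_eq)

text \<open>Modulo the square of \<open>I\<close> this is, up to sign, the universal
  derivation.\<close>

definition delta where "delta a = tens a \<one> \<ominus>\<^bsub>T\<^esub> tens \<one> a"

lemma delta_closed [simp]: "a \<in> carrier S \<Longrightarrow> delta a \<in> carrier T"
  by (simp add: delta_def)

lemma delta_in_diagonal: "a \<in> carrier S \<Longrightarrow> delta a \<in> I"
  by (simp add: diagonal_iff delta_def a_minus_def tensor_mult_tens r_neg)

text \<open>The elements \<open>delta a\<close>, with \<open>a\<close> from a set of algebra
  generators, generate \<open>I\<close>. In this form of minimality \<open>J\<close> can be zero, a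
  prime, or the ideal they span.\<close>

lemma diagonal_ideal_subset:
  assumes J: "ideal J T" and gen: "generate_ring S (R \<union> A) = carrier S" and AJ: "delta ` A \<subseteq> J"
  shows "I \<subseteq> J"
proof -
  interpret J: ideal J T by (fact J)
  interpret l: ring_hom_ring S T "\<lambda>a. tens a \<one>"
    by (intro ring_hom_ringI2 ring_axioms T.ring_axioms tens_hom_left)
  interpret r: ring_hom_ring S T "\<lambda>a. tens \<one> a"
    by (intro ring_hom_ringI2 ring_axioms T.ring_axioms tens_hom_right)
  have A: "A \<subseteq> carrier S" using gen generate_ring.incl[of _ "R \<union> A" S] by blast
  have d: "delta a \<in> J" if "a \<in> generate_ring S (R \<union> A)" for a
    using that
  proof (induction rule: generate_ring.induct)
    case one
    then show ?case by (simp add: delta_def a_minus_def T.r_neg)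
  next
    case (incl h)
    then show ?case using AJ tens_base by (auto simp: delta_def a_minus_def T.r_neg)
  next
    case (a_inv h)
    then have h: "h \<in> carrier S" using gen by simp
    have "delta (\<ominus> h) = \<ominus>\<^bsub>T\<^esub> delta h" using h
      by (simp add: delta_def a_minus_def T.minus_add)
    then show ?case using a_inv by simp
  next
    case (eng_add a b)
    then have h: "a \<in> carrier S" "b \<in> carrier S" using gen by simp_all
    have "delta (a \<oplus> b) = delta a \<oplus>\<^bsub>T\<^esub> delta b"
      using h by (simp add: delta_def a_minus_def T.minus_add T.a_ac)
    then show ?case using eng_add by simp
  next
    case (eng_mult a b)
    then have h: "a \<in> carrier S" "b \<in> carrier S" using gen by simp_all
    \<comment> \<open>A Leibniz rule: \<open>a\<close> acts on \<open>delta b\<close> through the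
      left factor, \<open>b\<close> on \<open>delta a\<close> through the right one.\<close>
    have "delta (a \<otimes> b) = tens a \<one> \<otimes>\<^bsub>T\<^esub> delta b \<oplus>\<^bsub>T\<^esub> delta a \<otimes>\<^bsub>T\<^esub> tens \<one> b"
      using h by (simp add: delta_def a_minus_def T.l_distr T.r_distr T.r_minus T.l_minus T.a_assoc T.r_neg1)
    then show ?case using eng_mult h J.I_l_closed J.I_r_closed by simp
  qed
  \<comment> \<open>Modulo \<open>J\<close> every tensor can be moved into the right factor, where
    it is determined by its product.\<close>
  have key: "u \<ominus>\<^bsub>T\<^esub> tens \<one> (tensor_mult S u) \<in> J" if "u \<in> carrier T" for u
    using that
  proof (induction rule: tensor_induct)
    case zero
    then show ?case by (simp add: a_minus_def T.r_neg)
  next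
    case (tens a b)
    have "tens a b \<ominus>\<^bsub>T\<^esub> tens \<one> (a \<otimes> b) = delta a \<otimes>\<^bsub>T\<^esub> tens \<one> b"
      using tens tens_mult[of a \<one> \<one> b]
      by (simp add: delta_def a_minus_def T.l_distr T.l_minus)
    then show ?case using d[of a] J.I_r_closed tens by (simp add: gen tensor_mult_tens)
  next
    case (minus u v)
    have "u \<ominus>\<^bsub>T\<^esub> v \<ominus>\<^bsub>T\<^esub> tens \<one> (tensor_mult S (u \<ominus>\<^bsub>T\<^esub> v)) =
      (u \<ominus>\<^bsub>T\<^esub> tens \<one> (tensor_mult S u)) \<oplus>\<^bsub>T\<^esub> (\<ominus>\<^bsub>T\<^esub> (v \<ominus>\<^bsub>T\<^esub> tens \<one> (tensor_mult S v)))"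
      using minus by (simp add: a_minus_def T.minus_add T.a_ac)
    then show ?case using minus by simp
  qed
  show ?thesis
  proof
    fix u assume "u \<in> I"
    then have "u \<in> carrier T" "tensor_mult S u = \<zero>" by (auto simp: diagonal_iff)
    then show "u \<in> J" using key[of u] by (simp add: a_minus_def)
  qed
qed

section \<open>Vanishing of the differentials\<close>

lemma trivial_differentials_if_diagonal_zero:
  assumes "I = {\<zero>\<^bsub>T\<^esub>}"
  shows "trivial_group (differentials R S)"
proof -
  have "I \<cdot>\<^bsub>T\<^esub> I = {\<zero>\<^bsub>T\<^esub>}"
  proof
    show "I \<cdot>\<^bsub>T\<^esub> I \<subseteq> {\<zero>\<^bsub>T\<^esub>}"
      using T.ideal_prod_inter[OF ideal_diagonal ideal_diagonal] assms by simp
    show "{\<zero>\<^bsub>T\<^esub>} \<subseteq> I \<cdot>\<^bsub>T\<^esub> I"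
      using ideal_prod.prod[of "\<zero>\<^bsub>T\<^esub>" I "\<zero>\<^bsub>T\<^esub>" I T] assms by simp
  qed
  then have "differentials R S = add_monoid (T\<lparr>carrier := {\<zero>\<^bsub>T\<^esub>}\<rparr>) Mod {\<zero>\<^bsub>T\<^esub>}"
    by (simp add: differentials_def assms)
  then have "carrier (differentials R S) = {{\<zero>\<^bsub>T\<^esub>}}" "\<one>\<^bsub>differentials R S\<^esub> = {\<zero>\<^bsub>T\<^esub>}"
    "{\<zero>\<^bsub>T\<^esub>} \<otimes>\<^bsub>differentials R S\<^esub> {\<zero>\<^bsub>T\<^esub>} = {\<zero>\<^bsub>T\<^esub>}"
    by (simp_all add: FactGroup_def RCOSETS_def r_coset_def set_mult_def)
  then show ?thesis unfolding trivial_group_def by (intro conjI groupI) simp_all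
qed

text \<open>A trivial quotient group has a single coset, the subgroup itself, and \<open>u\<close>
  lies in its own coset.\<close>

lemma diagonal_idempotent_if_trivial_differentials:
  assumes "trivial_group (differentials R S)"
  shows "I \<subseteq> I \<cdot>\<^bsub>T\<^esub> I"
proof
  fix u assume u: "u \<in> I"
  interpret I: ideal I T by (rule ideal_diagonal)
  interpret II: ideal "I \<cdot>\<^bsub>T\<^esub> I" T by (rule T.ideal_prod_is_ideal[OF ideal_diagonal ideal_diagonal])
  let ?A = "add_monoid (T\<lparr>carrier := I\<rparr>)"
  have "(I \<cdot>\<^bsub>T\<^esub> I) #>\<^bsub>?A\<^esub> u \<in> carrier (differentials R S)"
    using u by (auto simp: differentials_def FactGroup_def RCOSETS_def)
  moreover have "carrier (differentials R S) = {I \<cdot>\<^bsub>T\<^esub> I}"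
    using assms unfolding trivial_group_def by (simp add: differentials_def FactGroup_def)
  ultimately have "(I \<cdot>\<^bsub>T\<^esub> I) #>\<^bsub>?A\<^esub> u = I \<cdot>\<^bsub>T\<^esub> I" by simp
  moreover have "u = \<zero>\<^bsub>T\<^esub> \<oplus>\<^bsub>T\<^esub> u" using u by simp
  then have "u \<in> (I \<cdot>\<^bsub>T\<^esub> I) #>\<^bsub>?A\<^esub> u" using II.zero_closed by (auto simp: r_coset_def)
  ultimately show "u \<in> I \<cdot>\<^bsub>T\<^esub> I" by simp
qed

lemma epimorphism_iff_diagonal_zero:
  "ring_epimorphism (S\<lparr>carrier := R\<rparr>) S (\<lambda>x. x) \<longleftrightarrow> I = {\<zero>\<^bsub>T\<^esub>}"
proof -
  have z: "tens x \<one> = tens \<one> x \<longleftrightarrow> delta x = \<zero>\<^bsub>T\<^esub>" if "x \<in> carrier S" for x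
    using that by (simp add: delta_def)
  have "I = {\<zero>\<^bsub>T\<^esub>}" if "\<forall>x \<in> carrier S. delta x = \<zero>\<^bsub>T\<^esub>"
  proof -
    \<comment> \<open>All of \<open>S\<close> serves as generating set, as every
      \<open>delta x\<close> is known to vanish.\<close>
    have "generate_ring S (R \<union> carrier S) = carrier S"
      using generate_ring_incl[of "R \<union> carrier S"] generate_ring.incl[of _ "R \<union> carrier S" S] R_carrier
      by blast
    then have "I \<subseteq> {\<zero>\<^bsub>T\<^esub>}" by (rule diagonal_ideal_subset[OF T.zeroideal]) (use that in auto)
    moreover have "\<zero>\<^bsub>T\<^esub> \<in> I" by (simp add: diagonal_iff)
    ultimately show ?thesis by blast
  qed
  then show ?thesis using delta_in_diagonal unfolding epimorphism_iff_tens by (auto simp: z)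
qed

section \<open>Radicial unramified extensions are epimorphisms\<close>

lemma R_one: "\<one> \<in> R" and R_zero: "\<zero> \<in> R"
  and R_minus: "r \<in> R \<Longrightarrow> \<ominus> r \<in> R"
  and R_mult: "r \<in> R \<Longrightarrow> r' \<in> R \<Longrightarrow> r \<otimes> r' \<in> R"
  and R_add: "r \<in> R \<Longrightarrow> r' \<in> R \<Longrightarrow> r \<oplus> r' \<in> R"
  using subringE[OF subring_R] by auto

lemma diff_in_prime_iff:
  assumes Q: "primeideal Q S" and a: "a \<in> carrier S" "b \<in> carrier S"
  shows "a \<ominus> b \<in> Q \<longleftrightarrow> residue_frac S Q a \<one> = residue_frac S Q b \<one>"
proof -
  interpret Q: primeideal Q S by (rule Q)
  have one: "\<one> \<in> carrier S - Q" using Q.I_notcarr Q.one_imp_carrier by auto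
  show ?thesis using a one by (simp add: Q.residue_frac_eq_iff)
qed

text \<open>The two maps from \<open>S\<close> to the domain \<open>T Quot q\<close> have the same
  kernel \<open>Q\<close>. Pure inseparability puts a \<open>p ^ n\<close>-th power of the class of
  \<open>a\<close> into the residue field of the base, where both maps agree, and injectivity of
  Frobenius descends this to \<open>a\<close>.\<close>

lemma delta_in_prime_if_radicial:
  assumes rad: "radicial R S" and q: "primeideal q T" and a: "a \<in> carrier S"
  shows "delta a \<in> q"
proof -
  interpret q: primeideal q T by (rule q)
  interpret l: ring_hom_ring S T "\<lambda>a. tens a \<one>"
    by (intro ring_hom_ringI2 ring_axioms T.ring_axioms tens_hom_left)
  interpret r: ring_hom_ring S T "\<lambda>a. tens \<one> a"
    by (intro ring_hom_ringI2 ring_axioms T.ring_axioms tens_hom_right)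
  define Q where "Q = {a \<in> carrier S. tens a \<one> \<in> q}"
  define Q' where "Q' = {a \<in> carrier S. tens \<one> a \<in> q}"
  have Q: "primeideal Q S" and Q': "primeideal Q' S"
    unfolding Q_def Q'_def by (rule l.primeideal_vimage r.primeideal_vimage, rule is_cring, rule q)+
  have "Q \<inter> R = Q' \<inter> R" by (auto simp: Q_def Q'_def tens_base)
  then have QQ': "Q = Q'"
    using rad Q Q' unfolding radicial_def i_extension_def inj_on_def by blast
  interpret Q: primeideal Q S by (rule Q)
  interpret PR: primeideal "Q \<inter> R" "S\<lparr>carrier := R\<rparr>"
    by (rule primeideal_contraction[OF is_cring subring_R Q])
  let ?k = "residue_field (S\<lparr>carrier := R\<rparr>) (Q \<inter> R)" and ?K = "residue_field S Q"
  interpret k: field ?k by (rule PR.field_residue_field)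
  interpret K: field ?K by (rule Q.field_residue_field)
  interpret \<rho>: ring_hom_ring S ?K "\<lambda>a. residue_frac S Q a \<one>"
    by (intro ring_hom_ringI2 Q.residue_frac_hom ring_axioms K.ring_axioms)
  interpret res: ring_hom_ring ?k ?K "residual_map R S Q"
    by (intro ring_hom_ringI2 residual_map_hom[OF is_cring subring_R Q] k.ring_axioms K.ring_axioms)
  interpret D: domain "T Quot q" by (rule q.quotient_is_domain)
  interpret c: ring_hom_ring T "T Quot q" "\<lambda>u. q +>\<^bsub>T\<^esub> u" by (rule q.rcos_ring_hom_ring)
  have c_eq_iff: "q +>\<^bsub>T\<^esub> u = q +>\<^bsub>T\<^esub> v \<longleftrightarrow> u \<ominus>\<^bsub>T\<^esub> v \<in> q" if "u \<in> carrier T" "v \<in> carrier T" for u v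
    using T.quotient_eq_iff_same_a_r_cos[OF q.ideal_axioms that] by simp
  have c_zero_iff: "q +>\<^bsub>T\<^esub> u = \<zero>\<^bsub>T Quot q\<^esub> \<longleftrightarrow> u \<in> q" if "u \<in> carrier T" for u
    using c_eq_iff[OF that T.zero_closed] that by (simp add: a_minus_def)
  define p where "p = char_exponent ?k"
  have "purely_inseparable ?k ?K (residual_map R S Q)"
    using rad Q unfolding radicial_def kappa_radicial_def by blast
  then obtain n where n: "residue_frac S Q a \<one> [^]\<^bsub>?K\<^esub> (p ^ n) \<in> residual_map R S Q ` carrier ?k"
    using a unfolding purely_inseparable_def p_def by (metis \<rho>.hom_closed)
  then obtain y where y: "y \<in> carrier ?k" "residue_frac S Q a \<one> [^]\<^bsub>?K\<^esub> (p ^ n) = residual_map R S Q y" by blast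
  obtain r s where rs: "r \<in> R" "s \<in> R - Q" "y = residue_frac (S\<lparr>carrier := R\<rparr>) (Q \<inter> R) r s"
    using y(1) by (rule PR.residue_frac_cases) auto
  define m where "m = p ^ n"
  have one: "\<one> \<in> carrier S - Q" using Q.I_notcarr Q.one_imp_carrier by auto
  have "residue_frac S Q (a [^] m) \<one> = residue_frac S Q r s"
    using y(2) rs a residual_map_frac[OF is_cring subring_R Q rs(1,2)]
    by (simp add: m_def \<rho>.hom_nat_pow)
  \<comment> \<open>With the denominator cleared, the inseparability relation is a congruence in
    \<open>S\<close> that either map can carry to \<open>T\<close>.\<close>
  then have mem: "a [^] m \<otimes> s \<ominus> r \<in> Q"
    using Q.residue_frac_eq_iff[of "a [^] m" \<one> r s] rs a one by simp
  have c_pow: "(q +>\<^bsub>T\<^esub> u) [^]\<^bsub>T Quot q\<^esub> m \<otimes>\<^bsub>T Quot q\<^esub> (q +>\<^bsub>T\<^esub> v) = q +>\<^bsub>T\<^esub> w"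
    if "u \<in> carrier T" "v \<in> carrier T" "w \<in> carrier T" "u [^]\<^bsub>T\<^esub> m \<otimes>\<^bsub>T\<^esub> v \<ominus>\<^bsub>T\<^esub> w \<in> q" for u v w
  proof -
    have "q +>\<^bsub>T\<^esub> (u [^]\<^bsub>T\<^esub> m \<otimes>\<^bsub>T\<^esub> v) = q +>\<^bsub>T\<^esub> w"
      using c_eq_iff[of "u [^]\<^bsub>T\<^esub> m \<otimes>\<^bsub>T\<^esub> v" w] that T.m_closed T.nat_pow_closed by blast
    then show ?thesis using that c.hom_mult[of "u [^]\<^bsub>T\<^esub> m" v] c.hom_nat_pow[of u m] T.nat_pow_closed[of u m]
      by (simp only:)
  qed
  have "(q +>\<^bsub>T\<^esub> tens a \<one>) [^]\<^bsub>T Quot q\<^esub> m \<otimes>\<^bsub>T Quot q\<^esub> (q +>\<^bsub>T\<^esub> tens s \<one>) = q +>\<^bsub>T\<^esub> tens r \<one>"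
  proof -
    have "tens (a [^] m \<otimes> s \<ominus> r) \<one> \<in> q" using mem unfolding Q_def by blast
    then have "tens a \<one> [^]\<^bsub>T\<^esub> m \<otimes>\<^bsub>T\<^esub> tens s \<one> \<ominus>\<^bsub>T\<^esub> tens r \<one> \<in> q"
      using a rs by (simp add: a_minus_def l.hom_nat_pow)
    then show ?thesis using a rs by (intro c_pow) auto
  qed
  moreover have "(q +>\<^bsub>T\<^esub> tens \<one> a) [^]\<^bsub>T Quot q\<^esub> m \<otimes>\<^bsub>T Quot q\<^esub> (q +>\<^bsub>T\<^esub> tens \<one> s) = q +>\<^bsub>T\<^esub> tens \<one> r"
  proof -
    \<comment> \<open>The right-hand transport requires the congruence modulo \<open>Q'\<close>, so
      injectivity on spectra enters here.\<close>
    have "tens \<one> (a [^] m \<otimes> s \<ominus> r) \<in> q" using mem unfolding QQ' Q'_def by blast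
    then have "tens \<one> a [^]\<^bsub>T\<^esub> m \<otimes>\<^bsub>T\<^esub> tens \<one> s \<ominus>\<^bsub>T\<^esub> tens \<one> r \<in> q"
      using a rs by (simp add: a_minus_def r.hom_nat_pow)
    then show ?thesis using a rs by (intro c_pow) auto
  qed
  \<comment> \<open>As \<open>s\<close> lies in \<open>R\<close>, the factors
    \<open>tens s \<one>\<close> and \<open>tens \<one> s\<close> coincide; as \<open>s\<close> lies
    outside \<open>Q\<close>, this common factor can be cancelled.\<close>
  moreover have "tens s \<one> \<notin> q" using rs(1,2) R_closed unfolding Q_def by blast
  then have "q +>\<^bsub>T\<^esub> tens s \<one> \<noteq> \<zero>\<^bsub>T Quot q\<^esub>" using c_zero_iff[OF tens_closed[OF _ one_closed]] rs(1,2) R_closed by blast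
  ultimately have pow: "(q +>\<^bsub>T\<^esub> tens a \<one>) [^]\<^bsub>T Quot q\<^esub> m = (q +>\<^bsub>T\<^esub> tens \<one> a) [^]\<^bsub>T Quot q\<^esub> m"
    using D.m_rcancel[OF _ c.hom_closed D.nat_pow_closed[OF c.hom_closed] D.nat_pow_closed[OF c.hom_closed]]
      a rs(1,2) tens_base R_closed tens_closed one_closed by (metis Diff_iff)
  have "q +>\<^bsub>T\<^esub> tens a \<one> = q +>\<^bsub>T\<^esub> tens \<one> a"
  proof (cases "group.ord (add_monoid ?k) \<one>\<^bsub>?k\<^esub> = 0")
    case True
    \<comment> \<open>In characteristic zero the exponent is \<open>1\<close>, so the powers are the
      elements themselves.\<close>
    then have "m = 1" by (simp add: m_def p_def char_exponent_def)
    then show ?thesis using pow a by simp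
  next
    case False
    then have p: "group.ord (add_monoid ?k) \<one>\<^bsub>?k\<^esub> = p" "p \<noteq> 0"
      by (auto simp: p_def char_exponent_def Let_def)
    \<comment> \<open>The characteristic travels from \<open>?k\<close> to \<open>?K\<close>, then
      as a membership in \<open>Q\<close> to \<open>q\<close>, and so to
      \<open>T Quot q\<close>.\<close>
    have "add_pow ?K p \<one>\<^bsub>?K\<^esub> = \<zero>\<^bsub>?K\<^esub>"
      using res.hom_add_pow[OF k.one_closed, of p] k.prime_ord_one(2)[OF p] by simp
    then have "residue_frac S Q (add_pow S p \<one>) \<one> = \<zero>\<^bsub>?K\<^esub>"
      using \<rho>.hom_add_pow[OF one_closed, of p] by simp
    then have "add_pow S p \<one> \<in> Q" by (simp add: Q.residue_frac_eq_zero_iff)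
    then have "tens (add_pow S p \<one>) \<one> \<in> q" unfolding Q_def by blast
    then have "add_pow T p \<one>\<^bsub>T\<^esub> \<in> q" using l.hom_add_pow[OF one_closed, of p] by (simp only: tens_one)
    then have "add_pow (T Quot q) p \<one>\<^bsub>T Quot q\<^esub> = \<zero>\<^bsub>T Quot q\<^esub>"
      using c.hom_add_pow[OF T.one_closed, of p] c_zero_iff[of "add_pow T p \<one>\<^bsub>T\<^esub>"] by simp
    from D.pow_char_exponent_inj[OF k.prime_ord_one(1)[OF p] this c.hom_closed c.hom_closed pow[unfolded m_def]]
    show ?thesis using a by simp
  qed
  then show ?thesis
    unfolding delta_def using a c_eq_iff[of "tens a \<one>" "tens \<one> a"] tens_closed one_closed by blast
qed

lemma epimorphism_if_radicial_unramified:
  assumes rad: "radicial R S" and unram: "unramified R S"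
  shows "ring_epimorphism (S\<lparr>carrier := R\<rparr>) S (\<lambda>x. x)"
proof -
  obtain A where A: "finite A" "A \<subseteq> carrier S" "generate_ring S (R \<union> A) = carrier S"
    using unram unfolding unramified_def finite_type_def by blast
  have dA: "delta ` A \<subseteq> carrier T" using A by auto
  interpret I: ideal I T by (rule ideal_diagonal)
  have "I = Idl\<^bsub>T\<^esub> (delta ` A)"
  proof
    show "I \<subseteq> Idl\<^bsub>T\<^esub> (delta ` A)"
      by (rule diagonal_ideal_subset[OF T.genideal_ideal[OF dA] A(3) T.genideal_self[OF dA]])
    show "Idl\<^bsub>T\<^esub> (delta ` A) \<subseteq> I"
      by (rule T.genideal_minimal[OF ideal_diagonal]) (use A delta_in_diagonal in auto)
  qed
  moreover have "I \<subseteq> I \<cdot>\<^bsub>T\<^esub> I"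
    using unram diagonal_idempotent_if_trivial_differentials by (simp add: unramified_def)
  moreover have "\<one>\<^bsub>T\<^esub> \<ominus>\<^bsub>T\<^esub> u \<in> Units T" if u: "u \<in> I" for u
  proof (rule T.one_minus_unit_if_in_maximalideals)
    fix q assume "maximalideal q T"
    then have q: "primeideal q T" by (rule T.maximalideal_prime)
    then have "I \<subseteq> q"
      by (intro diagonal_ideal_subset[OF primeideal.axioms(1) A(3)])
         (use A delta_in_prime_if_radicial[OF rad q] in auto)
    with u show "u \<in> q" by blast
  qed (use u in simp)
  ultimately have "I = {\<zero>\<^bsub>T\<^esub>}" using A(1) dA by (intro T.nakayama_idempotent_ideal) auto
  then show ?thesis by (simp add: epimorphism_iff_diagonal_zero)
qed

section \<open>Epimorphisms are radicial\<close>

text \<open>Applied below with \<open>\<beta> a b\<close> the value of a linear form at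
  \<open>a\<close> times the image of \<open>b\<close>. The conclusion then says that the value at
  \<open>x\<close> is the value at \<open>\<one>\<close> times the image of
  \<open>x\<close>.\<close>

lemma epimorphism_imp_balanced_eq:
  fixes \<beta> :: "'a \<Rightarrow> 'a \<Rightarrow> 'c" and G :: "('c, 'd) ring_scheme"
  assumes epi: "ring_epimorphism (S\<lparr>carrier := R\<rparr>) S (\<lambda>x. x)"
    and G: "abelian_group G"
    and closed: "\<And>a b. a \<in> carrier S \<Longrightarrow> b \<in> carrier S \<Longrightarrow> \<beta> a b \<in> carrier G"
    and left: "\<And>a a' b. \<lbrakk>a \<in> carrier S; a' \<in> carrier S; b \<in> carrier S\<rbrakk> \<Longrightarrow>
        \<beta> (a \<oplus> a') b = \<beta> a b \<oplus>\<^bsub>G\<^esub> \<beta> a' b"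
    and right: "\<And>a b b'. \<lbrakk>a \<in> carrier S; b \<in> carrier S; b' \<in> carrier S\<rbrakk> \<Longrightarrow>
        \<beta> a (b \<oplus> b') = \<beta> a b \<oplus>\<^bsub>G\<^esub> \<beta> a b'"
    and bal: "\<And>r a b. \<lbrakk>r \<in> R; a \<in> carrier S; b \<in> carrier S\<rbrakk> \<Longrightarrow> \<beta> (r \<otimes> a) b = \<beta> a (r \<otimes> b)"
    and x: "x \<in> carrier S"
  shows "\<beta> x \<one> = \<beta> \<one> x"
  using epi x unfolding epimorphism_iff_tens
  by (intro tens_eq_imp_balanced_eq[OF G closed left right bal]) auto

section \<open>Submodules of \<open>S\<close> over \<open>R\<close>\<close>

text \<open>The \<open>R\<close>-submodules of \<open>S\<close>, kept as plain sets so that Zorn's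
  lemma applies to inclusion. Negatives come from scaling by \<open>\<ominus> \<one>\<close>, which
  lies in \<open>R\<close>.\<close>

definition submod where
  "submod W \<longleftrightarrow> W \<subseteq> carrier S \<and> \<zero> \<in> W \<and> (\<forall>u \<in> W. \<forall>v \<in> W. u \<oplus> v \<in> W) \<and> (\<forall>r \<in> R. \<forall>u \<in> W. r \<otimes> u \<in> W)"

lemma submodD:
  assumes "submod W"
  shows "u \<in> W \<Longrightarrow> u \<in> carrier S" "\<zero> \<in> W" "u \<in> W \<Longrightarrow> v \<in> W \<Longrightarrow> u \<oplus> v \<in> W"
    "r \<in> R \<Longrightarrow> u \<in> W \<Longrightarrow> r \<otimes> u \<in> W"
  using assms unfolding submod_def by auto

lemma submod_minus:
  assumes W: "submod W" and u: "u \<in> W"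
  shows "\<ominus> u \<in> W"
  using submodD(4)[OF W R_minus[OF R_one] u] submodD(1)[OF W u] by (simp add: l_minus)

lemma submod_diff: "submod W \<Longrightarrow> u \<in> W \<Longrightarrow> v \<in> W \<Longrightarrow> u \<ominus> v \<in> W"
  unfolding a_minus_def by (intro submodD(3) submod_minus)

lemma submod_R: "submod R"
  unfolding submod_def using R_carrier R_zero R_add R_mult by blast

text \<open>The submodule \<open>C x + W\<close>. With \<open>C = R\<close> it adjoins
  \<open>x\<close> to \<open>W\<close>; with \<open>C\<close> a maximal ideal of \<open>R\<close> it
  will be the kernel of a linear form.\<close>

definition extend where
  "extend C x W = {c \<otimes> x \<oplus> w | c w. c \<in> C \<and> w \<in> W}"

lemma extendI: "c \<in> C \<Longrightarrow> w \<in> W \<Longrightarrow> c \<otimes> x \<oplus> w \<in> extend C x W"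
  unfolding extend_def by blast

lemma extendE:
  assumes "u \<in> extend C x W"
  obtains c w where "c \<in> C" "w \<in> W" "u = c \<otimes> x \<oplus> w"
  using assms unfolding extend_def by blast

lemma submod_extend:
  assumes C: "submod C" and W: "submod W" and x: "x \<in> carrier S"
  shows "submod (extend C x W)"
  unfolding submod_def
proof (intro conjI ballI subsetI)
  note C' = submodD[OF C] and W' = submodD[OF W]
  show "\<zero> \<in> extend C x W" using extendI[OF C'(2) W'(2), of x] x by simp
  fix u assume "u \<in> extend C x W"
  then obtain c w where u: "c \<in> C" "w \<in> W" "u = c \<otimes> x \<oplus> w" by (rule extendE)
  have cw: "c \<in> carrier S" "w \<in> carrier S" using u C' W' by auto
  show "u \<in> carrier S" using u cw x by simp
  {
    fix v assume "v \<in> extend C x W"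
    then obtain c' w' where v: "c' \<in> C" "w' \<in> W" "v = c' \<otimes> x \<oplus> w'" by (rule extendE)
    have cw': "c' \<in> carrier S" "w' \<in> carrier S" using v C' W' by auto
    have "u \<oplus> v = (c \<oplus> c') \<otimes> x \<oplus> (w \<oplus> w')" using u(3) v(3) cw cw' x by (simp add: l_distr a_ac)
    then show "u \<oplus> v \<in> extend C x W" using extendI[OF C'(3)[OF u(1) v(1)] W'(3)[OF u(2) v(2)]] by simp
  }
  fix r assume r: "r \<in> R"
  have "r \<otimes> u = (r \<otimes> c) \<otimes> x \<oplus> r \<otimes> w" using u(3) cw x r by (simp add: r_distr m_assoc)
  then show "r \<otimes> u \<in> extend C x W" using extendI[OF C'(4)[OF r u(1)] W'(4)[OF r u(2)]] by simp
qed

lemma subset_extend: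
  assumes C: "submod C" and W: "submod W" and x: "x \<in> carrier S"
  shows "W \<subseteq> extend C x W"
proof
  fix w assume w: "w \<in> W"
  then show "w \<in> extend C x W"
    using extendI[OF submodD(2)[OF C] w, of x] submodD(1)[OF W w] x by simp
qed

lemma self_in_extend:
  assumes W: "submod W" and x: "x \<in> carrier S"
  shows "x \<in> extend R x W"
  using extendI[OF R_one submodD(2)[OF W], of x] x by simp

lemma submod_ideal: "ideal J S \<Longrightarrow> submod J"
  unfolding submod_def
  by (auto intro: ideal.I_l_closed ideal.Icarr additive_subgroup.a_closed additive_subgroup.zero_closed ideal.axioms(1))

text \<open>Modulo \<open>Q\<close> and after inverting \<open>R - Q\<close>, a maximal submodule that avoids \<open>R - Q\<close> is the kernel of
  a linear form \<open>\<phi>\<close> with \<open>\<phi>(1) = 1\<close>, namely \<open>\<phi>(a) = t / s\<close> if \<open>s a - t \<in> W\<close>.\<close>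

lemma exists_hyperplane:
  assumes Q: "primeideal Q S" and W0: "submod W0" "Q \<subseteq> W0" "W0 \<inter> R \<subseteq> Q"
  obtains W where "submod W" "W0 \<subseteq> W" "W \<inter> R \<subseteq> Q"
    "\<And>a. a \<in> carrier S \<Longrightarrow> \<exists>s \<in> R - Q. \<exists>t \<in> R. s \<otimes> a \<ominus> t \<in> W"
proof -
  interpret Q: primeideal Q S by (rule Q)
  define F where "F = {W. submod W \<and> W0 \<subseteq> W \<and> W \<inter> R \<subseteq> Q}"
  have "\<exists>M\<in>F. \<forall>Y\<in>F. M \<subseteq> Y \<longrightarrow> Y = M"
  proof (rule subset_Zorn_nonempty)
    show "F \<noteq> {}" using W0 by (auto simp: F_def)
    fix \<C> assume C: "\<C> \<noteq> {}" "subset.chain F \<C>"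
    then have mem: "\<And>V. V \<in> \<C> \<Longrightarrow> submod V \<and> W0 \<subseteq> V \<and> V \<inter> R \<subseteq> Q"
      by (auto simp: subset.chain_def F_def)
    have lin: "\<And>U V. U \<in> \<C> \<Longrightarrow> V \<in> \<C> \<Longrightarrow> U \<subseteq> V \<or> V \<subseteq> U"
      using C(2) unfolding subset.chain_def by blast
    have "submod (\<Union>\<C>)"
      unfolding submod_def
    proof (intro conjI ballI subsetI)
      show "u \<in> carrier S" if "u \<in> \<Union>\<C>" for u using that mem submodD(1) by blast
      show "\<zero> \<in> \<Union>\<C>" using C(1) mem submodD(2) by blast
      show "u \<oplus> v \<in> \<Union>\<C>" if "u \<in> \<Union>\<C>" "v \<in> \<Union>\<C>" for u v
      proof -
        from that obtain U V where UV: "U \<in> \<C>" "V \<in> \<C>" "u \<in> U" "v \<in> V" by blast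
        with lin[of U V] obtain X' where "X' \<in> \<C>" "u \<in> X'" "v \<in> X'" by blast
        with mem submodD(3) show ?thesis by blast
      qed
      show "r \<otimes> u \<in> \<Union>\<C>" if "r \<in> R" "u \<in> \<Union>\<C>" for r u using that mem submodD(4) by blast
    qed
    moreover have "W0 \<subseteq> \<Union>\<C>" "\<Union>\<C> \<inter> R \<subseteq> Q" using mem C(1) by blast+
    ultimately show "\<Union>\<C> \<in> F" by (simp add: F_def)
  qed
  then obtain W where WF: "W \<in> F" and max: "\<And>Y. Y \<in> F \<Longrightarrow> W \<subseteq> Y \<Longrightarrow> Y = W" by blast
  from WF have W: "submod W" "W0 \<subseteq> W" "W \<inter> R \<subseteq> Q" by (auto simp: F_def)
  note W' = submodD[OF W(1)]
  have "\<exists>s \<in> R - Q. \<exists>t \<in> R. s \<otimes> a \<ominus> t \<in> W" if a: "a \<in> carrier S" for a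
  proof (cases "a \<in> W")
    case True
    have "\<one> \<in> R - Q" using R_one Q.I_notcarr Q.one_imp_carrier by blast
    moreover have "\<one> \<otimes> a \<ominus> \<zero> \<in> W" using True a by (simp add: a_minus_def)
    ultimately show ?thesis using R_zero by blast
  next
    case False
    have "extend R a W \<noteq> W" using self_in_extend[OF W(1) a] False by blast
    \<comment> \<open>By maximality, adjoining \<open>a\<close> must produce an element
      \<open>t\<close> of \<open>R\<close> outside \<open>Q\<close>; its expression
      \<open>s \<otimes> a \<oplus> w\<close> provides \<open>s\<close>.\<close>
    then have "extend R a W \<notin> F" using max subset_extend[OF submod_R W(1) a] by blast
    then have "\<not> extend R a W \<inter> R \<subseteq> Q"
      using submod_extend[OF submod_R W(1) a] subset_extend[OF submod_R W(1) a] W(2) unfolding F_def by blast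
    then obtain t where t: "t \<in> extend R a W" "t \<in> R" "t \<notin> Q" by blast
    from t(1) obtain s w where sw: "s \<in> R" "w \<in> W" "t = s \<otimes> a \<oplus> w" by (rule extendE)
    have wc: "w \<in> carrier S" using W'(1) sw by blast
    have "s \<notin> Q"
    proof
      assume "s \<in> Q"
      then have "s \<otimes> a \<in> W" using Q.I_r_closed[OF _ a] W0(2) W(2) by blast
      then have "t \<in> W" using W'(3) sw by simp
      with t W(3) show False by blast
    qed
    moreover have "s \<otimes> a \<ominus> t = \<ominus> w"
      unfolding sw(3) using sw(1) wc a by (simp add: a_minus_def minus_add r_neg2)
    ultimately show ?thesis using sw(1) t(2) submod_minus[OF W(1) sw(2)] by (metis DiffI)
  qed
  with W show ?thesis using that by blast
qed

section \<open>Residual extensions of an epimorphism\<close>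

text \<open>With denominators cleared, this places the residue class of \<open>x\<close> in the
  image of the residue field at \<open>Q \<inter> R\<close>. Otherwise \<open>R x + Q\<close> meets
  \<open>R\<close> only inside \<open>Q\<close>, and a hyperplane above it gives a form
  \<open>\<phi>\<close> into \<open>?K\<close> with \<open>\<phi> \<one> = 1\<close> and
  \<open>\<phi> x = 0\<close>.\<close>

lemma epimorphism_residually_surjective:
  assumes epi: "ring_epimorphism (S\<lparr>carrier := R\<rparr>) S (\<lambda>x. x)" and Q: "primeideal Q S" and x: "x \<in> carrier S"
  shows "\<exists>s \<in> R - Q. \<exists>r \<in> R. s \<otimes> x \<ominus> r \<in> Q"
proof (rule ccontr)
  assume neg: "\<not> ?thesis"
  interpret Q: primeideal Q S by (rule Q)
  have QS: "submod Q" by (rule submod_ideal[OF Q.ideal_axioms])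
  let ?W0 = "extend R x Q"
  have "?W0 \<inter> R \<subseteq> Q"
  proof clarify
    fix t assume t: "t \<in> ?W0" "t \<in> R"
    from t(1) obtain s w where sw: "s \<in> R" "w \<in> Q" "t = s \<otimes> x \<oplus> w" by (rule extendE)
    have wc: "w \<in> carrier S" using sw by simp
    have "s \<otimes> x \<ominus> t = \<ominus> w"
      unfolding sw(3) using sw(1) wc x by (simp add: a_minus_def minus_add r_neg2)
    then have "s \<in> Q" using neg t(2) sw(1) submod_minus[OF QS sw(2)] by (metis DiffI)
    then show "t \<in> Q" using sw Q.I_r_closed[OF _ x] by simp
  qed
  then obtain W where W: "submod W" "?W0 \<subseteq> W" "W \<inter> R \<subseteq> Q"
    and hyp: "\<And>a. a \<in> carrier S \<Longrightarrow> \<exists>s \<in> R - Q. \<exists>t \<in> R. s \<otimes> a \<ominus> t \<in> W"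
    using exists_hyperplane[OF Q submod_extend[OF submod_R QS x] subset_extend[OF submod_R QS x]] by blast
  note W' = submodD[OF W(1)]
  have one: "\<one> \<in> R - Q" using R_one Q.I_notcarr Q.one_imp_carrier by blast
  define rel where "rel a s t \<longleftrightarrow> s \<in> R - Q \<and> t \<in> R \<and> s \<otimes> a \<ominus> t \<in> W" for a s t
  let ?K = "residue_field S Q"
  interpret K: field ?K by (rule Q.field_residue_field)
  define \<rho> where "\<rho> a = residue_frac S Q a \<one>" for a
  interpret \<rho>: ring_hom_ring S ?K \<rho>
    unfolding \<rho>_def by (intro ring_hom_ringI2 Q.residue_frac_hom ring_axioms K.ring_axioms)
  have \<rho>_zero: "\<rho> a = \<zero>\<^bsub>?K\<^esub> \<longleftrightarrow> a \<in> Q" if "a \<in> carrier S" for a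
    unfolding \<rho>_def using that by (rule Q.residue_frac_eq_zero_iff)
  \<comment> \<open>Two descriptions of \<open>a\<close> modulo \<open>W\<close> are combined so
    that \<open>a\<close> cancels; the remainder lies in \<open>W \<inter> R\<close>, hence in
    \<open>Q\<close>.\<close>
  have uniq: "\<rho> t \<otimes>\<^bsub>?K\<^esub> \<rho> s' = \<rho> t' \<otimes>\<^bsub>?K\<^esub> \<rho> s" if "rel a s t" "rel a s' t'" "a \<in> carrier S" for a s t s' t'
  proof -
    have c: "s \<in> R" "t \<in> R" "s' \<in> R" "t' \<in> R" using that by (auto simp: rel_def)
    have "s \<otimes> (s' \<otimes> a \<ominus> t') \<ominus> s' \<otimes> (s \<otimes> a \<ominus> t) \<in> W"
      by (rule submod_diff[OF W(1) W'(4) W'(4)]) (use that in \<open>auto simp: rel_def\<close>)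
    moreover have "s \<otimes> (s' \<otimes> a \<ominus> t') \<ominus> s' \<otimes> (s \<otimes> a \<ominus> t) = t \<otimes> s' \<ominus> t' \<otimes> s"
    proof -
      have "s \<otimes> (s' \<otimes> a \<ominus> t') \<ominus> s' \<otimes> (s \<otimes> a \<ominus> t) =
        (s' \<otimes> (s \<otimes> a) \<oplus> \<ominus> (t' \<otimes> s)) \<oplus> (\<ominus> (s' \<otimes> (s \<otimes> a)) \<oplus> t \<otimes> s')"
        using c that(3) by (simp add: a_minus_def r_distr r_minus minus_add m_ac)
      also have "\<dots> = t \<otimes> s' \<oplus> \<ominus> (t' \<otimes> s)"
        using c that(3) by (simp add: a_ac r_neg r_neg1 r_neg2)
      finally show ?thesis by (simp add: a_minus_def)
    qed
    moreover have "t \<otimes> s' \<ominus> t' \<otimes> s \<in> R"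
      unfolding a_minus_def using c by (intro R_add R_mult R_minus) auto
    ultimately have "t \<otimes> s' \<ominus> t' \<otimes> s \<in> Q" using W(3) by auto
    then have "\<rho> (t \<otimes> s') = \<rho> (t' \<otimes> s)" using diff_in_prime_iff[OF Q] c by (simp add: \<rho>_def)
    then show ?thesis using c by simp
  qed
  \<comment> \<open>The value is the fraction \<open>t / s\<close> in \<open>?K\<close>, where
    \<open>s\<close> is invertible because it lies outside \<open>Q\<close>.\<close>
  define \<phi> where "\<phi> a = (SOME v. v \<in> carrier ?K \<and> (\<exists>s t. rel a s t \<and> v \<otimes>\<^bsub>?K\<^esub> \<rho> s = \<rho> t))" for a
  have cancel: "u = v" if "u \<otimes>\<^bsub>?K\<^esub> \<rho> s = v \<otimes>\<^bsub>?K\<^esub> \<rho> s" "u \<in> carrier ?K" "v \<in> carrier ?K" "s \<in> R - Q" for u v s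
  proof -
    have "\<rho> s \<noteq> \<zero>\<^bsub>?K\<^esub>" using \<rho>_zero[of s] that(4) R_closed by blast
    then show ?thesis using that K.m_rcancel[of "\<rho> s" u v] by auto
  qed
  have \<phi>_ex: "\<phi> a \<in> carrier ?K \<and> (\<exists>s t. rel a s t \<and> \<phi> a \<otimes>\<^bsub>?K\<^esub> \<rho> s = \<rho> t)" if a: "a \<in> carrier S" for a
  proof -
    obtain s t where st: "rel a s t" using hyp[OF a] by (auto simp: rel_def)
    then have c: "s \<in> R" "t \<in> R" "s \<notin> Q" by (auto simp: rel_def)
    have nz: "\<rho> s \<noteq> \<zero>\<^bsub>?K\<^esub>" using \<rho>_zero[of s] c by simp
    then have u: "\<rho> s \<in> Units ?K" using c K.field_Units by simp
    let ?v = "\<rho> t \<otimes>\<^bsub>?K\<^esub> inv\<^bsub>?K\<^esub> \<rho> s"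
    have "?v \<in> carrier ?K" "?v \<otimes>\<^bsub>?K\<^esub> \<rho> s = \<rho> t"
      using c u by (simp_all add: K.m_assoc)
    then have "?v \<in> carrier ?K \<and> (\<exists>s t. rel a s t \<and> ?v \<otimes>\<^bsub>?K\<^esub> \<rho> s = \<rho> t)" using st by blast
    then show ?thesis unfolding \<phi>_def by (rule someI)
  qed
  have \<phi>_closed: "\<phi> a \<in> carrier ?K" if "a \<in> carrier S" for a using \<phi>_ex[OF that] by blast
  have \<phi>_rel: "\<phi> a \<otimes>\<^bsub>?K\<^esub> \<rho> s = \<rho> t" if a: "a \<in> carrier S" and st: "rel a s t" for a s t
  proof -
    obtain s' t' where s't': "rel a s' t'" "\<phi> a \<otimes>\<^bsub>?K\<^esub> \<rho> s' = \<rho> t'" using \<phi>_ex[OF a] by blast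
    have c: "s \<in> carrier S" "t \<in> carrier S" "s' \<in> carrier S" "t' \<in> carrier S" "s' \<in> R - Q"
      using st s't'(1) by (auto simp: rel_def)
    have "(\<phi> a \<otimes>\<^bsub>?K\<^esub> \<rho> s) \<otimes>\<^bsub>?K\<^esub> \<rho> s' = (\<phi> a \<otimes>\<^bsub>?K\<^esub> \<rho> s') \<otimes>\<^bsub>?K\<^esub> \<rho> s"
      using \<phi>_closed[OF a] c by (simp add: K.m_ac)
    also have "\<dots> = \<rho> t \<otimes>\<^bsub>?K\<^esub> \<rho> s'" unfolding s't'(2) using uniq[OF st s't'(1) a] by simp
    finally show ?thesis by (rule cancel) (use \<phi>_closed[OF a] c in auto)
  qed
  have R_Q_mult: "s \<otimes> s' \<in> R - Q" if "s \<in> R - Q" "s' \<in> R - Q" for s s'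
    using that R_mult[of s s'] Q.I_prime[of s s'] R_closed by blast
  have \<phi>_add: "\<phi> (a \<oplus> a') = \<phi> a \<oplus>\<^bsub>?K\<^esub> \<phi> a'" if a: "a \<in> carrier S" "a' \<in> carrier S" for a a'
  proof -
    obtain s t s' t' where st: "rel a s t" and st': "rel a' s' t'"
      using \<phi>_ex a by meson
    have c: "s \<in> R" "t \<in> R" "s' \<in> R" "t' \<in> R" "s \<in> R - Q" "s' \<in> R - Q"
      using st st' by (auto simp: rel_def)
    have "s' \<otimes> (s \<otimes> a \<ominus> t) \<oplus> s \<otimes> (s' \<otimes> a' \<ominus> t') \<in> W"
      by (rule W'(3)[OF W'(4) W'(4)]) (use st st' in \<open>auto simp: rel_def\<close>)
    moreover have "s' \<otimes> (s \<otimes> a \<ominus> t) \<oplus> s \<otimes> (s' \<otimes> a' \<ominus> t') = (s \<otimes> s') \<otimes> (a \<oplus> a') \<ominus> (t \<otimes> s' \<oplus> t' \<otimes> s)"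
      using c a by (simp add: a_minus_def r_distr r_minus minus_add m_ac a_ac)
    ultimately have "rel (a \<oplus> a') (s \<otimes> s') (t \<otimes> s' \<oplus> t' \<otimes> s)"
      using R_Q_mult[OF c(5,6)] c R_add R_mult by (simp add: rel_def)
    from \<phi>_rel[OF _ this] have "\<phi> (a \<oplus> a') \<otimes>\<^bsub>?K\<^esub> \<rho> (s \<otimes> s') = \<rho> t \<otimes>\<^bsub>?K\<^esub> \<rho> s' \<oplus>\<^bsub>?K\<^esub> \<rho> t' \<otimes>\<^bsub>?K\<^esub> \<rho> s"
      using a c by simp
    also have "\<dots> = (\<phi> a \<oplus>\<^bsub>?K\<^esub> \<phi> a') \<otimes>\<^bsub>?K\<^esub> \<rho> (s \<otimes> s')"
      unfolding \<phi>_rel[OF a(1) st, symmetric] \<phi>_rel[OF a(2) st', symmetric]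
      using \<phi>_closed a c by (simp add: K.l_distr K.r_distr K.m_ac)
    finally show ?thesis by (rule cancel) (use \<phi>_closed a R_Q_mult[OF c(5,6)] in auto)
  qed
  have \<phi>_scale: "\<phi> (r \<otimes> a) = \<rho> r \<otimes>\<^bsub>?K\<^esub> \<phi> a" if r: "r \<in> R" and a: "a \<in> carrier S" for r a
  proof -
    obtain s t where st: "rel a s t" using \<phi>_ex a by meson
    have c: "s \<in> R" "t \<in> R" "s \<in> R - Q" using st by (auto simp: rel_def)
    have "r \<otimes> (s \<otimes> a \<ominus> t) \<in> W" by (rule W'(4)) (use st r in \<open>auto simp: rel_def\<close>)
    moreover have "r \<otimes> (s \<otimes> a \<ominus> t) = s \<otimes> (r \<otimes> a) \<ominus> r \<otimes> t"
      using c a r by (simp add: a_minus_def r_distr r_minus m_ac)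
    ultimately have "rel (r \<otimes> a) s (r \<otimes> t)" using c r R_mult by (simp add: rel_def)
    from \<phi>_rel[OF _ this] have "\<phi> (r \<otimes> a) \<otimes>\<^bsub>?K\<^esub> \<rho> s = \<rho> r \<otimes>\<^bsub>?K\<^esub> \<rho> t" using a c r by simp
    also have "\<dots> = (\<rho> r \<otimes>\<^bsub>?K\<^esub> \<phi> a) \<otimes>\<^bsub>?K\<^esub> \<rho> s"
      unfolding \<phi>_rel[OF a st, symmetric] using \<phi>_closed a c r by (simp add: K.m_ac)
    finally show ?thesis by (rule cancel) (use \<phi>_closed a c r in auto)
  qed
  \<comment> \<open>The left side is \<open>\<phi> x\<close>, which is zero; the right side will be
    \<open>\<rho> x\<close>.\<close>
  have "\<phi> x \<otimes>\<^bsub>?K\<^esub> \<rho> \<one> = \<phi> \<one> \<otimes>\<^bsub>?K\<^esub> \<rho> x"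
  proof (rule epimorphism_imp_balanced_eq[OF epi K.abelian_group_axioms, where \<beta> = "\<lambda>a b. \<phi> a \<otimes>\<^bsub>?K\<^esub> \<rho> b"])
    show "\<phi> (r \<otimes> a) \<otimes>\<^bsub>?K\<^esub> \<rho> b = \<phi> a \<otimes>\<^bsub>?K\<^esub> \<rho> (r \<otimes> b)" if "r \<in> R" "a \<in> carrier S" "b \<in> carrier S" for r a b
      using that \<phi>_closed by (simp add: \<phi>_scale K.m_ac)
  qed (use x \<phi>_closed in \<open>auto simp: \<phi>_add K.l_distr K.r_distr\<close>)
  moreover have "rel x \<one> \<zero>"
    using one R_zero x self_in_extend[OF QS x] W(2) by (auto simp: rel_def a_minus_def)
  from \<phi>_rel[OF x this] have "\<phi> x = \<zero>\<^bsub>?K\<^esub>" using \<phi>_closed x by simp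
  moreover have "rel \<one> \<one> \<one>" using one W'(2) by (auto simp: rel_def a_minus_def r_neg)
  from \<phi>_rel[OF _ this] have "\<phi> \<one> = \<one>\<^bsub>?K\<^esub>" using \<phi>_closed by simp
  ultimately have "\<rho> x = \<zero>\<^bsub>?K\<^esub>" using x by simp
  then have "x \<in> Q" using \<rho>_zero x by blast
  \<comment> \<open>The witnesses \<open>s = \<one>\<close> and \<open>r = \<zero>\<close>
    contradict \<open>neg\<close>.\<close>
  then have "\<one> \<otimes> x \<ominus> \<zero> \<in> Q" using x by (simp add: a_minus_def)
  then show False using neg one R_zero by blast
qed

text \<open>From \<open>s a = r\<close> and \<open>s' b = r'\<close> modulo \<open>Q\<close>, the
  fraction \<open>a / b\<close> equals \<open>r s' / (s r')\<close>, which is defined over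
  \<open>R\<close>.\<close>

lemma residual_map_surjective:
  assumes epi: "ring_epimorphism (S\<lparr>carrier := R\<rparr>) S (\<lambda>x. x)" and Q: "primeideal Q S"
  shows "residual_map R S Q ` carrier (residue_field (S\<lparr>carrier := R\<rparr>) (Q \<inter> R)) = carrier (residue_field S Q)"
proof
  interpret Q: primeideal Q S by (rule Q)
  interpret PR: primeideal "Q \<inter> R" "S\<lparr>carrier := R\<rparr>"
    by (rule primeideal_contraction[OF is_cring subring_R Q])
  let ?k = "residue_field (S\<lparr>carrier := R\<rparr>) (Q \<inter> R)" and ?K = "residue_field S Q"
  interpret K: field ?K by (rule Q.field_residue_field)
  interpret \<rho>: ring_hom_ring S ?K "\<lambda>a. residue_frac S Q a \<one>"
    by (intro ring_hom_ringI2 Q.residue_frac_hom ring_axioms K.ring_axioms)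
  show "residual_map R S Q ` carrier ?k \<subseteq> carrier ?K"
    using residual_map_hom[OF is_cring subring_R Q] by (auto simp: ring_hom_def)
  show "carrier ?K \<subseteq> residual_map R S Q ` carrier ?k"
  proof
    fix y assume "y \<in> carrier ?K"
    then obtain a b where ab: "a \<in> carrier S" "b \<in> carrier S - Q" "y = residue_frac S Q a b"
      by (rule Q.residue_frac_cases)
    obtain s r where sr: "s \<in> R - Q" "r \<in> R" "s \<otimes> a \<ominus> r \<in> Q"
      using epimorphism_residually_surjective[OF epi Q ab(1)] by blast
    obtain s' r' where sr': "s' \<in> R - Q" "r' \<in> R" "s' \<otimes> b \<ominus> r' \<in> Q"
      using epimorphism_residually_surjective[OF epi Q] ab(2) by blast
    have c: "s \<in> carrier S" "r \<in> carrier S" "s' \<in> carrier S" "r' \<in> carrier S" "b \<in> carrier S"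
      using sr sr' ab(2) by auto
    \<comment> \<open>This makes \<open>s \<otimes> r'\<close> an admissible denominator.\<close>
    have r'_Q: "r' \<notin> Q"
    proof
      assume "r' \<in> Q"
      then have "(s' \<otimes> b \<ominus> r') \<oplus> r' \<in> Q" using sr'(3) by simp
      then have "s' \<otimes> b \<in> Q" using c by (simp add: a_minus_def a_assoc l_neg)
      then show False using Q.I_prime[OF c(3,5)] sr'(1) ab(2) by blast
    qed
    have \<rho>: "residue_frac S Q s \<one> \<otimes>\<^bsub>?K\<^esub> residue_frac S Q a \<one> = residue_frac S Q r \<one>"
      "residue_frac S Q s' \<one> \<otimes>\<^bsub>?K\<^esub> residue_frac S Q b \<one> = residue_frac S Q r' \<one>"
      using sr(3) sr'(3) c ab(1) diff_in_prime_iff[OF Q, of "s \<otimes> a" r] diff_in_prime_iff[OF Q, of "s' \<otimes> b" r']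
      by simp_all
    have sQ: "s \<otimes> r' \<in> R - Q"
      using sr(1) sr'(2) r'_Q R_mult[of s r'] Q.I_prime[of s r'] c by blast
    have "residue_frac S Q (a \<otimes> (s \<otimes> r')) \<one> = residue_frac S Q ((r \<otimes> s') \<otimes> b) \<one>"
      using c ab(1) by (simp flip: \<rho> add: K.m_ac)
    then have "y = residue_frac S Q (r \<otimes> s') (s \<otimes> r')"
      unfolding ab(3) using c ab sQ Q.residue_frac_eq_iff_mult[of a b "r \<otimes> s'" "s \<otimes> r'"] by simp
    also have "\<dots> = residual_map R S Q (residue_frac (S\<lparr>carrier := R\<rparr>) (Q \<inter> R) (r \<otimes> s') (s \<otimes> r'))"
      using sr(2) sr'(1) sQ R_mult by (intro residual_map_frac[OF is_cring subring_R Q, symmetric]) auto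
    finally show "y \<in> residual_map R S Q ` carrier ?k"
      using PR.residue_frac_closed[of "r \<otimes> s'" "s \<otimes> r'"] sr(2) sr'(1) sQ R_mult by simp
  qed
qed

text \<open>A surjective residual map is an isomorphism, so \<open>S\<close> maps to the residue
  field of the base with kernel \<open>Q\<close>. That target depends only on
  \<open>Q \<inter> R\<close>, which allows two primes with the same contraction to be
  compared.\<close>

lemma residue_factorization:
  assumes epi: "ring_epimorphism (S\<lparr>carrier := R\<rparr>) S (\<lambda>x. x)" and Q: "primeideal Q S"
  obtains g where "g \<in> ring_hom S (residue_field (S\<lparr>carrier := R\<rparr>) (Q \<inter> R))"
    "\<And>r. r \<in> R \<Longrightarrow> g r = residue_frac (S\<lparr>carrier := R\<rparr>) (Q \<inter> R) r \<one>"
    "\<And>a. a \<in> carrier S \<Longrightarrow> g a = \<zero>\<^bsub>residue_field (S\<lparr>carrier := R\<rparr>) (Q \<inter> R)\<^esub> \<longleftrightarrow> a \<in> Q"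
proof -
  interpret Q: primeideal Q S by (rule Q)
  interpret PR: primeideal "Q \<inter> R" "S\<lparr>carrier := R\<rparr>"
    by (rule primeideal_contraction[OF is_cring subring_R Q])
  let ?k = "residue_field (S\<lparr>carrier := R\<rparr>) (Q \<inter> R)" and ?K = "residue_field S Q"
  let ?\<theta> = "residual_map R S Q"
  interpret k: field ?k by (rule PR.field_residue_field)
  interpret K: field ?K by (rule Q.field_residue_field)
  have hom: "?\<theta> \<in> ring_hom ?k ?K" by (rule residual_map_hom[OF is_cring subring_R Q])
  have inj: "inj_on ?\<theta> (carrier ?k)"
    by (rule non_trivial_field_hom_is_inj[OF hom k.field_axioms K.field_axioms])
  have "?\<theta> \<in> ring_iso ?k ?K"
    using hom inj residual_map_surjective[OF epi Q] by (simp add: ring_iso_def bij_betw_def)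
  then have iso: "inv_into (carrier ?k) ?\<theta> \<in> ring_iso ?K ?k" by (rule ring_iso_set_sym[OF k.ring_axioms])
  then have inv_hom: "inv_into (carrier ?k) ?\<theta> \<in> ring_hom ?K ?k" by (simp add: ring_iso_def)
  interpret i: ring_hom_ring ?K ?k "inv_into (carrier ?k) ?\<theta>"
    by (intro ring_hom_ringI2 inv_hom k.ring_axioms K.ring_axioms)
  have inv_inj: "inj_on (inv_into (carrier ?k) ?\<theta>) (carrier ?K)"
    using iso by (simp add: ring_iso_def bij_betw_def)
  have one: "\<one> \<in> R - Q" using R_one Q.I_notcarr Q.one_imp_carrier by blast
  define g where "g a = inv_into (carrier ?k) ?\<theta> (residue_frac S Q a \<one>)" for a
  have \<rho>_closed: "residue_frac S Q a \<one> \<in> carrier ?K" if "a \<in> carrier S" for a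
    using Q.residue_frac_hom that by (auto simp: ring_hom_def)
  show ?thesis
  proof
    have "inv_into (carrier ?k) ?\<theta> \<circ> (\<lambda>a. residue_frac S Q a \<one>) \<in> ring_hom S ?k"
      using Q.residue_frac_hom inv_hom by (rule ring_hom_trans)
    then show "g \<in> ring_hom S ?k" by (simp add: g_def[abs_def] o_def)
    show "g r = residue_frac (S\<lparr>carrier := R\<rparr>) (Q \<inter> R) r \<one>" if "r \<in> R" for r
      unfolding g_def residual_map_frac[OF is_cring subring_R Q that one, symmetric]
      using inj PR.residue_frac_closed[of r \<one>] that one by (intro inv_into_f_f) auto
    show "g a = \<zero>\<^bsub>?k\<^esub> \<longleftrightarrow> a \<in> Q" if a: "a \<in> carrier S" for a
    proof -
      have "g a = \<zero>\<^bsub>?k\<^esub> \<longleftrightarrow> residue_frac S Q a \<one> = \<zero>\<^bsub>?K\<^esub>"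
        unfolding g_def using inv_inj \<rho>_closed[OF a] K.zero_closed i.hom_zero by (metis inj_onD)
      then show ?thesis using Q.residue_frac_eq_zero_iff[OF a] by simp
    qed
  qed
qed

lemma radicial_if_epimorphism:
  assumes epi: "ring_epimorphism (S\<lparr>carrier := R\<rparr>) S (\<lambda>x. x)"
  shows "radicial R S"
  unfolding radicial_def
proof
  show "kappa_radicial R S"
    unfolding kappa_radicial_def purely_inseparable_def
  proof (intro allI impI conjI ballI)
    fix Q assume Q: "primeideal Q S"
    interpret Q: primeideal Q S by (rule Q)
    interpret PR: primeideal "Q \<inter> R" "S\<lparr>carrier := R\<rparr>"
      by (rule primeideal_contraction[OF is_cring subring_R Q])
    let ?k = "residue_field (S\<lparr>carrier := R\<rparr>) (Q \<inter> R)" and ?K = "residue_field S Q"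
    show "field ?k" by (rule PR.field_residue_field)
    show "field ?K" by (rule Q.field_residue_field)
    then interpret K: field ?K .
    show "residual_map R S Q \<in> ring_hom ?k ?K" by (rule residual_map_hom[OF is_cring subring_R Q])
    fix y assume "y \<in> carrier ?K"
    \<comment> \<open>All of \<open>?K\<close> is in the image, so the exponent \<open>n = 0\<close>
      serves.\<close>
    then have "y [^]\<^bsub>?K\<^esub> (char_exponent ?k ^ 0) \<in> residual_map R S Q ` carrier ?k"
      using residual_map_surjective[OF epi Q] by simp
    then show "\<exists>n. y [^]\<^bsub>?K\<^esub> (char_exponent ?k ^ n) \<in> residual_map R S Q ` carrier ?k" by (rule exI)
  qed
  show "i_extension R S"
    unfolding i_extension_def
  proof (rule inj_onI, clarify)
    fix Q Q' assume Q: "primeideal Q S" and Q': "primeideal Q' S" and eq: "Q \<inter> R = Q' \<inter> R"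
    let ?k = "residue_field (S\<lparr>carrier := R\<rparr>) (Q \<inter> R)"
    interpret PR: primeideal "Q \<inter> R" "S\<lparr>carrier := R\<rparr>"
      by (rule primeideal_contraction[OF is_cring subring_R Q])
    interpret k: field ?k by (rule PR.field_residue_field)
    obtain g where g: "g \<in> ring_hom S ?k" "\<And>r. r \<in> R \<Longrightarrow> g r = residue_frac (S\<lparr>carrier := R\<rparr>) (Q \<inter> R) r \<one>"
      "\<And>a. a \<in> carrier S \<Longrightarrow> g a = \<zero>\<^bsub>?k\<^esub> \<longleftrightarrow> a \<in> Q" by (rule residue_factorization[OF epi Q]) blast
    obtain h where h: "h \<in> ring_hom S ?k" "\<And>r. r \<in> R \<Longrightarrow> h r = residue_frac (S\<lparr>carrier := R\<rparr>) (Q \<inter> R) r \<one>"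
      "\<And>a. a \<in> carrier S \<Longrightarrow> h a = \<zero>\<^bsub>?k\<^esub> \<longleftrightarrow> a \<in> Q'"
      unfolding eq by (rule residue_factorization[OF epi Q']) blast
    \<comment> \<open>Both morphisms restrict to the canonical map on \<open>R\<close>; once they
      are equal, so are their kernels \<open>Q\<close> and \<open>Q'\<close>.\<close>
    have "g a = h a" if "a \<in> carrier S" for a
      by (rule ring_epimorphism_any[OF epi ring_axioms k.is_cring g(1) h(1) _ that]) (simp add: g(2) h(2))
    then have "a \<in> Q \<longleftrightarrow> a \<in> Q'" if "a \<in> carrier S" for a using g(3) h(3) that by metis
    moreover have "Q \<subseteq> carrier S" "Q' \<subseteq> carrier S"
      using ideal.Icarr[OF primeideal.axioms(1)[OF Q]] ideal.Icarr[OF primeideal.axioms(1)[OF Q']] by auto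
    ultimately show "Q = Q'" by blast
  qed
qed

section \<open>Integral epimorphisms of finite type\<close>

text \<open>The span of \<open>1, a, \<dots>, a\<^sup>n\<^sup>-\<^sup>1\<close>.\<close>

fun power_span where
  "power_span a 0 = {\<zero>}"
| "power_span a (Suc n) = extend R (a [^] n) (power_span a n)"

lemma submod_power_span: "a \<in> carrier S \<Longrightarrow> submod (power_span a n)"
proof (induction n)
  case 0
  show ?case by (auto simp: submod_def)
next
  case (Suc n)
  then show ?case by (simp add: submod_extend submod_R)
qed

lemma R_subset_power_span:
  assumes "a \<in> carrier S"
  shows "R \<subseteq> power_span a (Suc n)"
proof (induction n)
  case 0
  show ?case using extendI[of _ R \<zero> "{\<zero>}" \<one>] by auto
next
  case (Suc n)
  then show ?case
    using subset_extend[OF submod_R submod_power_span[OF assms, of "Suc n"], of "a [^] Suc n"] assms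
    unfolding power_span.simps(2)[of a "Suc n"] by blast
qed

text \<open>\<open>eval\<close> reads the leading coefficient first, so the head of
  \<open>c # p\<close> belongs to the power \<open>length p\<close>, as in the outermost
  \<open>extend\<close>.\<close>

lemma eval_in_power_span:
  assumes "a \<in> carrier S" "set p \<subseteq> R"
  shows "eval p a \<in> power_span a (length p)"
  using assms(2)
proof (induction p)
  case (Cons c p)
  then show ?case using assms(1) by (auto intro!: extendI)
qed simp

lemma power_span_mult:
  assumes a: "a \<in> carrier S"
  shows "w \<in> power_span a n \<Longrightarrow> a \<otimes> w \<in> power_span a (Suc n)"
proof (induction n arbitrary: w)
  case 0
  then show ?case using a submodD(2)[OF submod_power_span[OF a]] by (simp del: power_span.simps(2))
next
  case (Suc n)
  from Suc.prems obtain c v where cv: "c \<in> R" "v \<in> power_span a n" "w = c \<otimes> a [^] n \<oplus> v"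
    by (auto elim: extendE)
  have v: "v \<in> carrier S" using submodD(1)[OF submod_power_span[OF a] cv(2)] .
  have "a \<otimes> w = c \<otimes> a [^] Suc n \<oplus> a \<otimes> v"
    using cv(1,3) v a by (simp add: r_distr m_ac)
  then show ?case
    using extendI[OF cv(1) Suc.IH[OF cv(2)], of "a [^] Suc n"] by (simp del: nat_pow_Suc)
qed

text \<open>The relation for \<open>a [^] d\<close> makes the span stable under \<open>a\<close>,
  hence under the whole ring generated by \<open>R\<close> and \<open>a\<close>. The bound
  \<open>d > 0\<close> puts \<open>\<one>\<close> into the span.\<close>

lemma power_span_eq_carrier:
  assumes a: "a \<in> carrier S" and gen: "generate_ring S (R \<union> {a}) = carrier S"
    and d: "a [^] d \<in> power_span a d" "d > 0"
  shows "power_span a d = carrier S"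
proof -
  note W = submod_power_span[OF a, of d] and W' = submodD[OF submod_power_span[OF a, of d]]
  have aW: "a \<otimes> w \<in> power_span a d" if "w \<in> power_span a d" for w
  proof -
    \<comment> \<open>Multiplication by \<open>a\<close> can leave the span only through a multiple
      of \<open>a [^] d\<close>, which the relation brings back.\<close>
    from power_span_mult[OF a that] obtain c v where cv: "c \<in> R" "v \<in> power_span a d" "a \<otimes> w = c \<otimes> a [^] d \<oplus> v"
      by (auto elim: extendE)
    then show ?thesis using W'(3)[OF W'(4)[OF cv(1) d(1)] cv(2)] by simp
  qed
  have "s \<otimes> w \<in> power_span a d" if "s \<in> generate_ring S (R \<union> {a})" "w \<in> power_span a d" for s w
    using that
  proof (induction arbitrary: w rule: generate_ring.induct)
    case one
    then show ?case using W'(1) by simp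
  next
    case (incl h)
    then show ?case using aW W'(4) by blast
  next
    case (a_inv h)
    then show ?case using submod_minus[OF W] gen W'(1) by (simp add: l_minus)
  next
    case (eng_add h1 h2)
    then show ?case using W'(1,3) gen by (simp add: l_distr)
  next
    case (eng_mult h1 h2)
    then show ?case using W'(1) gen by (simp add: m_assoc)
  qed
  moreover have "\<one> \<in> power_span a d"
  proof -
    obtain n where "d = Suc n" using d(2) gr0_implies_Suc by blast
    then show ?thesis using R_subset_power_span[OF a, of n] R_one by blast
  qed
  ultimately have "carrier S \<subseteq> power_span a d" using gen by (metis r_one subsetI)
  then show ?thesis using W'(1) by blast
qed

text \<open>The inverse in the restricted ring is described relative to the carrier
  \<open>R\<close>; uniqueness of inverses identifies it with the one in \<open>S\<close>.\<close>

lemma base_minus: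
  assumes "r \<in> R"
  shows "\<ominus>\<^bsub>S\<lparr>carrier := R\<rparr>\<^esub> r = \<ominus> r"
proof -
  interpret B: cring "S\<lparr>carrier := R\<rparr>" using subcringI'[OF subring_R] subcring_iff R_carrier by blast
  show ?thesis by (rule B.minus_equality) (use assms R_minus in \<open>auto simp: l_neg\<close>)
qed

section \<open>A linear form modulo a maximal ideal\<close>

text \<open>The quotient of \<open>S\<close> by \<open>W\<close> is cyclic on the class of
  \<open>x\<close>, with annihilator \<open>J\<close>. If it were nonzero, a maximal
  \<open>M\<close> above \<open>J\<close> would give a linear form to \<open>R / M\<close> with
  value \<open>1\<close> at \<open>x\<close> and \<open>0\<close> on \<open>W\<close>, hence at
  \<open>\<one>\<close>.\<close>

lemma epimorphism_cyclic_quotient_zero: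
  assumes epi: "ring_epimorphism (S\<lparr>carrier := R\<rparr>) S (\<lambda>x. x)"
    and W: "submod W" "R \<subseteq> W" and x: "x \<in> carrier S" and ext: "extend R x W = carrier S"
  shows "x \<in> W"
proof (rule ccontr)
  assume xW: "x \<notin> W"
  note W' = submodD[OF W(1)]
  interpret B: cring "S\<lparr>carrier := R\<rparr>" using subcringI'[OF subring_R] subcring_iff R_carrier by blast
  define J where "J = {r \<in> R. r \<otimes> x \<in> W}"
  have "ideal J (S\<lparr>carrier := R\<rparr>)"
  proof (rule idealI)
    show "ring (S\<lparr>carrier := R\<rparr>)" by unfold_locales
    show "subgroup J (add_monoid (S\<lparr>carrier := R\<rparr>))"
    proof (rule B.add.subgroupI)
      have "\<zero> \<in> J" using R_zero W'(2) x by (simp add: J_def)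
      then show "J \<noteq> {}" by blast
      show "\<ominus>\<^bsub>S\<lparr>carrier := R\<rparr>\<^esub> r \<in> J" if "r \<in> J" for r
        using that x submod_minus[OF W(1)] R_minus by (simp add: J_def base_minus l_minus)
      show "r \<oplus>\<^bsub>S\<lparr>carrier := R\<rparr>\<^esub> r' \<in> J" if "r \<in> J" "r' \<in> J" for r r'
        using that x W'(3) R_add by (simp add: J_def l_distr)
    qed (auto simp: J_def)
    show "s \<otimes>\<^bsub>S\<lparr>carrier := R\<rparr>\<^esub> r \<in> J" if "r \<in> J" "s \<in> carrier (S\<lparr>carrier := R\<rparr>)" for r s
      using that x W'(4) R_mult by (simp add: J_def m_assoc)
    show "r \<otimes>\<^bsub>S\<lparr>carrier := R\<rparr>\<^esub> s \<in> J" if "r \<in> J" "s \<in> carrier (S\<lparr>carrier := R\<rparr>)" for r s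
      using that x W'(4) R_mult by (simp add: J_def m_comm[of r s] m_assoc)
  qed
  moreover have "J \<noteq> carrier (S\<lparr>carrier := R\<rparr>)"
  proof -
    have "\<one> \<notin> J" using x xW by (simp add: J_def)
    then show ?thesis using R_one by auto
  qed
  ultimately obtain M where "maximalideal M (S\<lparr>carrier := R\<rparr>)" and JM: "J \<subseteq> M"
    using B.exists_maximalideal_above by blast
  then interpret M: maximalideal M "S\<lparr>carrier := R\<rparr>" by simp
  have MR: "M \<subseteq> R" using M.a_subset by simp
  have one_M: "\<one> \<notin> M" using M.one_imp_carrier M.I_notcarr by auto
  have M: "submod M"
    unfolding submod_def using MR R_carrier M.zero_closed M.a_closed M.I_l_closed by auto
  \<comment> \<open>Otherwise \<open>\<one> \<ominus> m\<close> annihilates \<open>x\<close> modulo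
    \<open>W\<close>, so it lies in \<open>J \<subseteq> M\<close>, and \<open>\<one>\<close> would
    lie in \<open>M\<close>.\<close>
  have x_ext: "x \<notin> extend M x W"
  proof
    assume "x \<in> extend M x W"
    then obtain m w where mw: "m \<in> M" "w \<in> W" "x = m \<otimes> x \<oplus> w" by (rule extendE)
    have c: "m \<in> R" "w \<in> carrier S" using mw MR W' by auto
    have "(\<one> \<ominus> m) \<otimes> x = x \<ominus> m \<otimes> x" using c x by (simp add: a_minus_def l_distr l_minus)
    also have "\<dots> = (m \<otimes> x \<oplus> w) \<ominus> m \<otimes> x" using mw(3) by simp
    also have "\<dots> = w" using c x by (simp add: a_minus_def a_assoc a_comm[of w] r_neg2)
    finally have "\<one> \<ominus> m \<in> J" using mw(2) c R_one R_add R_minus by (simp add: J_def a_minus_def)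
    then have "(\<one> \<ominus> m) \<oplus> m \<in> M" using JM submodD(3)[OF M] mw(1) by blast
    then show False using one_M c by (simp add: a_minus_def a_assoc l_neg)
  qed
  have EW: "submod (extend M x W)" by (rule submod_extend[OF M W(1) x])
  note EW' = submodD[OF EW]
  \<comment> \<open>The largest ideal of \<open>S\<close> inside \<open>M x + W\<close>; the test
    element \<open>s = x\<close> shows that it is proper.\<close>
  define K where "K = {u \<in> carrier S. \<forall>s \<in> carrier S. u \<otimes> s \<in> extend M x W}"
  have K: "ideal K S"
  proof (rule idealI)
    show "ring S" by (rule ring_axioms)
    show "subgroup K (add_monoid S)"
    proof (rule add.subgroupI)
      have "\<zero> \<in> K" using EW'(2) by (simp add: K_def)
      then show "K \<noteq> {}" by blast
    qed (use EW'(3) submod_minus[OF EW] in \<open>auto simp: K_def l_minus l_distr\<close>)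
  qed (auto simp: K_def m_assoc m_comm m_lcomm)
  interpret K: ideal K S by (rule K)
  interpret SK: cring "S Quot K" by (rule K.quotient_is_cring[OF is_cring])
  interpret \<pi>: ring_hom_ring S "S Quot K" "\<lambda>u. K +> u" by (rule K.rcos_ring_hom_ring)
  have decomp: "\<exists>c w. c \<in> R \<and> w \<in> W \<and> u = c \<otimes> x \<oplus> w" if "u \<in> carrier S" for u
    using that unfolding ext[symmetric] by (auto elim: extendE)
  \<comment> \<open>Since \<open>S = R x + W\<close>, the multiples of elements of \<open>M\<close>
    stay in \<open>M x + W\<close>.\<close>
  have MK: "M \<subseteq> K"
  proof
    fix m assume m: "m \<in> M"
    have "m \<otimes> u \<in> extend M x W" if u: "u \<in> carrier S" for u
    proof -
      obtain c w where cw: "c \<in> R" "w \<in> W" "u = c \<otimes> x \<oplus> w" using decomp[OF u] by blast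
      have "m \<otimes> u = (c \<otimes> m) \<otimes> x \<oplus> m \<otimes> w" using cw m MR x W'(1) by (simp add: r_distr m_ac subsetD)
      then show ?thesis using extendI[OF submodD(4)[OF M cw(1) m] W'(4)[OF _ cw(2)]] m MR by auto
    qed
    moreover have "m \<in> carrier S" using m MR R_carrier by blast
    ultimately show "m \<in> K" unfolding K_def by blast
  qed
  \<comment> \<open>The linear form \<open>S \<rightarrow> R / M\<close> with kernel \<open>M x + W\<close>, lifted to \<open>R\<close>; the target of the balanced
    map is \<open>S / K\<close>, which is nonzero because \<open>x \<notin> M x + W\<close>.\<close>
  define \<gamma> where "\<gamma> u = (SOME c. c \<in> R \<and> (\<exists>w \<in> W. u = c \<otimes> x \<oplus> w))" for u
  have \<gamma>: "\<gamma> u \<in> R" "\<exists>w \<in> W. u = \<gamma> u \<otimes> x \<oplus> w" if "u \<in> carrier S" for u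
    using someI_ex[of "\<lambda>c. c \<in> R \<and> (\<exists>w \<in> W. u = c \<otimes> x \<oplus> w)"] decomp[OF that] unfolding \<gamma>_def by blast+
  \<comment> \<open>Two possible coefficients of \<open>x\<close> differ by an element of
    \<open>J\<close>, and \<open>J \<subseteq> M \<subseteq> K\<close>; thus the choice made by
    \<open>\<gamma>\<close> is invisible modulo \<open>K\<close>.\<close>
  have \<gamma>_eq: "K +> \<gamma> u = K +> c" if c: "c \<in> R" "w \<in> W" "u = c \<otimes> x \<oplus> w" for u c w
  proof -
    have u: "u \<in> carrier S" using c x W'(1) by simp
    obtain w' where w': "w' \<in> W" "u = \<gamma> u \<otimes> x \<oplus> w'" using \<gamma>(2)[OF u] by blast
    have cc: "w \<in> carrier S" "w' \<in> carrier S" "\<gamma> u \<in> carrier S" "c \<in> carrier S" using c w' W'(1) \<gamma>(1)[OF u] by auto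
    have "\<gamma> u \<otimes> x = u \<ominus> w'"
      using w'(2) cc x by (metis a_minus_def add.inv_solve_right m_closed u)
    then have "(\<gamma> u \<ominus> c) \<otimes> x = u \<ominus> w' \<ominus> c \<otimes> x" using cc x by (simp add: a_minus_def l_distr l_minus)
    also have "\<dots> = w \<ominus> w'" unfolding c(3) using cc x by (simp add: a_minus_def a_ac r_neg2 r_neg1 r_neg)
    finally have "\<gamma> u \<ominus> c \<in> J"
      using submod_diff[OF W(1) c(2) w'(1)] submod_diff[OF submod_R \<gamma>(1)[OF u] c(1)] by (simp add: J_def)
    then have "\<gamma> u \<ominus> c \<in> K" using JM MK by blast
    then show ?thesis using quotient_eq_iff_same_a_r_cos[OF K cc(3,4)] by simp
  qed
  have "(K +> \<gamma> x) \<otimes>\<^bsub>S Quot K\<^esub> (K +> \<one>) = (K +> \<gamma> \<one>) \<otimes>\<^bsub>S Quot K\<^esub> (K +> x)"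
  proof (rule epimorphism_imp_balanced_eq[OF epi SK.abelian_group_axioms _ _ _ _ x,
        where \<beta> = "\<lambda>a b. (K +> \<gamma> a) \<otimes>\<^bsub>S Quot K\<^esub> (K +> b)"])
    show "(K +> \<gamma> a) \<otimes>\<^bsub>S Quot K\<^esub> (K +> b) \<in> carrier (S Quot K)" if "a \<in> carrier S" "b \<in> carrier S" for a b
      using that \<gamma>(1) by simp
    show "(K +> \<gamma> a) \<otimes>\<^bsub>S Quot K\<^esub> (K +> (b \<oplus> b')) =
      (K +> \<gamma> a) \<otimes>\<^bsub>S Quot K\<^esub> (K +> b) \<oplus>\<^bsub>S Quot K\<^esub> (K +> \<gamma> a) \<otimes>\<^bsub>S Quot K\<^esub> (K +> b')"
      if "a \<in> carrier S" "b \<in> carrier S" "b' \<in> carrier S" for a b b'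
      using that \<gamma>(1) by (simp add: SK.r_distr)
    show "(K +> \<gamma> (a \<oplus> a')) \<otimes>\<^bsub>S Quot K\<^esub> (K +> b) =
      (K +> \<gamma> a) \<otimes>\<^bsub>S Quot K\<^esub> (K +> b) \<oplus>\<^bsub>S Quot K\<^esub> (K +> \<gamma> a') \<otimes>\<^bsub>S Quot K\<^esub> (K +> b)"
      if a: "a \<in> carrier S" "a' \<in> carrier S" and b: "b \<in> carrier S" for a a' b
    proof -
      obtain w w' where w: "w \<in> W" "a = \<gamma> a \<otimes> x \<oplus> w" "w' \<in> W" "a' = \<gamma> a' \<otimes> x \<oplus> w'"
        using \<gamma>(2) a by blast
      have "(\<gamma> a \<otimes> x \<oplus> w) \<oplus> (\<gamma> a' \<otimes> x \<oplus> w') = (\<gamma> a \<oplus> \<gamma> a') \<otimes> x \<oplus> (w \<oplus> w')"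
        using \<gamma>(1) a x W'(1) w(1,3) by (simp add: l_distr a_ac)
      then have "a \<oplus> a' = (\<gamma> a \<oplus> \<gamma> a') \<otimes> x \<oplus> (w \<oplus> w')" using w(2,4) by simp
      from \<gamma>_eq[OF _ _ this] have "K +> \<gamma> (a \<oplus> a') = (K +> \<gamma> a) \<oplus>\<^bsub>S Quot K\<^esub> (K +> \<gamma> a')"
        using \<gamma>(1) a R_add W'(3) w(1,3) by simp
      then show ?thesis using \<gamma>(1) a b by (simp add: SK.l_distr)
    qed
    show "(K +> \<gamma> (r \<otimes> a)) \<otimes>\<^bsub>S Quot K\<^esub> (K +> b) = (K +> \<gamma> a) \<otimes>\<^bsub>S Quot K\<^esub> (K +> (r \<otimes> b))"
      if r: "r \<in> R" and a: "a \<in> carrier S" and b: "b \<in> carrier S" for r a b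
    proof -
      obtain w where w: "w \<in> W" "a = \<gamma> a \<otimes> x \<oplus> w" using \<gamma>(2) a by blast
      have "r \<otimes> (\<gamma> a \<otimes> x \<oplus> w) = (r \<otimes> \<gamma> a) \<otimes> x \<oplus> r \<otimes> w"
        using \<gamma>(1) a x r W'(1) w(1) by (simp add: r_distr m_assoc)
      then have "r \<otimes> a = (r \<otimes> \<gamma> a) \<otimes> x \<oplus> r \<otimes> w" using w(2) by simp
      from \<gamma>_eq[OF _ _ this] have "K +> \<gamma> (r \<otimes> a) = (K +> r) \<otimes>\<^bsub>S Quot K\<^esub> (K +> \<gamma> a)"
        using \<gamma>(1) a r R_mult W'(4) w(1) by simp
      then show ?thesis using \<gamma>(1) a b r by (simp add: SK.m_ac)
    qed
  qed
  \<comment> \<open>The decompositions are \<open>x = \<one> \<otimes> x \<oplus> \<zero>\<close>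
    and \<open>\<one> = \<zero> \<otimes> x \<oplus> \<one>\<close>, the latter because
    \<open>R \<subseteq> W\<close>.\<close>
  moreover have "K +> \<gamma> x = K +> \<one>" by (rule \<gamma>_eq[OF R_one W'(2)]) (use x in simp)
  moreover have "K +> \<gamma> \<one> = K +> \<zero>" by (rule \<gamma>_eq[OF R_zero, of \<one>]) (use x R_one W(2) in auto)
  ultimately have "K +> \<one> = K +> \<zero>" using x by simp
  then have "\<one> \<in> K"
    using quotient_eq_iff_same_a_r_cos[OF K one_closed zero_closed] by (simp add: a_minus_def)
  then have "\<one> \<otimes> x \<in> extend M x W" using x unfolding K_def by blast
  then show False using x x_ext by simp
qed

section \<open>Induction on integral generators\<close>

text \<open>Take the least \<open>d\<close> with \<open>a [^] d\<close> in the span of the lower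
  powers. If \<open>d = Suc e\<close> with \<open>e > 0\<close>, the span of the powers below
  \<open>e\<close> contains \<open>R\<close>, and the cyclic quotient lemma puts
  \<open>a [^] e\<close> into it, against minimality.\<close>

lemma epimorphism_monogenic_integral_trivial:
  assumes epi: "ring_epimorphism (S\<lparr>carrier := R\<rparr>) S (\<lambda>x. x)"
    and a: "a \<in> carrier S" and gen: "generate_ring S (R \<union> {a}) = carrier S"
    and p: "set p \<subseteq> R" "eval (\<one> # p) a = \<zero>"
  shows "R = carrier S"
proof -
  let ?n = "length p"
  have ec: "eval p a \<in> carrier S" using p(1) R_carrier a by (intro eval_in_carrier) auto
  have "a [^] ?n \<oplus> eval p a = \<zero>" using p(2) a by simp
  then have "a [^] ?n = \<ominus> eval p a" using a ec by (metis minus_equality nat_pow_closed)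
  then have ex: "a [^] ?n \<in> power_span a ?n"
    using submod_minus[OF submod_power_span[OF a] eval_in_power_span[OF a p(1)]] by simp
  define d where "d = (LEAST d. a [^] d \<in> power_span a d)"
  have d: "a [^] d \<in> power_span a d" unfolding d_def using ex by (rule LeastI)
  show ?thesis
  proof (cases d)
    case 0
    \<comment> \<open>The empty span is \<open>{\<zero>}\<close>, so \<open>d = 0\<close> means that
      \<open>S\<close> is the zero ring.\<close>
    then have "\<one> = \<zero>" using d by simp
    then have "carrier S = {\<zero>}" by (metis one_zeroD)
    then show ?thesis using R_carrier R_zero by auto
  next
    case (Suc e)
    have full: "extend R (a [^] e) (power_span a e) = carrier S"
      using power_span_eq_carrier[OF a gen d] Suc by simp
    have "a [^] e \<notin> power_span a e" using not_less_Least[of e "\<lambda>d. a [^] d \<in> power_span a d"] Suc by (simp add: d_def)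
    moreover have "a [^] e \<in> power_span a e" if "R \<subseteq> power_span a e"
      by (rule epimorphism_cyclic_quotient_zero[OF epi submod_power_span[OF a] that _ full]) (use a in simp)
    ultimately have e: "\<not> R \<subseteq> power_span a e" by blast
    with R_subset_power_span[OF a] have "e = 0" by (cases e) auto
    then have "extend R \<one> {\<zero>} = carrier S" using full by simp
    then have "carrier S \<subseteq> R" by (auto simp: extend_def)
    then show ?thesis using R_carrier by blast
  qed
qed

text \<open>Generators are removed from the top: \<open>S\<close> is generated by \<open>a\<close>
  over \<open>?R'\<close>, and the inclusion of \<open>?R'\<close> is again an epimorphism. Hence
  \<open>?R' = carrier S\<close>, so \<open>A\<close> alone generates and the induction hypothesis
  applies to the original base \<open>R\<close>.\<close>

lemma epimorphism_integral_finite_type_trivial: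
  assumes epi: "ring_epimorphism (S\<lparr>carrier := R\<rparr>) S (\<lambda>x. x)"
    and int: "integral_extension R S" and ft: "finite_type R S"
  shows "R = carrier S"
proof -
  have "generate_ring S (R \<union> A) = carrier S \<longrightarrow> R = carrier S" if "finite A" "A \<subseteq> carrier S" for A
    using that
  proof (induction A)
    case empty
    have "generate_ring S R = R"
      using generate_ring_min_subring1[OF R_carrier subring_R] generate_ring.incl[of _ R S] by blast
    then show ?case by simp
  next
    case (insert a A)
    show ?case
    proof
      assume gen: "generate_ring S (R \<union> insert a A) = carrier S"
      let ?R' = "generate_ring S (R \<union> A)"
      have RA: "R \<union> A \<subseteq> carrier S" using R_carrier insert.prems by blast
      interpret R': ring_extension S ?R'
        by (intro ring_extension.intro ring_extension_axioms.intro cring_axioms generate_ring_is_subring[OF RA])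
      have incl: "R \<union> A \<subseteq> ?R'" by (auto intro: generate_ring.incl)
      have aS: "a \<in> carrier S" using insert.prems by blast
      have R'a: "?R' \<union> {a} \<subseteq> carrier S" using R'.R_carrier aS by blast
      have "generate_ring S (R \<union> insert a A) \<subseteq> generate_ring S (?R' \<union> {a})"
        by (rule generate_ring_min_subring1[OF _ generate_ring_is_subring[OF R'a]])
           (use RA aS incl generate_ring.incl[of _ "?R' \<union> {a}" S] in blast)+
      then have gen': "generate_ring S (?R' \<union> {a}) = carrier S"
        using gen generate_ring_incl[OF R'a] by simp
      \<comment> \<open>Morphisms that agree on \<open>?R'\<close> agree on \<open>R\<close>, where
        the given epimorphism decides.\<close>
      have "ring_epimorphism (S\<lparr>carrier := ?R'\<rparr>) S (\<lambda>x. x)"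
        unfolding ring_epimorphism_def
      proof (intro conjI allI impI ballI)
        show "(\<lambda>x. x) \<in> ring_hom (S\<lparr>carrier := ?R'\<rparr>) S" by (rule ring_hom_memI) auto
        show "g b = h b" if "cring B" "g \<in> ring_hom S B" "h \<in> ring_hom S B"
          "\<forall>a \<in> carrier (S\<lparr>carrier := ?R'\<rparr>). g a = h a" "b \<in> carrier S"
          for B :: "('a \<times> 'a) list ring" and g h b
          by (rule ring_epimorphism_any[OF epi ring_axioms that(1-3) _ that(5)]) (use that(4) incl in auto)
      qed
      moreover obtain p where "set p \<subseteq> R" "eval (\<one> # p) a = \<zero>"
        using int aS unfolding integral_extension_def by blast
      ultimately have "?R' = carrier S"
        using R'.epimorphism_monogenic_integral_trivial[OF _ aS gen', of p] incl by auto
      then show "R = carrier S" using insert by blast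
    qed
  qed
  then show ?thesis using ft unfolding finite_type_def by blast
qed

end

theorem proposition4p2:
  fixes S :: "('a, 'b) ring_scheme" and R :: "'a set"
  assumes "cring S" and "subring R S"
  shows "(finite_type R S \<longrightarrow>
            (ring_epimorphism (S\<lparr>carrier := R\<rparr>) S (\<lambda>x. x) \<longleftrightarrow> radicial R S \<and> unramified R S)) \<and>
         (integral_extension R S \<and> FCP_extension R S \<and> radicial R S \<and> unramified R S \<longrightarrow>
            R = carrier S)"
proof -
  interpret ring_extension S R
    using assms by (simp add: ring_extension_def ring_extension_axioms_def)
  \<comment> \<open>For an epimorphism the ideal \<open>I\<close> is zero, and with it its quotient
    by its square.\<close>
  have "unramified R S" if "finite_type R S" "ring_epimorphism (S\<lparr>carrier := R\<rparr>) S (\<lambda>x. x)"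
    using that trivial_differentials_if_diagonal_zero
    unfolding epimorphism_iff_diagonal_zero unramified_def by blast
  then show ?thesis
    using radicial_if_epimorphism epimorphism_if_radicial_unramified
      epimorphism_integral_finite_type_trivial unfolding unramified_def by blast
qed

end
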